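(* Let $(M=B\times_f F,g^f,\Pi)$ be an Einstein Poisson warped product space with $Ric=\lambda g^f$, with $\dim B=s_1\geq2$, where $f$ is a Casimir function on $(B,\Pi_B)$. Let $\hat\lambda$ be the constant such that $Ric_F=\hat\lambda g_F$, and suppose $\hat\lambda<0$. Then: (a) if $\lambda>0$, then no such warping function $f$ exists; (b) if $\lambda<0$, then $f=\sqrt{\lambda/\hat\lambda}$.
   Context: Contravariant geometry. Let $(N,\Pi)$ be a Poisson manifold with Poisson bivector field $\Pi$. The anchor map $\sharp_\Pi:T^*N\to TN$ is defined by $\beta(\sharp_\Pi(\alpha))=\Pi(\alpha,\beta)$. The Koszul bracket on 1-forms is $[\alpha,\beta]_\Pi=\mathcal L_{\sharp_\Pi(\alpha)}\beta-\mathcal L_{\sharp_\Pi(\beta)}\alpha-d(\Pi(\alpha,\beta))$. A pseudo-Riemannian metric $\tilde g$ on $N$ induces a metric $g$ on $T^*N$ (its cometric) through the isomorphism $X\mapsto\tilde g(X,\cdot)$. The contravariant Levi-Civita connection of $(\Pi,g)$ is the unique $\mathbb R$-bilinear map $\mathcal D:\Gamma(T^*N)\times\Gamma(T^*N)\to\Gamma(T^*N)$ with $\mathcal D_{u\alpha}\beta=u\mathcal D_\alpha\beta$, $\mathcal D_\alpha(u\beta)=u\mathcal D_\alpha\beta+\sharp_\Pi(\alpha)(u)\beta$ for $u\in C^\infty(N)$, $\mathcal D_\alpha\beta-\mathcal D_\beta\alpha=[\alpha,\beta]_\Pi$, and $\sharp_\Pi(\alpha)(g(\beta,\gamma))=g(\mathcal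 D_\alpha\beta,\gamma)+g(\beta,\mathcal D_\alpha\gamma)$. Its curvature is $\mathcal R(\alpha,\beta)\gamma=\mathcal D_\alpha\mathcal D_\beta\gamma-\mathcal D_\beta\mathcal D_\alpha\gamma-\mathcal D_{[\alpha,\beta]_\Pi}\gamma$. For a local $g$-orthonormal coframe $\{\eta_i\}$ with $\varepsilon_i=g(\eta_i,\eta_i)=\pm1$, the Ricci curvature is $Ric(\alpha,\beta)=\sum_i\varepsilon_i\,g(\mathcal R(\alpha,\eta_i)\eta_i,\beta)$. The triple $(N,g,\Pi)$ is a (pseudo-)Riemannian Poisson manifold if $\mathcal D\Pi=0$, i.e. $\sharp_\Pi(\alpha)(\Pi(\beta,\gamma))-\Pi(\mathcal D_\alpha\beta,\gamma)-\Pi(\beta,\mathcal D_\alpha\gamma)=0$ for all 1-forms $\alpha,\beta,\gamma$. A function $f$ is Casimir if $\sharp_\Pi(df)=0$. Warped products. Let $(B,\tilde g_B)$, $(F,\tilde g_F)$ be pseudo-Riemannian manifolds of positive dimensions with cometrics $g_B,g_F$ and Poisson bivector fields $\Pi_B,\Pi_F$; let $f>0$ be a smooth function on $B$ (the warping function), and let $\pi,\sigma$ be the projections of $B\times F$ onto $B$ and $F$. Put $u^h=u\circ\pi$, $\alpha_1^h=\pi^*\alpha_1$ for functions and 1-forms on $B$, and $w^v=w\circ\sigma$, $\alpha_2^v=\sigma^*\alpha_2$ for functions and 1-forms on $F$. On $M=B\times_fF$ (the manifold $B\times F$) one takes the warped metric $\tilde g^f=\pi^*\tilde g_B+(f^h)^2\sigma^*\tilde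 g_F$, whose cometric $g^f$ satisfies $g^f(\alpha_1^h,\beta_1^h)=g_B(\alpha_1,\beta_1)^h$, $g^f(\alpha_1^h,\beta_2^v)=0$, $g^f(\alpha_2^v,\beta_2^v)=\frac1{(f^h)^2}g_F(\alpha_2,\beta_2)^v$, and the Poisson bivector $\Pi=\Pi_B+\Pi_F$ given by $\Pi(\alpha_1^h,\beta_1^h)=\Pi_B(\alpha_1,\beta_1)^h$, $\Pi(\alpha_1^h,\beta_2^v)=0$, $\Pi(\alpha_2^v,\beta_2^v)=\Pi_F(\alpha_2,\beta_2)^v$. $Ric,Ric_B,Ric_F$ are the Ricci curvatures of $(M,\Pi,g^f)$, $(B,\Pi_B,g_B)$, $(F,\Pi_F,g_F)$. The triple $(M,g^f,\Pi)$ is an Einstein Poisson warped product space if it is a (pseudo-)Riemannian Poisson manifold, $f$ is Casimir on $(B,\Pi_B)$, and $Ric=\lambda g^f$ for a constant $\lambda$; in that case $Ric_F=\hat\lambda g_F$ for a constant $\hat\lambda$. *)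

theory Defs
  imports "HOL-Analysis.Analysis"
begin

section \<open>Smooth manifolds\<close>

primrec Ck_on :: "nat \<Rightarrow> 'e::real_normed_vector set \<Rightarrow> ('e \<Rightarrow> 'w::real_normed_vector) \<Rightarrow> bool" where
  "Ck_on 0 S f \<longleftrightarrow> continuous_on S f"
| "Ck_on (Suc k) S f \<longleftrightarrow>
     (\<forall>y\<in>S. f differentiable (at y)) \<and> (\<forall>v. Ck_on k S (\<lambda>y. frechet_derivative f (at y) v))"

text \<open>Only used for open \<open>S\<close>.\<close>

definition smooth_on :: "'e::real_normed_vector set \<Rightarrow> ('e \<Rightarrow> 'w::real_normed_vector) \<Rightarrow> bool" where
  "smooth_on S f \<longleftrightarrow> (\<forall>k. Ck_on k S f)"

record ('a, 'e) chart =
  chart_dom :: "'a set"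
  chart_map :: "'a \<Rightarrow> 'e"

abbreviation chart_image :: "('a, 'e) chart \<Rightarrow> 'e set" where
  "chart_image c \<equiv> chart_map c ` chart_dom c"

abbreviation chart_inv :: "('a, 'e) chart \<Rightarrow> 'e \<Rightarrow> 'a" where
  "chart_inv c \<equiv> inv_into (chart_dom c) (chart_map c)"

text \<open>
  A manifold modelled on \<open>'e\<close> (so of dimension \<open>DIM('e)\<close>, which is positive) has the type \<open>'a\<close>
  as its set of points. It carries a smooth atlas, which need not be maximal, and for each point
  a preferred chart around it. The tangent space at \<open>x\<close> is the model space \<open>'e\<close>: a vector of
  \<open>'e\<close> stands for the tangent vector at \<open>x\<close> having these components in the chart \<open>chart_at N x\<close>.
  Covectors at \<open>x\<close> are accordingly the linear forms on \<open>'e\<close>.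
\<close>

record ('a, 'e) manifold =
  atlas :: "('a, 'e) chart set"
  chart_at :: "'a \<Rightarrow> ('a, 'e) chart"

definition is_chart :: "('a::topological_space, 'e::euclidean_space) chart \<Rightarrow> bool" where
  "is_chart c \<longleftrightarrow> open (chart_dom c) \<and> open (chart_image c) \<and>
     homeomorphism (chart_dom c) (chart_image c) (chart_map c) (chart_inv c)"

definition smooth_manifold ::
    "('a::{t2_space,second_countable_topology}, 'e::euclidean_space) manifold \<Rightarrow> bool" where
  "smooth_manifold N \<longleftrightarrow>
     (\<forall>c\<in>atlas N. is_chart c) \<and>
     (\<forall>x. chart_at N x \<in> atlas N \<and> x \<in> chart_dom (chart_at N x)) \<and>
     (\<forall>c\<in>atlas N. \<forall>d\<in>atlas N.
        smooth_on (chart_map c ` (chart_dom c \<inter> chart_dom d)) (chart_map d \<circ> chart_inv c))"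

definition smooth_functions ::
    "('a, 'e::euclidean_space) manifold \<Rightarrow> ('a \<Rightarrow> real) set" where
  "smooth_functions N = {u. \<forall>c\<in>atlas N. smooth_on (chart_image c) (u \<circ> chart_inv c)}"

definition differential ::
    "('a, 'e::euclidean_space) manifold \<Rightarrow> ('a \<Rightarrow> real) \<Rightarrow> 'a \<Rightarrow> ('e \<Rightarrow>\<^sub>L real)" where
  "differential N u x =
     Blinfun (frechet_derivative (u \<circ> chart_inv (chart_at N x)) (at (chart_map (chart_at N x) x)))"

definition tangent_map ::
    "('a, 'e::euclidean_space) manifold \<Rightarrow> ('b, 'd::euclidean_space) manifold \<Rightarrow>
     ('a \<Rightarrow> 'b) \<Rightarrow> 'a \<Rightarrow> ('e \<Rightarrow>\<^sub>L 'd)" where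
  "tangent_map N N' \<phi> x =
     Blinfun (frechet_derivative (chart_map (chart_at N' (\<phi> x)) \<circ> \<phi> \<circ> chart_inv (chart_at N x))
       (at (chart_map (chart_at N x) x)))"

section \<open>Vector fields, 1-forms, bivector fields and metrics\<close>

text \<open>
  The type synonyms describe arbitrary, not necessarily smooth, sections.
\<close>

type_synonym ('a, 'e) vector_field = "'a \<Rightarrow> 'e"
type_synonym ('a, 'e) form = "'a \<Rightarrow> ('e \<Rightarrow>\<^sub>L real)"
type_synonym ('a, 'e) metric = "'a \<Rightarrow> 'e \<Rightarrow> 'e \<Rightarrow> real"
type_synonym ('a, 'e) cotensor = "'a \<Rightarrow> ('e \<Rightarrow>\<^sub>L real) \<Rightarrow> ('e \<Rightarrow>\<^sub>L real) \<Rightarrow> real"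
type_synonym ('a, 'e) connection = "('a, 'e) form \<Rightarrow> ('a, 'e) form \<Rightarrow> ('a, 'e) form"

text \<open>Components in a chart \<open>c\<close>, as functions on the image of \<open>c\<close>.\<close>

definition vector_in_chart ::
    "('a, 'e::euclidean_space) manifold \<Rightarrow> ('a, 'e) vector_field \<Rightarrow> ('a, 'e) chart \<Rightarrow> 'e \<Rightarrow> 'e" where
  "vector_in_chart N X c y = (let x = chart_inv c y; k = chart_at N x in
     frechet_derivative (chart_map c \<circ> chart_inv k) (at (chart_map k x)) (X x))"

definition form_in_chart ::
    "('a, 'e::euclidean_space) manifold \<Rightarrow> ('a, 'e) form \<Rightarrow> ('a, 'e) chart \<Rightarrow> 'e \<Rightarrow> ('e \<Rightarrow>\<^sub>L real)" where
  "form_in_chart N \<omega> c y = (let x = chart_inv c y; k = chart_at N x in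
     \<omega> x o\<^sub>L Blinfun (frechet_derivative (chart_map k \<circ> chart_inv c) (at y)))"

definition vector_fields ::
    "('a, 'e::euclidean_space) manifold \<Rightarrow> ('a, 'e) vector_field set" where
  "vector_fields N = {X. \<forall>c\<in>atlas N. smooth_on (chart_image c) (vector_in_chart N X c)}"

definition one_forms ::
    "('a, 'e::euclidean_space) manifold \<Rightarrow> ('a, 'e) form set" where
  "one_forms N = {\<omega>. \<forall>c\<in>atlas N. smooth_on (chart_image c) (form_in_chart N \<omega> c)}"

text \<open>
  The Lie derivative in local coordinates,
  \<open>(L\<^sub>X \<beta>)\<^sub>i = X\<^sup>j \<partial>\<^sub>j \<beta>\<^sub>i + \<beta>\<^sub>j \<partial>\<^sub>i X\<^sup>j\<close>, in the preferred chart at \<open>x\<close>.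
\<close>

definition lie_derivative ::
    "('a, 'e::euclidean_space) manifold \<Rightarrow> ('a, 'e) vector_field \<Rightarrow> ('a, 'e) form \<Rightarrow> ('a, 'e) form" where
  "lie_derivative N X \<beta> x = (let k = chart_at N x; y = chart_map k x in
     Blinfun (\<lambda>v. frechet_derivative (form_in_chart N \<beta> k) (at y) (X x) v
                + \<beta> x (frechet_derivative (vector_in_chart N X k) (at y) v)))"

definition pseudo_riemannian_metric ::
    "('a, 'e::euclidean_space) manifold \<Rightarrow> ('a, 'e) metric \<Rightarrow> bool" where
  "pseudo_riemannian_metric N G \<longleftrightarrow>
     (\<forall>x. bilinear (G x) \<and> (\<forall>v w. G x v w = G x w v) \<and> (\<forall>v. (\<forall>w. G x v w = 0) \<longrightarrow> v = 0)) \<and>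
     (\<forall>X\<in>vector_fields N. \<forall>Y\<in>vector_fields N. (\<lambda>x. G x (X x) (Y x)) \<in> smooth_functions N)"

text \<open>The inverse of the isomorphism \<open>v \<mapsto> G(v, \<cdot>)\<close>.\<close>

definition metric_sharp :: "('a, 'e::euclidean_space) metric \<Rightarrow> 'a \<Rightarrow> ('e \<Rightarrow>\<^sub>L real) \<Rightarrow> 'e" where
  "metric_sharp G x a = (THE v. \<forall>w. G x v w = a w)"

definition cometric :: "('a, 'e::euclidean_space) metric \<Rightarrow> ('a, 'e) cotensor" where
  "cometric G x a b = G x (metric_sharp G x a) (metric_sharp G x b)"

definition bivector_field ::
    "('a, 'e::euclidean_space) manifold \<Rightarrow> ('a, 'e) cotensor \<Rightarrow> bool" where
  "bivector_field N P \<longleftrightarrow>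
     (\<forall>x. bilinear (P x) \<and> (\<forall>a b. P x a b = - P x b a)) \<and>
     (\<forall>\<alpha>\<in>one_forms N. \<forall>\<beta>\<in>one_forms N. (\<lambda>x. P x (\<alpha> x) (\<beta> x)) \<in> smooth_functions N)"

definition poisson_bracket ::
    "('a, 'e::euclidean_space) manifold \<Rightarrow> ('a, 'e) cotensor \<Rightarrow>
     ('a \<Rightarrow> real) \<Rightarrow> ('a \<Rightarrow> real) \<Rightarrow> ('a \<Rightarrow> real)" where
  "poisson_bracket N P u v = (\<lambda>x. P x (differential N u x) (differential N v x))"

definition poisson_bivector ::
    "('a, 'e::euclidean_space) manifold \<Rightarrow> ('a, 'e) cotensor \<Rightarrow> bool" where
  "poisson_bivector N P \<longleftrightarrow> bivector_field N P \<and>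
     (\<forall>u\<in>smooth_functions N. \<forall>v\<in>smooth_functions N. \<forall>w\<in>smooth_functions N. \<forall>x.
        poisson_bracket N P u (poisson_bracket N P v w) x
      + poisson_bracket N P v (poisson_bracket N P w u) x
      + poisson_bracket N P w (poisson_bracket N P u v) x = 0)"

section \<open>Contravariant geometry\<close>

definition anchor :: "('a, 'e::euclidean_space) cotensor \<Rightarrow> ('a, 'e) form \<Rightarrow> ('a, 'e) vector_field" where
  "anchor P \<alpha> x = (THE v. \<forall>b. blinfun_apply b v = P x (\<alpha> x) b)"

definition casimir :: "('a, 'e::euclidean_space) manifold \<Rightarrow> ('a, 'e) cotensor \<Rightarrow> ('a \<Rightarrow> real) \<Rightarrow> bool" where
  "casimir N P u \<longleftrightarrow> u \<in> smooth_functions N \<and> (\<forall>x. anchor P (differential N u) x = 0)"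

text \<open>The derivative \<open>\<sharp>\<^sub>P(\<alpha>)(u)\<close> of a function along the anchor of a 1-form.\<close>

definition anchor_deriv ::
    "('a, 'e::euclidean_space) manifold \<Rightarrow> ('a, 'e) cotensor \<Rightarrow> ('a, 'e) form \<Rightarrow> ('a \<Rightarrow> real) \<Rightarrow> ('a \<Rightarrow> real)" where
  "anchor_deriv N P \<alpha> u x = blinfun_apply (differential N u x) (anchor P \<alpha> x)"

definition koszul_bracket ::
    "('a, 'e::euclidean_space) manifold \<Rightarrow> ('a, 'e) cotensor \<Rightarrow>
     ('a, 'e) form \<Rightarrow> ('a, 'e) form \<Rightarrow> ('a, 'e) form" where
  "koszul_bracket N P \<alpha> \<beta> = (\<lambda>x. lie_derivative N (anchor P \<alpha>) \<beta> x
     - lie_derivative N (anchor P \<beta>) \<alpha> x - differential N (\<lambda>z. P z (\<alpha> z) (\<beta> z)) x)"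

text \<open>
  \<open>D\<close> is the contravariant Levi-Civita connection of \<open>(P, g)\<close>. These properties determine \<open>D\<close> on
  smooth 1-forms; its values on other sections are irrelevant.
\<close>

definition levi_civita ::
    "('a, 'e::euclidean_space) manifold \<Rightarrow> ('a, 'e) cotensor \<Rightarrow> ('a, 'e) cotensor \<Rightarrow>
     ('a, 'e) connection \<Rightarrow> bool" where
  "levi_civita N P g D \<longleftrightarrow>
     (\<forall>\<alpha>\<in>one_forms N. \<forall>\<beta>\<in>one_forms N. D \<alpha> \<beta> \<in> one_forms N) \<and>
     (\<forall>\<alpha>\<in>one_forms N. \<forall>\<beta>\<in>one_forms N. \<forall>\<gamma>\<in>one_forms N. \<forall>r s::real.
        D (\<lambda>x. r *\<^sub>R \<alpha> x + s *\<^sub>R \<beta> x) \<gamma> = (\<lambda>x. r *\<^sub>R D \<alpha> \<gamma> x + s *\<^sub>R D \<beta> \<gamma> x) \<and>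
        D \<gamma> (\<lambda>x. r *\<^sub>R \<alpha> x + s *\<^sub>R \<beta> x) = (\<lambda>x. r *\<^sub>R D \<gamma> \<alpha> x + s *\<^sub>R D \<gamma> \<beta> x)) \<and>
     (\<forall>u\<in>smooth_functions N. \<forall>\<alpha>\<in>one_forms N. \<forall>\<beta>\<in>one_forms N.
        D (\<lambda>x. u x *\<^sub>R \<alpha> x) \<beta> = (\<lambda>x. u x *\<^sub>R D \<alpha> \<beta> x) \<and>
        D \<alpha> (\<lambda>x. u x *\<^sub>R \<beta> x) = (\<lambda>x. u x *\<^sub>R D \<alpha> \<beta> x + anchor_deriv N P \<alpha> u x *\<^sub>R \<beta> x)) \<and>
     (\<forall>\<alpha>\<in>one_forms N. \<forall>\<beta>\<in>one_forms N.
        (\<lambda>x. D \<alpha> \<beta> x - D \<beta> \<alpha> x) = koszul_bracket N P \<alpha> \<beta>) \<and>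
     (\<forall>\<alpha>\<in>one_forms N. \<forall>\<beta>\<in>one_forms N. \<forall>\<gamma>\<in>one_forms N. \<forall>x.
        anchor_deriv N P \<alpha> (\<lambda>z. g z (\<beta> z) (\<gamma> z)) x = g x (D \<alpha> \<beta> x) (\<gamma> x) + g x (\<beta> x) (D \<alpha> \<gamma> x))"

definition curvature ::
    "('a, 'e::euclidean_space) manifold \<Rightarrow> ('a, 'e) cotensor \<Rightarrow> ('a, 'e) connection \<Rightarrow>
     ('a, 'e) form \<Rightarrow> ('a, 'e) form \<Rightarrow> ('a, 'e) form \<Rightarrow> ('a, 'e) form" where
  "curvature N P D \<alpha> \<beta> \<gamma> =
     (\<lambda>x. D \<alpha> (D \<beta> \<gamma>) x - D \<beta> (D \<alpha> \<gamma>) x - D (koszul_bracket N P \<alpha> \<beta>) \<gamma> x)"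

text \<open>
  Connections act on global 1-forms. A local coframe on \<open>U\<close> is therefore given by global 1-forms
  that are orthonormal at the points of \<open>U\<close>; after shrinking its domain, every local orthonormal
  coframe is of this kind (multiply by a bump function).
\<close>

definition local_orthonormal_coframe ::
    "('a::topological_space, 'e::euclidean_space) manifold \<Rightarrow> ('a, 'e) cotensor \<Rightarrow>
     'a set \<Rightarrow> (nat \<Rightarrow> real) \<Rightarrow> (nat \<Rightarrow> ('a, 'e) form) \<Rightarrow> bool" where
  "local_orthonormal_coframe N g U \<epsilon> \<eta> \<longleftrightarrow> open U \<and>
     (\<forall>i<DIM('e). \<eta> i \<in> one_forms N \<and> (\<epsilon> i = 1 \<or> \<epsilon> i = -1)) \<and>
     (\<forall>x\<in>U. \<forall>i<DIM('e). \<forall>j<DIM('e). g x (\<eta> i x) (\<eta> j x) = (if i = j then \<epsilon> i else 0))"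

definition ricci ::
    "('a, 'e::euclidean_space) manifold \<Rightarrow> ('a, 'e) cotensor \<Rightarrow> ('a, 'e) cotensor \<Rightarrow>
     ('a, 'e) connection \<Rightarrow> (nat \<Rightarrow> real) \<Rightarrow> (nat \<Rightarrow> ('a, 'e) form) \<Rightarrow>
     ('a, 'e) form \<Rightarrow> ('a, 'e) form \<Rightarrow> 'a \<Rightarrow> real" where
  "ricci N P g D \<epsilon> \<eta> \<alpha> \<beta> x =
     (\<Sum>i<DIM('e). \<epsilon> i * g x (curvature N P D \<alpha> (\<eta> i) (\<eta> i) x) (\<beta> x))"

text \<open>
  \<open>Ric = c g\<close>, where \<open>Ric\<close> is computed from \<open>D\<close> and local orthonormal coframes. As \<open>Ric\<close> does not
  depend on the coframe, the equation is required for all of them.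
\<close>

definition ricci_eq ::
    "('a::topological_space, 'e::euclidean_space) manifold \<Rightarrow> ('a, 'e) cotensor \<Rightarrow> ('a, 'e) cotensor \<Rightarrow>
     ('a, 'e) connection \<Rightarrow> real \<Rightarrow> bool" where
  "ricci_eq N P g D c \<longleftrightarrow> (\<forall>U \<epsilon> \<eta>. local_orthonormal_coframe N g U \<epsilon> \<eta> \<longrightarrow>
     (\<forall>\<alpha>\<in>one_forms N. \<forall>\<beta>\<in>one_forms N. \<forall>x\<in>U.
        ricci N P g D \<epsilon> \<eta> \<alpha> \<beta> x = c * g x (\<alpha> x) (\<beta> x)))"

text \<open>The condition \<open>D P = 0\<close> defining (pseudo-)Riemannian Poisson manifolds.\<close>

definition parallel_bivector ::
    "('a, 'e::euclidean_space) manifold \<Rightarrow> ('a, 'e) cotensor \<Rightarrow> ('a, 'e) connection \<Rightarrow> bool" where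
  "parallel_bivector N P D \<longleftrightarrow>
     (\<forall>\<alpha>\<in>one_forms N. \<forall>\<beta>\<in>one_forms N. \<forall>\<gamma>\<in>one_forms N. \<forall>x.
        anchor_deriv N P \<alpha> (\<lambda>z. P z (\<beta> z) (\<gamma> z)) x
          - P x (D \<alpha> \<beta> x) (\<gamma> x) - P x (\<beta> x) (D \<alpha> \<gamma> x) = 0)"

section \<open>Warped products\<close>

definition product_chart :: "('a, 'e) chart \<Rightarrow> ('b, 'd) chart \<Rightarrow> ('a \<times> 'b, 'e \<times> 'd) chart" where
  "product_chart c d =
     \<lparr>chart_dom = chart_dom c \<times> chart_dom d, chart_map = map_prod (chart_map c) (chart_map d)\<rparr>"

definition product_manifold ::
    "('a, 'e) manifold \<Rightarrow> ('b, 'd) manifold \<Rightarrow> ('a \<times> 'b, 'e \<times> 'd) manifold" where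
  "product_manifold B F =
     \<lparr>atlas = {product_chart c d | c d. c \<in> atlas B \<and> d \<in> atlas F},
      chart_at = (\<lambda>p. product_chart (chart_at B (fst p)) (chart_at F (snd p)))\<rparr>"

definition pullback_metric ::
    "('a, 'e::euclidean_space) manifold \<Rightarrow> ('b, 'd::euclidean_space) manifold \<Rightarrow>
     ('a \<Rightarrow> 'b) \<Rightarrow> ('b, 'd) metric \<Rightarrow> ('a, 'e) metric" where
  "pullback_metric N N' \<phi> G p v w = G (\<phi> p) (tangent_map N N' \<phi> p v) (tangent_map N N' \<phi> p w)"

definition warped_metric ::
    "('a, 'e::euclidean_space) manifold \<Rightarrow> ('a, 'e) metric \<Rightarrow>
     ('b, 'd::euclidean_space) manifold \<Rightarrow> ('b, 'd) metric \<Rightarrow>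
     ('a \<Rightarrow> real) \<Rightarrow> ('a \<times> 'b, 'e \<times> 'd) metric" where
  "warped_metric B gB F gF f p v w =
     pullback_metric (product_manifold B F) B fst gB p v w
     + (f (fst p))\<^sup>2 * pullback_metric (product_manifold B F) F snd gF p v w"

text \<open>
  The bivector field \<open>\<Pi>\<^sub>B + \<Pi>\<^sub>F\<close>: at \<open>(x, y)\<close> the two summands act on the restrictions of a covector
  to the slices \<open>B \<times> {y}\<close> and \<open>{x} \<times> F\<close>. The restrictions of \<open>\<alpha>\<^sub>1\<^sup>h\<close> are \<open>\<alpha>\<^sub>1\<close> and \<open>0\<close>, those of
  \<open>\<alpha>\<^sub>2\<^sup>v\<close> are \<open>0\<close> and \<open>\<alpha>\<^sub>2\<close>.
\<close>

definition product_bivector ::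
    "('a, 'e::euclidean_space) manifold \<Rightarrow> ('a, 'e) cotensor \<Rightarrow>
     ('b, 'd::euclidean_space) manifold \<Rightarrow> ('b, 'd) cotensor \<Rightarrow> ('a \<times> 'b, 'e \<times> 'd) cotensor" where
  "product_bivector B PB F PF p a b =
     (let iB = tangent_map B (product_manifold B F) (\<lambda>x. (x, snd p)) (fst p);
          iF = tangent_map F (product_manifold B F) (\<lambda>y. (fst p, y)) (snd p)
      in PB (fst p) (a o\<^sub>L iB) (b o\<^sub>L iB) + PF (snd p) (a o\<^sub>L iF) (b o\<^sub>L iF))"

definition warping_function :: "('a, 'e::euclidean_space) manifold \<Rightarrow> ('a \<Rightarrow> real) \<Rightarrow> bool" where
  "warping_function B f \<longleftrightarrow> f \<in> smooth_functions B \<and> (\<forall>x. f x > 0)"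

definition einstein_poisson_warped_product ::
    "('a::topological_space, 'e::euclidean_space) manifold \<Rightarrow> ('a, 'e) metric \<Rightarrow> ('a, 'e) cotensor \<Rightarrow>
     ('b::topological_space, 'd::euclidean_space) manifold \<Rightarrow> ('b, 'd) metric \<Rightarrow> ('b, 'd) cotensor \<Rightarrow>
     ('a \<Rightarrow> real) \<Rightarrow> real \<Rightarrow> bool" where
  "einstein_poisson_warped_product B gB PB F gF PF f c \<longleftrightarrow>
     warping_function B f \<and> casimir B PB f \<and>
     (let M = product_manifold B F; P = product_bivector B PB F PF;
          g = cometric (warped_metric B gB F gF f)
      in \<exists>D. levi_civita M P g D \<and> parallel_bivector M P D \<and> ricci_eq M P g D c)"

end

(*
  Write h and v for the lifts of 1-forms on B and F. By the Koszul formula, and because the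
  anchor of every form kills the Casimir function f, one gets D (v b) (v b') = v (DF b b') and
  D (h a) (v b) = D (v b) (h a) = 0, while D (h a) (h a') has no vertical part. Evaluated on
  vertical forms, the Ricci curvature of the warped product is therefore that of F:
  complete a coframe h(eta_i) from B by the rescaled forms f * v(eta_j) from F; the terms with
  h(eta_i) vanish, and in the others the two factors f cancel the 1/f^2 of the cometric. Hence
  lamhat * gF = lam / f^2 * gF, that is lam = lamhat * f^2 at every point.
*)
theory Submission
  imports Defs
begin

section \<open>Calculus of \<open>C\<^sup>k\<close> functions\<close>

text \<open>Every condition quantifies over globally smooth forms, while coframes are local.
  \<open>ricci_eq\<close> says nothing at a point that no local orthonormal coframe reaches, so
  coframes made of global forms have to be produced around every point of B and of F; this is the
  purpose of the bump functions, the extension lemmas and Gram-Schmidt. The metrics may be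
  indefinite, so Gram-Schmidt must be kept away from null vectors. Smoothness of metrics and
  bivectors is given only through their values on smooth fields and forms; hence smoothness is
  tested by pairing, not by components. The Casimir condition acts through skewness: the derivative
  of f along the anchor of a form alpha on B is -alpha(sharp df) = 0, and the same follows for
  1/f^2. This removes the only kind of Koszul term that could couple the two factors. Both Ricci
  equations are compared on a single member of the coframe on F: its square length is 1 or -1, so
  the scalar identity can be divided out although the metric is indefinite. The signs in the theorem
  then come from f^2 > 0.\<close>

lemma frechet_derivative_cong_open:
  assumes "open S" "y \<in> S" "\<And>z. z \<in> S \<Longrightarrow> f z = g z"
  shows "frechet_derivative f (at y) = frechet_derivative g (at y)"
proof -
  have "(f has_derivative f') (at y) \<longleftrightarrow> (g has_derivative f') (at y)" for f'
    using assms has_derivative_transform_within_open by (metis (no_types, lifting))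
  then show ?thesis by (simp add: frechet_derivative_def)
qed

text \<open>\<open>Ck_on\<close> differentiates a total function at points of S. Openness of S is
  what makes the class depend on the values on S alone.\<close>

lemma Ck_on_transform:
  assumes "open S"
  shows "Ck_on k S f \<Longrightarrow> (\<And>y. y \<in> S \<Longrightarrow> f y = g y) \<Longrightarrow> Ck_on k S g"
proof (induction k arbitrary: f g)
  case 0
  then show ?case using continuous_on_cong by (metis Ck_on.simps(1))
next
  case (Suc k)
  have fd: "frechet_derivative f (at y) = frechet_derivative g (at y)" if "y \<in> S" for y
    using frechet_derivative_cong_open[OF assms that] Suc.prems(2) by blast
  have "g differentiable (at y)" if "y \<in> S" for y
    using Suc.prems that assms unfolding differentiable_def Ck_on.simps
    by (metis has_derivative_transform_within_open)
  moreover have "Ck_on k S (\<lambda>y. frechet_derivative g (at y) v)" for v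
    using Suc.IH[of "\<lambda>y. frechet_derivative f (at y) v" "\<lambda>y. frechet_derivative g (at y) v"]
      Suc.prems(1) fd by simp
  ultimately show ?case by simp
qed

text \<open>\<open>frechet_derivative\<close> is a choice operator; uniqueness of derivatives
  identifies it with an explicit candidate, so that later proofs only exhibit
  \<open>f'\<close>.\<close>

lemma Ck_on_SucI:
  assumes "\<And>y. y \<in> S \<Longrightarrow> (f has_derivative f' y) (at y)"
    and "\<And>v. Ck_on k S (\<lambda>y. f' y v)" "open S"
  shows "Ck_on (Suc k) S f"
proof -
  have "frechet_derivative f (at y) = f' y" if "y \<in> S" for y
    using assms(1)[OF that] frechet_derivative_at by metis
  then have "Ck_on k S (\<lambda>y. frechet_derivative f (at y) v)" for v
    by (intro Ck_on_transform[OF assms(3) assms(2)[of v]]) simp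
  then show ?thesis using assms(1) by (auto simp: differentiable_def)
qed

lemma Ck_on_SucD:
  "Ck_on (Suc k) S f \<Longrightarrow> y \<in> S \<Longrightarrow> (f has_derivative frechet_derivative f (at y)) (at y)"
  using frechet_derivative_works by auto

lemma Ck_on_Suc_imp: "Ck_on (Suc k) S f \<Longrightarrow> Ck_on k S f"
proof (induction k arbitrary: f)
  case 0
  then show ?case
    by (auto intro!: continuous_at_imp_continuous_on differentiable_imp_continuous_within)
next
  case (Suc k)
  have "Ck_on (Suc k) S (\<lambda>y. frechet_derivative f (at y) v)" for v
    using Suc.prems Ck_on.simps(2) by blast
  then have "Ck_on k S (\<lambda>y. frechet_derivative f (at y) v)" for v
    using Suc.IH by blast
  then show ?case using Suc.prems by simp
qed

lemma Ck_on_subset: "Ck_on k S f \<Longrightarrow> T \<subseteq> S \<Longrightarrow> Ck_on k T f"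
  by (induction k arbitrary: f) (auto intro: continuous_on_subset)

lemma Ck_on_local:
  assumes "open S" "\<And>y. y \<in> S \<Longrightarrow> \<exists>T. open T \<and> y \<in> T \<and> Ck_on k (S \<inter> T) f"
  shows "Ck_on k S f"
  using assms(2)
proof (induction k arbitrary: f)
  case 0
  show ?case unfolding Ck_on.simps
  proof (rule continuous_at_imp_continuous_on, rule ballI)
    fix y assume "y \<in> S"
    then obtain T where "open T" "y \<in> T" "continuous_on (S \<inter> T) f" using 0 by auto
    then show "isCont f y"
      using \<open>y \<in> S\<close> assms(1) continuous_on_eq_continuous_at by (metis IntI open_Int)
  qed
next
  case (Suc k)
  have "f differentiable (at y)" if "y \<in> S" for y
    using Suc.prems[OF that] that by auto
  moreover have "Ck_on k S (\<lambda>y. frechet_derivative f (at y) v)" for v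
    using Suc.IH Suc.prems by (metis Ck_on.simps(2))
  ultimately show ?case by simp
qed

lemma Ck_on_const: "open S \<Longrightarrow> Ck_on k S (\<lambda>y. c)"
proof (induction k arbitrary: c)
  case (Suc k)
  then show ?case
    by (intro Ck_on_SucI[where f'="\<lambda>y v. 0"]) auto
qed auto

lemma Ck_on_linear:
  assumes "bounded_linear L" "open S"
  shows "Ck_on k S f \<Longrightarrow> Ck_on k S (\<lambda>y. L (f y))"
proof (induction k arbitrary: f)
  case 0
  then show ?case using bounded_linear.continuous_on[OF assms(1)] by auto
next
  case (Suc k)
  show ?case
  proof (rule Ck_on_SucI[where f'="\<lambda>y v. L (frechet_derivative f (at y) v)"])
    show "((\<lambda>y. L (f y)) has_derivative (\<lambda>v. L (frechet_derivative f (at y) v))) (at y)"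
      if "y \<in> S" for y
      using bounded_linear.has_derivative[OF assms(1) Ck_on_SucD[OF Suc.prems that]] .
    show "Ck_on k S (\<lambda>y. L (frechet_derivative f (at y) v))" for v
      using Suc by simp
  qed (use assms in auto)
qed

lemma Ck_on_add:
  assumes "open S"
  shows "Ck_on k S f \<Longrightarrow> Ck_on k S g \<Longrightarrow> Ck_on k S (\<lambda>y. f y + g y)"
proof (induction k arbitrary: f g)
  case (Suc k)
  show ?case
  proof (rule Ck_on_SucI[where f'="\<lambda>y v. frechet_derivative f (at y) v + frechet_derivative g (at y) v"])
    show "((\<lambda>y. f y + g y) has_derivative
        (\<lambda>v. frechet_derivative f (at y) v + frechet_derivative g (at y) v)) (at y)" if "y \<in> S" for y
      using Suc.prems that by (auto intro!: has_derivative_add Ck_on_SucD)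
  qed (use Suc assms in auto)
qed (auto intro: continuous_on_add)

lemma Ck_on_sum:
  assumes "open S"
  shows "(\<And>i. i \<in> I \<Longrightarrow> Ck_on k S (f i)) \<Longrightarrow> Ck_on k S (\<lambda>y. \<Sum>i\<in>I. f i y)"
  by (induction I rule: infinite_finite_induct) (auto intro: Ck_on_const Ck_on_add assms)

lemma Ck_on_bilinear:
  assumes "bounded_bilinear L" "open S"
  shows "Ck_on k S f \<Longrightarrow> Ck_on k S g \<Longrightarrow> Ck_on k S (\<lambda>y. L (f y) (g y))"
proof (induction k arbitrary: f g)
  case 0
  then show ?case using bounded_bilinear.continuous_on[OF assms(1)] by auto
next
  case (Suc k)
  let ?d = "\<lambda>y v. L (f y) (frechet_derivative g (at y) v) + L (frechet_derivative f (at y) v) (g y)"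
  show ?case
  proof (rule Ck_on_SucI[where f'="?d"])
    show "((\<lambda>y. L (f y) (g y)) has_derivative ?d y) (at y)" if "y \<in> S" for y
      using bounded_bilinear.FDERIV[OF assms(1) Ck_on_SucD[OF Suc.prems(1) that]
          Ck_on_SucD[OF Suc.prems(2) that]] .
    show "Ck_on k S (\<lambda>y. ?d y v)" for v
      using Suc Ck_on_Suc_imp[OF Suc.prems(1)] Ck_on_Suc_imp[OF Suc.prems(2)]
      by (intro Ck_on_add Suc.IH assms) auto
  qed (use assms in auto)
qed

lemma Ck_on_compose:
  fixes f :: "'e::euclidean_space \<Rightarrow> 'w::real_normed_vector" and g :: "'x::real_normed_vector \<Rightarrow> 'e"
  assumes "open S" "open T" "\<And>y. y \<in> S \<Longrightarrow> g y \<in> T"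
  shows "Ck_on k T f \<Longrightarrow> Ck_on k S g \<Longrightarrow> Ck_on k S (\<lambda>y. f (g y))"
proof (induction k arbitrary: f)
  case 0
  then show ?case using assms continuous_on_compose2[of T f S g] by auto
next
  case (Suc k)
  let ?d = "\<lambda>y v. frechet_derivative f (at (g y)) (frechet_derivative g (at y) v)"
  have fd: "(f has_derivative frechet_derivative f (at (g y))) (at (g y))" if "y \<in> S" for y
    using Ck_on_SucD[OF Suc.prems(1)] assms(3)[OF that] .
  show ?case
  proof (rule Ck_on_SucI[where f'="?d"])
    show "((\<lambda>y. f (g y)) has_derivative ?d y) (at y)" if "y \<in> S" for y
      using has_derivative_compose[OF Ck_on_SucD[OF Suc.prems(2) that] fd[OF that]] .
    fix v
    \<comment> \<open>In the chain rule the direction moves with \<open>y\<close> too, whereas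
      \<open>Ck_on\<close> controls derivatives in fixed directions only. Expanding the direction in
      the basis gives products of scalar coefficients and derivatives in fixed directions.\<close>
    have *: "Ck_on k S (\<lambda>y. \<Sum>b\<in>Basis. (frechet_derivative g (at y) v \<bullet> b) *\<^sub>R
        frechet_derivative f (at (g y)) b)"
    proof (intro Ck_on_sum assms Ck_on_bilinear[OF bounded_bilinear_scaleR])
      show "Ck_on k S (\<lambda>y. frechet_derivative g (at y) v \<bullet> b)" for b
        using Suc.prems(2) by (intro Ck_on_linear[OF bounded_linear_inner_left] assms) auto
      show "Ck_on k S (\<lambda>y. frechet_derivative f (at (g y)) b)" for b
        using Suc.IH[of "\<lambda>y. frechet_derivative f (at y) b"] Suc.prems
          Ck_on_Suc_imp[OF Suc.prems(2)] by auto
    qed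
    have "(\<Sum>b\<in>Basis. (w \<bullet> b) *\<^sub>R frechet_derivative f (at (g y)) b)
        = frechet_derivative f (at (g y)) w" if "y \<in> S" for y w
    proof -
      interpret bounded_linear "frechet_derivative f (at (g y))"
        using fd[OF that] has_derivative_bounded_linear by blast
      have "frechet_derivative f (at (g y)) w
          = frechet_derivative f (at (g y)) (\<Sum>b\<in>Basis. (w \<bullet> b) *\<^sub>R b)"
        by (simp only: euclidean_representation)
      then show ?thesis by (simp add: sum scaleR)
    qed
    then show "Ck_on k S (\<lambda>y. ?d y v)" using Ck_on_transform[OF assms(1) *] by simp
  qed (use assms in auto)
qed

text \<open>In finite dimension a form-valued map is a combination of constant functionals with its
  values on \<open>Basis\<close> as scalar coefficients.\<close>

lemma Ck_on_blinfun:
  fixes A :: "'x::real_normed_vector \<Rightarrow> 'e::euclidean_space \<Rightarrow>\<^sub>L real"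
  assumes "open S" "\<And>b. b \<in> Basis \<Longrightarrow> Ck_on k S (\<lambda>y. A y b)"
  shows "Ck_on k S A"
proof -
  have "A y = (\<Sum>b\<in>Basis. A y b *\<^sub>R blinfun_inner_left b)" for y
  proof (rule blinfun_eqI)
    fix w
    have "A y w = (\<Sum>b\<in>Basis. (w \<bullet> b) * A y b)"
      by (subst (1) euclidean_representation[of w, symmetric])
        (simp add: blinfun.sum_right blinfun.scaleR_right)
    also have "\<dots> = (\<Sum>b\<in>Basis. A y b *\<^sub>R blinfun_inner_left b) w"
      by (simp add: blinfun.sum_left blinfun.scaleR_left mult.commute inner_commute)
    finally show "A y w = (\<Sum>b\<in>Basis. A y b *\<^sub>R blinfun_inner_left b) w" .
  qed
  moreover have "Ck_on k S (\<lambda>y. \<Sum>b\<in>Basis. A y b *\<^sub>R (blinfun_inner_left b :: 'e \<Rightarrow>\<^sub>L real))"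
    by (intro Ck_on_sum assms Ck_on_bilinear[OF bounded_bilinear_scaleR] Ck_on_const) auto
  ultimately show ?thesis by simp
qed

lemma Ck_on_vector:
  fixes X :: "'x::real_normed_vector \<Rightarrow> 'e::euclidean_space"
  assumes "open S" "\<And>b. b \<in> Basis \<Longrightarrow> Ck_on k S (\<lambda>y. X y \<bullet> b)"
  shows "Ck_on k S X"
proof -
  have "Ck_on k S (\<lambda>y. \<Sum>b\<in>Basis. (X y \<bullet> b) *\<^sub>R b)"
    by (intro Ck_on_sum assms Ck_on_bilinear[OF bounded_bilinear_scaleR] Ck_on_const) auto
  then show ?thesis by (simp add: euclidean_representation)
qed

lemma Ck_on_id: "open S \<Longrightarrow> Ck_on k S (\<lambda>y. y)"
proof (cases k)
  case (Suc j)
  assume "open S"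
  then show ?thesis unfolding Suc
    by (intro Ck_on_SucI[where f'="\<lambda>y v. v"]) (auto intro: Ck_on_const)
qed auto

text \<open>The family of all real powers is closed under differentiation up to constants, so the
  induction keeps the exponent arbitrary.\<close>

lemma Ck_on_powr: "Ck_on k {0<..} (\<lambda>t::real. t powr a)"
proof (induction k arbitrary: a)
  case 0
  then show ?case by (auto intro!: continuous_intros)
next
  case (Suc k)
  show ?case
  proof (rule Ck_on_SucI[where f'="\<lambda>t v. (a * v) * t powr (a - 1)"])
    show "((\<lambda>t. t powr a) has_derivative (\<lambda>v. a * v * t powr (a - 1))) (at t)" if "t \<in> {0<..}" for t
    proof -
      have "((\<lambda>t. t powr a) has_real_derivative a * t powr (a - 1)) (at t)"
        using that has_real_derivative_powr by auto
      moreover have "(*) (a * t powr (a - 1)) = (\<lambda>v. a * v * t powr (a - 1))" by auto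
      ultimately show ?thesis by (simp add: has_field_derivative_def)
    qed
    show "Ck_on k {0<..} (\<lambda>t. (a * v) * t powr (a - 1))" for v
      using Ck_on_linear[OF bounded_linear_mult_right _ Suc] by auto
  qed auto
qed

section \<open>Flat functions, smooth cutoffs and the cut-off inverse square root\<close>

definition flat :: "nat \<Rightarrow> real \<Rightarrow> real" where
  "flat n t = (if t > 0 then exp (- (1 / t)) / t ^ n else 0)"

text \<open>A single term of the series of exp(1/t), the one of degree n + m, already bounds it from
  below; its reciprocal bounds exp(-1/t).\<close>

lemma flat_le: 
  assumes "t > 0" shows "flat n t \<le> fact (n + m) * t ^ m"
proof -
  have "(1 / t) ^ (n + m) / fact (n + m) \<le> exp (1 / t)"
  proof -
    have "(\<Sum>i\<in>{n + m}. (1 / t) ^ i /\<^sub>R fact i) \<le> (\<Sum>i. (1 / t) ^ i /\<^sub>R fact i)"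
      using assms by (intro sum_le_suminf summable_exp_generic) auto
    then show ?thesis by (simp add: exp_def divide_inverse mult.commute)
  qed
  then have "1 \<le> exp (1 / t) * (fact (n + m) * t ^ (n + m))"
    using assms by (simp add: field_simps power_divide)
  then have "exp (- (1 / t)) \<le> fact (n + m) * t ^ (n + m)"
    by (simp add: exp_minus field_simps)
  then show ?thesis using assms by (simp add: flat_def field_simps power_add)
qed

lemma flat_nonneg: "flat n t \<ge> 0"
  by (simp add: flat_def)

text \<open>Differentiating exp(-1/t) produces negative powers of t. Carrying the exponent
  \<open>n\<close> as a parameter makes the family closed under differentiation, which is all that
  smoothness needs. Only t = 0 requires an estimate.\<close>

lemma flat_has_derivative:
  "(flat n has_real_derivative flat (n + 2) t - n * flat (n + 1) t) (at t)"
proof -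
  consider "t > 0" | "t < 0" | "t = 0" by linarith
  then show ?thesis
  proof cases
    case 1
    have "((\<lambda>t. exp (- (1 / t)) / t ^ n) has_real_derivative flat (n + 2) t - n * flat (n + 1) t) (at t)"
    proof -
      have p: "real n * t ^ (n - 1) = n * t ^ n / t" using 1 by (cases n) auto
      have "((\<lambda>t. exp (- (1 / t)) / t ^ n) has_real_derivative
          (exp (- (1 / t)) * (1 / t\<^sup>2) * t ^ n - exp (- (1 / t)) * (n * t ^ (n - 1))) / (t ^ n * t ^ n)) (at t)"
        using 1 by (auto intro!: derivative_eq_intros simp: power2_eq_square)
      also have "(exp (- (1 / t)) * (1 / t\<^sup>2) * t ^ n - exp (- (1 / t)) * (n * t ^ (n - 1))) / (t ^ n * t ^ n)
          = flat (n + 2) t - n * flat (n + 1) t"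
        unfolding p using 1 by (simp add: flat_def divide_simps) (simp add: algebra_simps power2_eq_square)
      finally show ?thesis .
    qed
    then show ?thesis
      using has_field_derivative_transform_within_open[of _ _ t "{0<..}" "flat n"] 1
      by (auto simp: flat_def)
  next
    case 2
    have "((\<lambda>t. 0) has_real_derivative 0) (at t)" by simp
    then have "(flat n has_real_derivative 0) (at t)"
      using has_field_derivative_transform_within_open[of "\<lambda>t. 0" _ t "{..<0}" "flat n"] 2
      by (auto simp: flat_def)
    then show ?thesis using 2 by (simp add: flat_def)
  next
    case 3
    have bd: "norm ((flat n h - flat n 0) / h) \<le> fact (n + 2) * \<bar>h\<bar>" if "h \<noteq> 0" for h
    proof (cases "h > 0")
      case True
      \<comment> \<open>The exponent m = 2 leaves one power of \<open>h\<close> after the division,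
        enough to force the difference quotient to 0.\<close>
      then have "flat n h / h \<le> fact (n + 2) * h ^ 2 / h"
        using flat_le[of h n 2] by (intro divide_right_mono) auto
      then show ?thesis using True flat_nonneg[of n h] by (simp add: flat_def[of n 0] power2_eq_square)
    next
      case False
      have "0 \<le> fact (n + 2) * \<bar>h\<bar>" by (intro mult_nonneg_nonneg) auto
      then show ?thesis using False by (simp only: flat_def) simp
    qed
    have "((\<lambda>h. (flat n h - flat n 0) / h) \<longlongrightarrow> 0) (at 0)"
    proof (rule Lim_null_comparison)
      show "\<forall>\<^sub>F h in at 0. norm ((flat n h - flat n 0) / h) \<le> fact (n + 2) * \<bar>h\<bar>"
        using bd by (auto simp: eventually_at intro: exI[of _ 1])
      have "((\<lambda>h::real. fact (n + 2) * \<bar>h\<bar>) \<longlongrightarrow> fact (n + 2) * \<bar>0\<bar>) (at 0)"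
        by (intro tendsto_intros)
      then show "((\<lambda>h::real. fact (n + 2) * \<bar>h\<bar>) \<longlongrightarrow> 0) (at 0)" by simp
    qed
    then show ?thesis using 3 by (simp add: has_field_derivative_iff) (simp add: flat_def)
  qed
qed

lemma Ck_on_flat: "Ck_on k UNIV (flat n)"
proof (induction k arbitrary: n)
  case 0
  then show ?case using flat_has_derivative DERIV_isCont
    by (metis Ck_on.simps(1) continuous_at_imp_continuous_on)
next
  case (Suc k)
  show ?case
  proof (rule Ck_on_SucI[where f'="\<lambda>t v. v * flat (n + 2) t + - real n * v * flat (n + 1) t"])
    show "(flat n has_derivative (\<lambda>v. v * flat (n + 2) t + - real n * v * flat (n + 1) t)) (at t)" for t
    proof -
      have "(\<lambda>v. v * flat (n + 2) t + - real n * v * flat (n + 1) t)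
          = (*) (flat (n + 2) t - n * flat (n + 1) t)" by (auto simp: algebra_simps)
      then show ?thesis using flat_has_derivative[of n t] unfolding has_field_derivative_def by simp
    qed
    show "Ck_on k UNIV (\<lambda>t. v * flat (n + 2) t + - real n * v * flat (n + 1) t)" for v
      using Suc by (intro Ck_on_add Ck_on_linear[OF bounded_linear_mult_right]) auto
  qed auto
qed

text \<open>The first summand of the denominator is positive for t > 0 and the second for t < 1, so
  it never vanishes. Division is written with \<open>powr\<close> to fall under
  \<open>Ck_on_powr\<close>.\<close>

definition step :: "real \<Rightarrow> real" where
  "step t = flat 0 t * (flat 0 t + flat 0 (1 - t)) powr (-1)"

lemma step_eq_0: "t \<le> 0 \<Longrightarrow> step t = 0"
  by (simp add: step_def flat_def)

lemma step_eq_1: "t \<ge> 1 \<Longrightarrow> step t = 1"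
  by (simp add: step_def flat_def powr_minus)

lemma Ck_on_step: "Ck_on k UNIV step"
proof -
  have "flat 0 t + flat 0 (1 - t) > 0" for t
    by (cases "t > 0") (auto simp: flat_def add_pos_nonneg)
  moreover have "Ck_on k UNIV (\<lambda>t. flat 0 (1 - t))"
  proof (rule Ck_on_compose[of UNIV UNIV "\<lambda>t. 1 - t" _ "flat 0"])
    have "Ck_on k UNIV (\<lambda>t. 1 + (- 1) * t :: real)"
      by (intro Ck_on_add Ck_on_const Ck_on_linear[OF bounded_linear_mult_right] Ck_on_id) auto
    then show "Ck_on k UNIV (\<lambda>t. 1 - t :: real)" by simp
  qed (auto intro: Ck_on_flat)
  ultimately have "Ck_on k UNIV (\<lambda>t. (flat 0 t + flat 0 (1 - t)) powr -1)"
    by (intro Ck_on_compose[of UNIV "{0<..}" "\<lambda>t. flat 0 t + flat 0 (1 - t)" k "\<lambda>t. t powr -1"]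
        Ck_on_powr Ck_on_add Ck_on_flat) auto
  then show ?thesis
    unfolding step_def[abs_def] by (intro Ck_on_bilinear[OF bounded_bilinear_mult] Ck_on_flat) auto
qed

text \<open>A globally smooth replacement for \<open>t \<mapsto> 1 / sqrt t\<close> near \<open>t = 1\<close>.\<close>

definition rsqrt :: "real \<Rightarrow> real" where
  "rsqrt t = step (4 * t - 1) * t powr (- 1 / 2)"

text \<open>From t = 1/2 on, the cutoff argument 4t - 1 is at least 1, so only the power of t is
  left.\<close>

lemma rsqrt_square: "t > 1 / 2 \<Longrightarrow> rsqrt t * rsqrt t * t = 1"
  by (simp add: rsqrt_def step_eq_1 flip: powr_add)

lemma rsqrt_1: "rsqrt 1 = 1"
  by (simp add: rsqrt_def step_eq_1)

text \<open>The line is covered by t > 0, where the power is smooth, and t < 1/4, where the argument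
  of the cutoff is negative and the product is identically 0.\<close>

lemma Ck_on_rsqrt: "Ck_on k UNIV rsqrt"
proof (rule Ck_on_local)
  fix t :: real
  show "\<exists>T. open T \<and> t \<in> T \<and> Ck_on k (UNIV \<inter> T) rsqrt"
  proof (cases "t > 0")
    case True
    have "Ck_on k {0<..} (\<lambda>t. 4 * t + (- 1) :: real)"
      by (intro Ck_on_add Ck_on_const Ck_on_linear[OF bounded_linear_mult_right] Ck_on_id) auto
    then have "Ck_on k {0<..} (\<lambda>t::real. step (4 * t - 1))"
      using Ck_on_compose[of "{0<..}" UNIV "\<lambda>t. 4 * t + (-1)" k step] Ck_on_step by auto
    then have "Ck_on k {0<..} rsqrt"
      unfolding rsqrt_def[abs_def]
      by (intro Ck_on_bilinear[OF bounded_bilinear_mult] Ck_on_powr) auto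
    then show ?thesis using True by (intro exI[of _ "{0<..}"]) auto
  next
    case False
    have "Ck_on k {..<1/4} rsqrt"
      by (rule Ck_on_transform[OF _ Ck_on_const[of _ _ 0]]) (auto simp: rsqrt_def step_eq_0)
    then show ?thesis using False by (intro exI[of _ "{..<1/4}"]) auto
  qed
qed auto

section \<open>Closure rules for smooth maps on open sets\<close>

lemma smooth_on_transform:
  "open S \<Longrightarrow> smooth_on S f \<Longrightarrow> (\<And>y. y \<in> S \<Longrightarrow> f y = g y) \<Longrightarrow> smooth_on S g"
  unfolding smooth_on_def using Ck_on_transform by blast

lemma smooth_on_subset: "smooth_on S f \<Longrightarrow> T \<subseteq> S \<Longrightarrow> smooth_on T f"
  unfolding smooth_on_def using Ck_on_subset by blast

lemma smooth_on_Int2: "smooth_on T f \<Longrightarrow> smooth_on (S \<inter> T) f"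
  by (rule smooth_on_subset) auto

lemma smooth_on_local:
  assumes "open S" "\<And>y. y \<in> S \<Longrightarrow> \<exists>T. open T \<and> y \<in> T \<and> smooth_on (S \<inter> T) f"
  shows "smooth_on S f"
  unfolding smooth_on_def using Ck_on_local[OF assms(1)] assms(2) unfolding smooth_on_def by metis

lemma smooth_on_const: "open S \<Longrightarrow> smooth_on S (\<lambda>y. c)"
  unfolding smooth_on_def using Ck_on_const by blast

lemma smooth_on_linear: "bounded_linear L \<Longrightarrow> open S \<Longrightarrow> smooth_on S f \<Longrightarrow> smooth_on S (\<lambda>y. L (f y))"
  unfolding smooth_on_def using Ck_on_linear by blast

lemma smooth_on_add:
  "open S \<Longrightarrow> smooth_on S f \<Longrightarrow> smooth_on S g \<Longrightarrow> smooth_on S (\<lambda>y. f y + g y)"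
  unfolding smooth_on_def using Ck_on_add by blast

lemma smooth_on_bilinear:
  "bounded_bilinear L \<Longrightarrow> open S \<Longrightarrow> smooth_on S f \<Longrightarrow> smooth_on S g \<Longrightarrow> smooth_on S (\<lambda>y. L (f y) (g y))"
  unfolding smooth_on_def using Ck_on_bilinear by blast

lemma smooth_on_compose:
  fixes f :: "'e::euclidean_space \<Rightarrow> 'w::real_normed_vector" and g :: "'x::real_normed_vector \<Rightarrow> 'e"
  shows "open S \<Longrightarrow> open T \<Longrightarrow> (\<And>y. y \<in> S \<Longrightarrow> g y \<in> T) \<Longrightarrow> smooth_on T f \<Longrightarrow> smooth_on S g \<Longrightarrow>
    smooth_on S (\<lambda>y. f (g y))"
  unfolding smooth_on_def using Ck_on_compose[of S T g _ f] by blast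

lemma smooth_on_blinfun:
  fixes A :: "'x::real_normed_vector \<Rightarrow> 'e::euclidean_space \<Rightarrow>\<^sub>L real"
  shows "open S \<Longrightarrow> (\<And>b. b \<in> Basis \<Longrightarrow> smooth_on S (\<lambda>y. A y b)) \<Longrightarrow> smooth_on S A"
  unfolding smooth_on_def using Ck_on_blinfun by blast

lemma smooth_on_vector:
  fixes X :: "'x::real_normed_vector \<Rightarrow> 'e::euclidean_space"
  shows "open S \<Longrightarrow> (\<And>b. b \<in> Basis \<Longrightarrow> smooth_on S (\<lambda>y. X y \<bullet> b)) \<Longrightarrow> smooth_on S X"
  unfolding smooth_on_def using Ck_on_vector by blast

lemma smooth_on_id: "open S \<Longrightarrow> smooth_on S (\<lambda>y. y)"
  unfolding smooth_on_def using Ck_on_id by blast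

lemma smooth_on_frechet: "smooth_on S f \<Longrightarrow> smooth_on S (\<lambda>y. frechet_derivative f (at y) v)"
  unfolding smooth_on_def by (metis Ck_on.simps(2))

lemma smooth_on_has_derivative:
  "smooth_on S f \<Longrightarrow> y \<in> S \<Longrightarrow> (f has_derivative frechet_derivative f (at y)) (at y)"
  unfolding smooth_on_def using Ck_on_SucD by blast

section \<open>Charts\<close>

lemma is_chartD:
  assumes "is_chart c"
  shows "open (chart_dom c)" "open (chart_image c)" "inj_on (chart_map c) (chart_dom c)"
    "continuous_on (chart_dom c) (chart_map c)" "continuous_on (chart_image c) (chart_inv c)"
proof -
  have h: "homeomorphism (chart_dom c) (chart_image c) (chart_map c) (chart_inv c)"
    using assms by (simp_all add: is_chart_def)
  show "inj_on (chart_map c) (chart_dom c)"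
    by (rule inj_on_inverseI[of _ "chart_inv c"]) (rule homeomorphism_apply1[OF h])
  show "continuous_on (chart_dom c) (chart_map c)" "continuous_on (chart_image c) (chart_inv c)"
    using homeomorphism_cont1[OF h] homeomorphism_cont2[OF h] .
qed (use assms in \<open>simp_all add: is_chart_def\<close>)

lemma chart_inv_map: "is_chart c \<Longrightarrow> x \<in> chart_dom c \<Longrightarrow> chart_inv c (chart_map c x) = x"
  using is_chartD(3) by (metis inv_into_f_f)

lemma open_chart_map_image:
  assumes "is_chart c" "open W"
  shows "open (chart_map c ` (W \<inter> chart_dom c))"
proof -
  have "chart_map c ` (W \<inter> chart_dom c) = chart_image c \<inter> chart_inv c -` W"
    using chart_inv_map[OF assms(1)] by force
  then show ?thesis
    using continuous_open_preimage[OF is_chartD(5,2)[OF assms(1)] assms(2)] by simp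
qed

lemma open_chart_map_vimage:
  assumes "is_chart c" "open U"
  shows "open {z \<in> chart_dom c. chart_map c z \<in> U}"
proof -
  have "{z \<in> chart_dom c. chart_map c z \<in> U} = chart_dom c \<inter> chart_map c -` U" by auto
  then show ?thesis
    using continuous_open_preimage[OF is_chartD(4,1)[OF assms(1)] assms(2)] by simp
qed

text \<open>The Jacobian of the transition map, indexed by the point of the manifold and not by its
  coordinates, so that the cocycle rule holds at a common \<open>x\<close>.\<close>

definition chart_change :: "('a, 'e::euclidean_space) chart \<Rightarrow> ('a, 'e) chart \<Rightarrow> 'a \<Rightarrow> 'e \<Rightarrow> 'e" where
  "chart_change c d x = frechet_derivative (chart_map d \<circ> chart_inv c) (at (chart_map c x))"

locale mfd =
  fixes N :: "('a::{t2_space,second_countable_topology}, 'e::euclidean_space) manifold"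
  assumes smooth: "smooth_manifold N"
begin

lemma is_chart: "c \<in> atlas N \<Longrightarrow> is_chart c"
  using smooth unfolding smooth_manifold_def by blast

lemma chart_at [simp, intro]: "chart_at N x \<in> atlas N" "x \<in> chart_dom (chart_at N x)"
  using smooth unfolding smooth_manifold_def by blast+

lemmas chart_inv_map' [simp] = chart_inv_map[OF is_chart]

lemma open_dom: "c \<in> atlas N \<Longrightarrow> open (chart_dom c)"
  and open_image: "c \<in> atlas N \<Longrightarrow> open (chart_image c)"
  using is_chart is_chartD by blast+

lemma open_map_image: "c \<in> atlas N \<Longrightarrow> open W \<Longrightarrow> open (chart_map c ` (W \<inter> chart_dom c))"
  using open_chart_map_image is_chart by blast

lemma transition_smooth:
  assumes "c \<in> atlas N" "d \<in> atlas N"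
  shows "smooth_on (chart_map c ` (chart_dom d \<inter> chart_dom c)) (\<lambda>y. chart_map d (chart_inv c y))"
  using smooth assms unfolding smooth_manifold_def comp_def by (metis Int_commute)

lemma open_overlap:
  "c \<in> atlas N \<Longrightarrow> d \<in> atlas N \<Longrightarrow> open (chart_map c ` (chart_dom d \<inter> chart_dom c))"
  using open_map_image open_dom by blast

lemma transition_derivative:
  assumes "c \<in> atlas N" "d \<in> atlas N" "x \<in> chart_dom c" "x \<in> chart_dom d"
  shows "((\<lambda>y. chart_map d (chart_inv c y)) has_derivative chart_change c d x) (at (chart_map c x))"
  using smooth_on_has_derivative[OF transition_smooth[OF assms(1,2)], of "chart_map c x"] assms
  unfolding chart_change_def comp_def by blast

lemma chart_change_linear:
  assumes "c \<in> atlas N" "d \<in> atlas N" "x \<in> chart_dom c" "x \<in> chart_dom d"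
  shows "bounded_linear (chart_change c d x)"
  using transition_derivative[OF assms] has_derivative_bounded_linear by blast

text \<open>The chain rule through the transition map. Since \<open>g\<close> and \<open>h\<close>
  need to correspond only near \<open>x\<close>, it serves for functions that have a prescribed
  shape near one point, such as the extended coordinate functions.\<close>

lemma change_of_chart_derivative:
  assumes c: "c \<in> atlas N" and d: "d \<in> atlas N" and x: "x \<in> chart_dom c" "x \<in> chart_dom d"
    and h: "(h has_derivative h') (at (chart_map d x))"
    and V: "open V" "x \<in> V" "\<And>z. z \<in> V \<Longrightarrow> z \<in> chart_dom c \<Longrightarrow> z \<in> chart_dom d \<Longrightarrow>
      g (chart_map c z) = h (chart_map d z)"
  shows "(g has_derivative (\<lambda>v. h' (chart_change c d x v))) (at (chart_map c x))"
proof -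
  have "((\<lambda>y. h (chart_map d (chart_inv c y))) has_derivative (\<lambda>v. h' (chart_change c d x v)))
      (at (chart_map c x))"
    using has_derivative_compose[OF transition_derivative[OF c d x]] h c x by simp
  then show ?thesis
  proof (rule has_derivative_transform_within_open)
    show "open (chart_map c ` ((V \<inter> chart_dom d) \<inter> chart_dom c))"
      using open_map_image c d V open_dom by blast
  qed (use V x c in auto)
qed

text \<open>The cocycle rule: the map \<open>e\<close> read in chart \<open>c\<close> is its reading
  in \<open>d\<close> after the transition, and derivatives are unique.\<close>

lemma chart_change_compose:
  assumes "c \<in> atlas N" "d \<in> atlas N" "e \<in> atlas N"
    and "x \<in> chart_dom c" "x \<in> chart_dom d" "x \<in> chart_dom e"
  shows "chart_change d e x (chart_change c d x v) = chart_change c e x v"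
proof -
  have "((\<lambda>y. chart_map e (chart_inv c y)) has_derivative
      (\<lambda>v. chart_change d e x (chart_change c d x v))) (at (chart_map c x))"
    using assms
    by (intro change_of_chart_derivative[OF _ _ _ _ transition_derivative, of c d x e UNIV]) auto
  then show ?thesis using transition_derivative has_derivative_unique assms by metis
qed

lemma chart_change_same:
  assumes "c \<in> atlas N" "x \<in> chart_dom c"
  shows "chart_change c c x v = v"
proof -
  have "((\<lambda>y. chart_map c (chart_inv c y)) has_derivative (\<lambda>v. v)) (at (chart_map c x))"
    by (rule has_derivative_transform_within_open[of "\<lambda>y. y" _ _ UNIV "chart_image c"])
      (use assms open_image in \<open>auto simp: f_inv_into_f\<close>)
  then show ?thesis using transition_derivative has_derivative_unique assms by metis
qed

lemma vector_in_chart_eq: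
  "c \<in> atlas N \<Longrightarrow> x \<in> chart_dom c \<Longrightarrow>
    vector_in_chart N X c (chart_map c x) = chart_change (chart_at N x) c x (X x)"
  by (simp add: vector_in_chart_def chart_change_def Let_def)

lemma form_in_chart_eq:
  "c \<in> atlas N \<Longrightarrow> x \<in> chart_dom c \<Longrightarrow>
    form_in_chart N \<omega> c (chart_map c x) = \<omega> x o\<^sub>L Blinfun (chart_change c (chart_at N x) x)"
  by (simp add: form_in_chart_def chart_change_def Let_def)

lemma form_in_chart_apply:
  "c \<in> atlas N \<Longrightarrow> x \<in> chart_dom c \<Longrightarrow>
    form_in_chart N \<omega> c (chart_map c x) v = \<omega> x (chart_change c (chart_at N x) x v)"
  by (simp add: form_in_chart_eq bounded_linear_Blinfun_apply chart_change_linear)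

section \<open>Smooth functions\<close>

text \<open>One chart around each point is enough: smooth transition maps carry smoothness to every
  other chart of the atlas.\<close>

lemma smooth_functionsI:
  assumes "\<And>x. \<exists>c\<in>atlas N. \<exists>W. open W \<and> x \<in> W \<and> x \<in> chart_dom c \<and>
      smooth_on (chart_map c ` (W \<inter> chart_dom c)) (\<lambda>y. u (chart_inv c y))"
  shows "u \<in> smooth_functions N"
  unfolding smooth_functions_def comp_def
proof safe
  fix d assume d: "d \<in> atlas N"
  show "smooth_on (chart_image d) (\<lambda>y. u (chart_inv d y))"
  proof (rule smooth_on_local[OF open_image[OF d]])
    fix y assume "y \<in> chart_image d"
    then obtain x where x: "x \<in> chart_dom d" "y = chart_map d x" by blast
    obtain c W where c: "c \<in> atlas N" "open W" "x \<in> W" "x \<in> chart_dom c"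
      and s: "smooth_on (chart_map c ` (W \<inter> chart_dom c)) (\<lambda>y. u (chart_inv c y))"
      using assms by blast
    let ?T = "chart_map d ` ((W \<inter> chart_dom c) \<inter> chart_dom d)"
    have o: "open ?T" using open_map_image[OF d] c open_dom by blast
    have "smooth_on ?T (\<lambda>y. u (chart_inv c (chart_map c (chart_inv d y))))"
    proof (rule smooth_on_compose[OF o open_map_image[OF c(1,2)] _ s])
      show "smooth_on ?T (\<lambda>y. chart_map c (chart_inv d y))"
        by (rule smooth_on_subset[OF transition_smooth[OF d c(1)]]) auto
    qed (use d in auto)
    then have "smooth_on ?T (\<lambda>y. u (chart_inv d y))"
      by (rule smooth_on_transform[OF o]) (use d c in auto)
    then have "smooth_on (chart_image d \<inter> ?T) (\<lambda>y. u (chart_inv d y))"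
      by (rule smooth_on_Int2)
    moreover have "y \<in> ?T" using x c by blast
    ultimately show "\<exists>T. open T \<and> y \<in> T \<and> smooth_on (chart_image d \<inter> T) (\<lambda>y. u (chart_inv d y))"
      using o by blast
  qed
qed

lemma smooth_functionsD: "u \<in> smooth_functions N \<Longrightarrow> c \<in> atlas N \<Longrightarrow>
    smooth_on (chart_image c) (\<lambda>y. u (chart_inv c y))"
  unfolding smooth_functions_def comp_def by blast

lemma smooth_functions_local:
  assumes "\<And>x. \<exists>W v. open W \<and> x \<in> W \<and> v \<in> smooth_functions N \<and> (\<forall>z\<in>W. u z = v z)"
  shows "u \<in> smooth_functions N"
proof (rule smooth_functionsI)
  fix x
  obtain W v where W: "open W" "x \<in> W" "v \<in> smooth_functions N" "\<forall>z\<in>W. u z = v z"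
    using assms by blast
  let ?c = "chart_at N x"
  have "smooth_on (chart_map ?c ` (W \<inter> chart_dom ?c)) (\<lambda>y. v (chart_inv ?c y))"
    using smooth_functionsD[OF W(3), of ?c] by (rule smooth_on_subset) auto
  then have "smooth_on (chart_map ?c ` (W \<inter> chart_dom ?c)) (\<lambda>y. u (chart_inv ?c y))"
    by (rule smooth_on_transform[OF open_map_image[OF chart_at(1) W(1)]]) (use W in auto)
  then show "\<exists>c\<in>atlas N. \<exists>W. open W \<and> x \<in> W \<and> x \<in> chart_dom c \<and>
      smooth_on (chart_map c ` (W \<inter> chart_dom c)) (\<lambda>y. u (chart_inv c y))"
    using W by (intro bexI[of _ ?c] exI[of _ W]) auto
qed

lemma smooth_functions_const: "(\<lambda>x. r) \<in> smooth_functions N"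
  unfolding smooth_functions_def comp_def using smooth_on_const open_image by blast

lemma smooth_functions_add:
  "u \<in> smooth_functions N \<Longrightarrow> v \<in> smooth_functions N \<Longrightarrow> (\<lambda>x. u x + v x) \<in> smooth_functions N"
  unfolding smooth_functions_def comp_def by (auto intro: smooth_on_add open_image)

lemma smooth_functions_mult:
  "u \<in> smooth_functions N \<Longrightarrow> v \<in> smooth_functions N \<Longrightarrow> (\<lambda>x. u x * v x) \<in> smooth_functions N"
  unfolding smooth_functions_def comp_def
  by (auto intro: smooth_on_bilinear[OF bounded_bilinear_mult] open_image)

lemma smooth_functions_sum:
  "(\<And>i. i \<in> I \<Longrightarrow> u i \<in> smooth_functions N) \<Longrightarrow> (\<lambda>x. \<Sum>i\<in>I. u i x) \<in> smooth_functions N"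
  by (induction I rule: infinite_finite_induct)
    (auto intro: smooth_functions_const smooth_functions_add)

lemma smooth_functions_rsqrt:
  "u \<in> smooth_functions N \<Longrightarrow> (\<lambda>x. rsqrt (u x)) \<in> smooth_functions N"
  unfolding smooth_functions_def comp_def
proof safe
  fix c assume "\<forall>c\<in>atlas N. smooth_on (chart_image c) (\<lambda>y. u (chart_inv c y))" and c: "c \<in> atlas N"
  then have "smooth_on (chart_image c) (\<lambda>y. u (chart_inv c y))" by blast
  then show "smooth_on (chart_image c) (\<lambda>y. rsqrt (u (chart_inv c y)))"
    using Ck_on_rsqrt
    by (intro smooth_on_compose[OF open_image[OF c] open_UNIV, of _ rsqrt]) (auto simp: smooth_on_def)
qed

text \<open>A radial cutoff in the chart, extended by 0. Two sets are recorded because both are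
  used: \<open>V\<close>, where products with the bump keep their local values, and the closed
  \<open>K\<close>, off which they are 0.\<close>

lemma bump_function:
  assumes c: "c \<in> atlas N" and x: "x \<in> chart_dom c"
  obtains \<phi> V K where "\<phi> \<in> smooth_functions N" "open V" "x \<in> V" "V \<subseteq> chart_dom c" "closed K"
    "K \<subseteq> chart_dom c" "\<And>z. z \<in> V \<Longrightarrow> \<phi> z = 1" "\<And>z. z \<notin> K \<Longrightarrow> \<phi> z = 0"
proof -
  note ch = is_chart[OF c]
  let ?p = "chart_map c x"
  have "open (chart_image c)" "?p \<in> chart_image c"
    using open_image[OF c] x by auto
  then obtain r where r: "r > 0" "cball ?p r \<subseteq> chart_image c"
    by (metis open_contains_cball)
  \<comment> \<open>The argument of \<open>step\<close> is at least 1 for distances up to r/2 and is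
    -2 at distance r, so the cutoff is 1 on the half ball and 0 outside the ball.\<close>
  define \<psi> where "\<psi> y = step (2 - (4 / r\<^sup>2) * ((y - ?p) \<bullet> (y - ?p)))" for y
  define \<phi> where "\<phi> z = (if z \<in> chart_dom c then \<psi> (chart_map c z) else 0)" for z
  define K where "K = chart_inv c ` cball ?p r"
  define V where "V = {z \<in> chart_dom c. chart_map c z \<in> ball ?p (r / 2)}"
  have "compact K" unfolding K_def
    using is_chartD(5)[OF ch] r by (intro compact_continuous_image) (auto intro: continuous_on_subset)
  \<comment> \<open>Here the Hausdorff property enters: the complement of K is open, which makes the
    extension by 0 smooth at points outside the chart.\<close>
  then have K: "closed K" by (rule compact_imp_closed)
  have Kd: "K \<subseteq> chart_dom c" using r unfolding K_def by (auto intro!: inv_into_into)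
  have "open V" unfolding V_def by (rule open_chart_map_vimage[OF ch open_ball])
  then have V: "open V" "x \<in> V" "V \<subseteq> chart_dom c" using x r by (auto simp: V_def)
  have sq: "(y - ?p) \<bullet> (y - ?p) = (dist ?p y)\<^sup>2" for y
    by (simp add: dist_norm norm_minus_commute power2_norm_eq_inner)
  have one: "\<phi> z = 1" if "z \<in> V" for z
  proof -
    have "(dist ?p (chart_map c z))\<^sup>2 \<le> (r / 2)\<^sup>2"
      using that r unfolding V_def by (intro power_mono) auto
    then have "(4 / r\<^sup>2) * (dist ?p (chart_map c z))\<^sup>2 \<le> (4 / r\<^sup>2) * (r / 2)\<^sup>2"
      using r by (intro mult_left_mono) auto
    also have "\<dots> = 1" using r by (simp add: power2_eq_square)
    finally show ?thesis using that V unfolding \<phi>_def \<psi>_def sq by (auto intro!: step_eq_1)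
  qed
  have zero: "\<phi> z = 0" if "z \<notin> K" for z
  proof (cases "z \<in> chart_dom c")
    case True
    have "dist ?p (chart_map c z) > r"
    proof (rule ccontr)
      assume "\<not> ?thesis"
      then have "chart_inv c (chart_map c z) \<in> K" unfolding K_def by (intro imageI) simp
      then show False using True that c by simp
    qed
    then have "(dist ?p (chart_map c z))\<^sup>2 \<ge> r\<^sup>2" using r by (intro power_mono) auto
    then have "(4 / r\<^sup>2) * (dist ?p (chart_map c z))\<^sup>2 \<ge> (4 / r\<^sup>2) * r\<^sup>2"
      using r by (intro mult_left_mono) auto
    moreover have "(4 / r\<^sup>2) * r\<^sup>2 = 4" using r by simp
    ultimately show ?thesis unfolding \<phi>_def \<psi>_def sq by (auto intro!: step_eq_0)
  qed (simp add: \<phi>_def)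
  have \<psi>: "smooth_on UNIV \<psi>"
  proof -
    have "smooth_on UNIV (\<lambda>y. y + (- ?p))"
      by (intro smooth_on_add smooth_on_id smooth_on_const) auto
    then have *: "smooth_on UNIV (\<lambda>y. y - ?p)" by simp
    have "smooth_on UNIV (\<lambda>y. 2 + (- (4 / r\<^sup>2)) * ((y - ?p) \<bullet> (y - ?p)))"
      by (intro smooth_on_add smooth_on_const smooth_on_linear[OF bounded_linear_mult_right]
          smooth_on_bilinear[OF bounded_bilinear_inner] *) auto
    then have "smooth_on UNIV (\<lambda>y. 2 - (4 / r\<^sup>2) * ((y - ?p) \<bullet> (y - ?p)))" by simp
    moreover have "smooth_on UNIV step" using Ck_on_step by (simp add: smooth_on_def)
    ultimately show ?thesis unfolding \<psi>_def[abs_def]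
      using smooth_on_compose[of UNIV UNIV _ step] by auto
  qed
  have "\<phi> \<in> smooth_functions N"
  proof (rule smooth_functionsI)
    fix w
    show "\<exists>c\<in>atlas N. \<exists>W. open W \<and> w \<in> W \<and> w \<in> chart_dom c \<and>
      smooth_on (chart_map c ` (W \<inter> chart_dom c)) (\<lambda>y. \<phi> (chart_inv c y))"
    proof (cases "w \<in> chart_dom c")
      case True
      have "smooth_on (chart_map c ` (UNIV \<inter> chart_dom c)) (\<lambda>y. \<phi> (chart_inv c y))"
        by (rule smooth_on_transform[OF open_map_image[OF c] smooth_on_subset[OF \<psi>]])
          (use c in \<open>auto simp: \<phi>_def\<close>)
      then show ?thesis using True c by (intro bexI[of _ c] exI[of _ UNIV]) auto
    next
      case False
      let ?d = "chart_at N w"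
      have o: "open (chart_map ?d ` (- K \<inter> chart_dom ?d))" using open_map_image[of ?d "- K"] K by auto
      have "smooth_on (chart_map ?d ` (- K \<inter> chart_dom ?d)) (\<lambda>y. \<phi> (chart_inv ?d y))"
        by (rule smooth_on_transform[OF o smooth_on_const[OF o, of 0]]) (auto simp: zero)
      then show ?thesis using False Kd K by (intro bexI[of _ ?d] exI[of _ "- K"]) auto
    qed
  qed
  then show ?thesis using that V K Kd one zero by blast
qed

text \<open>Multiplying by a bump function turns a function of the coordinates into a global one
  without changing it near \<open>x\<close>, as required by operators that act on global objects
  only.\<close>

lemma smooth_extension:
  assumes c: "c \<in> atlas N" and x: "x \<in> chart_dom c" and \<psi>: "smooth_on (chart_image c) \<psi>"
  obtains u V where "u \<in> smooth_functions N" "open V" "x \<in> V" "V \<subseteq> chart_dom c"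
    "\<And>z. z \<in> V \<Longrightarrow> u z = \<psi> (chart_map c z)"
proof -
  obtain \<phi> V K where b: "\<phi> \<in> smooth_functions N" "open V" "x \<in> V" "V \<subseteq> chart_dom c" "closed K"
    "K \<subseteq> chart_dom c" "\<And>z. z \<in> V \<Longrightarrow> \<phi> z = 1" "\<And>z. z \<notin> K \<Longrightarrow> \<phi> z = 0"
    using bump_function[OF c x] by blast
  define u where "u z = \<phi> z * \<psi> (chart_map c z)" for z
  have "u \<in> smooth_functions N"
  proof (rule smooth_functionsI)
    fix w
    show "\<exists>c\<in>atlas N. \<exists>W. open W \<and> w \<in> W \<and> w \<in> chart_dom c \<and>
      smooth_on (chart_map c ` (W \<inter> chart_dom c)) (\<lambda>y. u (chart_inv c y))"
    proof (cases "w \<in> chart_dom c")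
      case True
      have "smooth_on (chart_image c) (\<lambda>y. \<phi> (chart_inv c y) * \<psi> y)"
        using smooth_functionsD[OF b(1) c] \<psi> open_image[OF c]
        by (intro smooth_on_bilinear[OF bounded_bilinear_mult])
      then have "smooth_on (chart_map c ` (UNIV \<inter> chart_dom c)) (\<lambda>y. u (chart_inv c y))"
        unfolding Int_UNIV_left
        by (rule smooth_on_transform[OF open_image[OF c]]) (use c in \<open>auto simp: u_def\<close>)
      then show ?thesis using True c by (intro bexI[of _ c] exI[of _ UNIV]) auto
    next
      case False
      let ?d = "chart_at N w"
      have o: "open (chart_map ?d ` (- K \<inter> chart_dom ?d))" using open_map_image[of ?d "- K"] b by auto
      have "smooth_on (chart_map ?d ` (- K \<inter> chart_dom ?d)) (\<lambda>y. u (chart_inv ?d y))"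
        by (rule smooth_on_transform[OF o smooth_on_const[OF o, of 0]]) (auto simp: b u_def)
      then show ?thesis using False b by (intro bexI[of _ ?d] exI[of _ "- K"]) auto
    qed
  qed
  then show ?thesis using that b by (simp add: u_def)
qed

section \<open>Smooth forms and vector fields\<close>

lemma function_derivative:
  assumes "u \<in> smooth_functions N" "c \<in> atlas N" "x \<in> chart_dom c"
  shows "((\<lambda>y. u (chart_inv c y)) has_derivative
    frechet_derivative (\<lambda>y. u (chart_inv c y)) (at (chart_map c x))) (at (chart_map c x))"
  using smooth_on_has_derivative[OF smooth_functionsD] assms by blast

lemma differential_eqI:
  assumes "((\<lambda>y. u (chart_inv (chart_at N x) y)) has_derivative u') (at (chart_map (chart_at N x) x))"
  shows "differential N u x v = u' v"
  using frechet_derivative_at[OF assms] has_derivative_bounded_linear[OF assms]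
  unfolding differential_def comp_def by (simp add: bounded_linear_Blinfun_apply)

lemma has_derivative_differential:
  assumes "u \<in> smooth_functions N"
  shows "((\<lambda>y. u (chart_inv (chart_at N x) y)) has_derivative differential N u x)
    (at (chart_map (chart_at N x) x))"
  using function_derivative[OF assms, of "chart_at N x" x] differential_eqI
  by (metis (no_types, lifting) chart_at ext)

text \<open>\<open>differential\<close> is computed in the preferred chart of each point, and that
  chart may jump from point to point. In a fixed chart the jumps cancel against the change of chart,
  which is why differentials are smooth forms.\<close>

lemma differential_in_chart:
  assumes u: "u \<in> smooth_functions N" and c: "c \<in> atlas N" and x: "x \<in> chart_dom c"
  shows "form_in_chart N (differential N u) c (chart_map c x) v
    = frechet_derivative (\<lambda>y. u (chart_inv c y)) (at (chart_map c x)) v"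
proof -
  have "((\<lambda>y. u (chart_inv c y)) has_derivative
      (\<lambda>v. differential N u x (chart_change c (chart_at N x) x v))) (at (chart_map c x))"
    by (rule change_of_chart_derivative[OF c _ x _ has_derivative_differential[OF u] open_UNIV])
      (use c in auto)
  then show ?thesis using frechet_derivative_at c x by (metis form_in_chart_apply)
qed

lemma differential_one_form: "u \<in> smooth_functions N \<Longrightarrow> differential N u \<in> one_forms N"
  unfolding one_forms_def
proof safe
  fix c assume u: "u \<in> smooth_functions N" and c: "c \<in> atlas N"
  show "smooth_on (chart_image c) (form_in_chart N (differential N u) c)"
  proof (rule smooth_on_blinfun[OF open_image[OF c]])
    fix b
    show "smooth_on (chart_image c) (\<lambda>y. form_in_chart N (differential N u) c y b)"
      by (rule smooth_on_transform[OF open_image[OF c]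
            smooth_on_frechet[OF smooth_functionsD[OF u c], of b]])
        (use differential_in_chart[OF u c] in auto)
  qed
qed

text \<open>The form is the differential of an extension of the linear coordinate function a(y), so
  its coefficients in \<open>c\<close> are constant near \<open>x\<close>.\<close>

lemma coordinate_form:
  assumes c: "c \<in> atlas N" and x: "x \<in> chart_dom c"
  obtains \<omega> V where "\<omega> \<in> one_forms N" "open V" "x \<in> V" "V \<subseteq> chart_dom c"
    "\<And>z v. z \<in> V \<Longrightarrow> \<omega> z v = blinfun_apply a (chart_change (chart_at N z) c z v)"
proof -
  have "smooth_on (chart_image c) (blinfun_apply a)"
    using smooth_on_linear[OF blinfun.bounded_linear_right open_image[OF c] smooth_on_id[OF open_image[OF c]]]
    by blast
  then obtain u V where u: "u \<in> smooth_functions N" "open V" "x \<in> V" "V \<subseteq> chart_dom c"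
    "\<And>z. z \<in> V \<Longrightarrow> u z = a (chart_map c z)"
    using smooth_extension[OF c x] by metis
  have "differential N u z v = a (chart_change (chart_at N z) c z v)" if "z \<in> V" for z v
    by (rule differential_eqI, rule change_of_chart_derivative[OF _ c _ _ _ u(2) that, of _ "blinfun_apply a"])
      (use that u in \<open>auto intro: bounded_linear_imp_has_derivative blinfun.bounded_linear_right\<close>)
  then show ?thesis using that[OF differential_one_form[OF u(1)] u(2-4)] by blast
qed

lemma vector_fields_scale:
  assumes "u \<in> smooth_functions N" "X \<in> vector_fields N"
  shows "(\<lambda>x. u x *\<^sub>R X x) \<in> vector_fields N"
  unfolding vector_fields_def
proof safe
  fix c assume c: "c \<in> atlas N"
  have s: "smooth_on (chart_image c) (\<lambda>y. u (chart_inv c y) *\<^sub>R vector_in_chart N X c y)"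
    using assms c smooth_functionsD
    by (intro smooth_on_bilinear[OF bounded_bilinear_scaleR]) (auto simp: vector_fields_def open_image)
  show "smooth_on (chart_image c) (vector_in_chart N (\<lambda>x. u x *\<^sub>R X x) c)"
    by (rule smooth_on_transform[OF open_image[OF c] s])
      (use c linear_cmul[OF bounded_linear.linear[OF chart_change_linear]] in \<open>auto simp: vector_in_chart_eq\<close>)
qed

lemma vector_fields_add:
  assumes "X \<in> vector_fields N" "Y \<in> vector_fields N"
  shows "(\<lambda>x. X x + Y x) \<in> vector_fields N"
  unfolding vector_fields_def
proof safe
  fix c assume c: "c \<in> atlas N"
  have s: "smooth_on (chart_image c) (\<lambda>y. vector_in_chart N X c y + vector_in_chart N Y c y)"
    using assms c by (intro smooth_on_add) (auto simp: vector_fields_def open_image)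
  show "smooth_on (chart_image c) (vector_in_chart N (\<lambda>x. X x + Y x) c)"
    by (rule smooth_on_transform[OF open_image[OF c] s])
      (use c linear_add[OF bounded_linear.linear[OF chart_change_linear]] in \<open>auto simp: vector_in_chart_eq\<close>)
qed

lemma vector_fields_zero: "(\<lambda>x. 0) \<in> vector_fields N"
  unfolding vector_fields_def
proof safe
  fix c assume c: "c \<in> atlas N"
  show "smooth_on (chart_image c) (vector_in_chart N (\<lambda>x. 0) c)"
    by (rule smooth_on_transform[OF open_image[OF c] smooth_on_const[OF open_image[OF c], of 0]])
      (use c linear_0[OF bounded_linear.linear[OF chart_change_linear]] in \<open>auto simp: vector_in_chart_eq\<close>)
qed

lemma vector_fields_sum:
  "(\<And>i. i \<in> I \<Longrightarrow> X i \<in> vector_fields N) \<Longrightarrow> (\<lambda>x. \<Sum>i\<in>I. X i x) \<in> vector_fields N"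
  by (induction I rule: infinite_finite_induct) (auto intro: vector_fields_zero vector_fields_add)

lemma one_forms_scale:
  assumes "u \<in> smooth_functions N" "\<omega> \<in> one_forms N"
  shows "(\<lambda>x. u x *\<^sub>R \<omega> x) \<in> one_forms N"
  unfolding one_forms_def
proof safe
  fix c assume c: "c \<in> atlas N"
  have s: "smooth_on (chart_image c) (\<lambda>y. u (chart_inv c y) *\<^sub>R form_in_chart N \<omega> c y)"
    using assms c smooth_functionsD
    by (intro smooth_on_bilinear[OF bounded_bilinear_scaleR]) (auto simp: one_forms_def open_image)
  show "smooth_on (chart_image c) (form_in_chart N (\<lambda>x. u x *\<^sub>R \<omega> x) c)"
    by (rule smooth_on_transform[OF open_image[OF c] s])
      (use c in \<open>auto intro!: blinfun_eqI simp: form_in_chart_apply blinfun.scaleR_left\<close>)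
qed

lemma one_forms_zero: "(\<lambda>x. 0) \<in> one_forms N"
  unfolding one_forms_def
proof safe
  fix c assume c: "c \<in> atlas N"
  show "smooth_on (chart_image c) (form_in_chart N (\<lambda>x. 0) c)"
    by (rule smooth_on_transform[OF open_image[OF c] smooth_on_const[OF open_image[OF c], of 0]])
      (use c in \<open>auto intro!: blinfun_eqI simp: form_in_chart_apply\<close>)
qed

text \<open>A field cannot be obtained as a differential, so the constant field of the chart is cut
  off by a bump function directly.\<close>

lemma coordinate_field:
  assumes c: "c \<in> atlas N" and x: "x \<in> chart_dom c"
  obtains X V where "X \<in> vector_fields N" "open V" "x \<in> V" "V \<subseteq> chart_dom c"
    "\<And>z. z \<in> V \<Longrightarrow> X z = chart_change c (chart_at N z) z v"
proof -
  obtain \<phi> V K where b: "\<phi> \<in> smooth_functions N" "open V" "x \<in> V" "V \<subseteq> chart_dom c" "closed K"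
    "K \<subseteq> chart_dom c" "\<And>z. z \<in> V \<Longrightarrow> \<phi> z = 1" "\<And>z. z \<notin> K \<Longrightarrow> \<phi> z = 0"
    using bump_function[OF c x] by blast
  define X where "X z = \<phi> z *\<^sub>R chart_change c (chart_at N z) z v" for z
  have "X \<in> vector_fields N" unfolding vector_fields_def
  proof safe
    fix d assume d: "d \<in> atlas N"
    note lin = bounded_linear.linear[OF chart_change_linear]
    show "smooth_on (chart_image d) (vector_in_chart N X d)"
    proof (rule smooth_on_local[OF open_image[OF d]])
      fix y assume "y \<in> chart_image d"
      then obtain w where w: "w \<in> chart_dom d" "y = chart_map d w" by blast
      show "\<exists>T. open T \<and> y \<in> T \<and> smooth_on (chart_image d \<inter> T) (vector_in_chart N X d)"
      proof (cases "w \<in> chart_dom c")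
        case True
        let ?T = "chart_map d ` (chart_dom c \<inter> chart_dom d)"
        have o: "open ?T" using open_overlap c d by blast
        let ?t = "\<lambda>y. chart_map d (chart_inv c y)"
        \<comment> \<open>In another chart \<open>d\<close> the components of a field constant in
          \<open>c\<close> form the Jacobian of the transition, evaluated at the
          \<open>c\<close>-coordinates.\<close>
        have "smooth_on ?T (\<lambda>y. frechet_derivative ?t (at (chart_map c (chart_inv d y))) v)"
          by (rule smooth_on_compose[OF o open_overlap[OF c d] _
                smooth_on_frechet[OF transition_smooth[OF c d]] transition_smooth[OF d c]])
            (use d in auto)
        moreover have "smooth_on ?T (\<lambda>y. \<phi> (chart_inv d y))"
          using smooth_functionsD[OF b(1) d] by (rule smooth_on_subset) auto
        ultimately have s: "smooth_on ?T
          (\<lambda>y. \<phi> (chart_inv d y) *\<^sub>R frechet_derivative ?t (at (chart_map c (chart_inv d y))) v)"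
          using smooth_on_bilinear[OF bounded_bilinear_scaleR o] by blast
        have "smooth_on ?T (vector_in_chart N X d)"
        proof (rule smooth_on_transform[OF o s])
          fix y assume "y \<in> ?T"
          then obtain z where z: "z \<in> chart_dom c" "z \<in> chart_dom d" "y = chart_map d z" by blast
          show "\<phi> (chart_inv d y) *\<^sub>R frechet_derivative ?t (at (chart_map c (chart_inv d y))) v
              = vector_in_chart N X d y"
            using z c d linear_cmul[OF lin, of "chart_at N z" d z]
            by (simp add: vector_in_chart_eq X_def chart_change_compose)
              (simp add: chart_change_def comp_def)
        qed
        then show ?thesis using o w True by (intro exI[of _ ?T]) (auto intro: smooth_on_Int2)
      next
        case False
        let ?T = "chart_map d ` (- K \<inter> chart_dom d)"
        have o: "open ?T" using open_map_image[OF d, of "- K"] b by auto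
        have "smooth_on ?T (vector_in_chart N X d)"
          by (rule smooth_on_transform[OF o smooth_on_const[OF o, of 0]])
            (use d linear_0[OF lin] in \<open>auto simp: vector_in_chart_eq X_def b\<close>)
        then show ?thesis using o w False b by (intro exI[of _ ?T]) (auto intro: smooth_on_Int2)
      qed
    qed
  qed
  then show ?thesis using that[OF _ b(2-4)] b(7) by (simp add: X_def)
qed

text \<open>The Jacobian in the form and the one in the field are inverse to each other, so the
  pairing may be computed in any chart.\<close>

lemma pairing_smooth:
  assumes "\<omega> \<in> one_forms N" "X \<in> vector_fields N"
  shows "(\<lambda>x. \<omega> x (X x)) \<in> smooth_functions N"
  unfolding smooth_functions_def comp_def
proof safe
  fix c assume c: "c \<in> atlas N"
  have s: "smooth_on (chart_image c) (\<lambda>y. form_in_chart N \<omega> c y (vector_in_chart N X c y))"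
    using assms c
    by (intro smooth_on_bilinear[OF bounded_bilinear_blinfun_apply])
      (auto simp: one_forms_def vector_fields_def open_image)
  show "smooth_on (chart_image c) (\<lambda>y. \<omega> (chart_inv c y) (X (chart_inv c y)))"
    by (rule smooth_on_transform[OF open_image[OF c] s])
      (use c in \<open>auto simp: form_in_chart_apply vector_in_chart_eq chart_change_compose chart_change_same\<close>)
qed

text \<open>Pairing with the coordinate fields recovers each component near a given point. Forms
  defined through a metric can thus be recognised as smooth without its coefficients.\<close>

lemma one_formsI:
  assumes "\<And>X. X \<in> vector_fields N \<Longrightarrow> (\<lambda>x. blinfun_apply (\<omega> x) (X x)) \<in> smooth_functions N"
  shows "\<omega> \<in> one_forms N"
  unfolding one_forms_def
proof safe
  fix c assume c: "c \<in> atlas N"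
  show "smooth_on (chart_image c) (form_in_chart N \<omega> c)"
  proof (rule smooth_on_blinfun[OF open_image[OF c]], rule smooth_on_local[OF open_image[OF c]])
    fix b y assume "y \<in> chart_image c"
    then obtain x where x: "x \<in> chart_dom c" "y = chart_map c x" by blast
    obtain X V where X: "X \<in> vector_fields N" "open V" "x \<in> V" "V \<subseteq> chart_dom c"
      "\<And>z. z \<in> V \<Longrightarrow> X z = chart_change c (chart_at N z) z b"
      using coordinate_field[OF c x(1)] by metis
    let ?T = "chart_map c ` (V \<inter> chart_dom c)"
    have o: "open ?T" using open_map_image[OF c X(2)] .
    have "smooth_on ?T (\<lambda>y. \<omega> (chart_inv c y) (X (chart_inv c y)))"
      using smooth_functionsD[OF assms[OF X(1)] c] by (rule smooth_on_subset) auto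
    then have "smooth_on ?T (\<lambda>y. form_in_chart N \<omega> c y b)"
      by (rule smooth_on_transform[OF o]) (use c X in \<open>auto simp: form_in_chart_apply\<close>)
    then show "\<exists>T. open T \<and> y \<in> T \<and> smooth_on (chart_image c \<inter> T) (\<lambda>y. form_in_chart N \<omega> c y b)"
      using o x X by (intro exI[of _ ?T]) (auto intro: smooth_on_Int2)
  qed
qed

text \<open>The dual test, with coordinate forms; it applies to the anchor, which is known only
  through its pairings.\<close>

lemma vector_fieldsI:
  assumes "\<And>\<omega>. \<omega> \<in> one_forms N \<Longrightarrow> (\<lambda>x. blinfun_apply (\<omega> x) (X x)) \<in> smooth_functions N"
  shows "X \<in> vector_fields N"
  unfolding vector_fields_def
proof safe
  fix c assume c: "c \<in> atlas N"
  show "smooth_on (chart_image c) (vector_in_chart N X c)"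
  proof (rule smooth_on_vector[OF open_image[OF c]], rule smooth_on_local[OF open_image[OF c]])
    fix b y assume "y \<in> chart_image c"
    then obtain x where x: "x \<in> chart_dom c" "y = chart_map c x" by blast
    obtain \<omega> V where \<omega>: "\<omega> \<in> one_forms N" "open V" "x \<in> V" "V \<subseteq> chart_dom c"
      "\<And>z v. z \<in> V \<Longrightarrow> \<omega> z v = blinfun_inner_left b (chart_change (chart_at N z) c z v)"
      using coordinate_form[OF c x(1), of "blinfun_inner_left b"] by metis
    let ?T = "chart_map c ` (V \<inter> chart_dom c)"
    have o: "open ?T" using open_map_image[OF c \<omega>(2)] .
    have "smooth_on ?T (\<lambda>y. \<omega> (chart_inv c y) (X (chart_inv c y)))"
      using smooth_functionsD[OF assms[OF \<omega>(1)] c] by (rule smooth_on_subset) auto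
    then have "smooth_on ?T (\<lambda>y. vector_in_chart N X c y \<bullet> b)"
      by (rule smooth_on_transform[OF o]) (use c \<omega> in \<open>auto simp: vector_in_chart_eq inner_commute\<close>)
    then show "\<exists>T. open T \<and> y \<in> T \<and> smooth_on (chart_image c \<inter> T) (\<lambda>y. vector_in_chart N X c y \<bullet> b)"
      using o x \<omega> by (intro exI[of _ ?T]) (auto intro: smooth_on_Int2)
  qed
qed

text \<open>Makes it possible to test pointwise tensor identities with global forms.\<close>

lemma one_form_through:
  obtains \<omega> where "\<omega> \<in> one_forms N" "\<omega> x = a"
proof -
  obtain \<omega> V where \<omega>: "\<omega> \<in> one_forms N" "x \<in> V"
    "\<And>z v. z \<in> V \<Longrightarrow> \<omega> z v = a (chart_change (chart_at N z) (chart_at N x) z v)"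
    using coordinate_form[of "chart_at N x" x a] by (metis chart_at)
  then have "\<omega> x = a" by (intro blinfun_eqI) (simp add: chart_change_same)
  then show ?thesis using that \<omega> by blast
qed

lemma vector_field_through:
  obtains X where "X \<in> vector_fields N" "X x = v"
proof -
  obtain X V where X: "X \<in> vector_fields N" "x \<in> V"
    "\<And>z. z \<in> V \<Longrightarrow> X z = chart_change (chart_at N x) (chart_at N z) z v"
    using coordinate_field[of "chart_at N x" x v] by (metis chart_at)
  then have "X x = v" by (simp add: chart_change_same)
  then show ?thesis using that X by blast
qed

end

section \<open>Nondegenerate symmetric forms\<close>

locale inner_form =
  fixes G :: "'e::euclidean_space \<Rightarrow> 'e \<Rightarrow> real"
  assumes bilinear: "bilinear G" and sym: "G v w = G w v"
    and nondegenerate: "(\<And>w. G v w = 0) \<Longrightarrow> v = 0"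
begin

lemmas form_simps = bilinear_ladd[OF bilinear] bilinear_radd[OF bilinear]
  bilinear_lmul[OF bilinear] bilinear_rmul[OF bilinear] bilinear_lsub[OF bilinear]
  bilinear_rsub[OF bilinear] bilinear_lzero[OF bilinear] bilinear_rzero[OF bilinear]

lemma linear_left: "linear (\<lambda>v. G v w)" and linear_right: "linear (G v)"
  using bilinear unfolding bilinear_def by blast+

lemma form_sum_left: "G (\<Sum>i\<in>I. v i) w = (\<Sum>i\<in>I. G (v i) w)"
  using linear_sum[OF linear_left[of w]] by simp

definition flat_form :: "'e \<Rightarrow> 'e \<Rightarrow>\<^sub>L real" where
  "flat_form v = Blinfun (G v)"

lemma flat_form_apply: "flat_form v w = G v w"
  unfolding flat_form_def
  by (rule bounded_linear_Blinfun_apply[THEN fun_cong])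
    (simp add: linear_right linear_conv_bounded_linear[symmetric])

text \<open>\<open>L\<close> is the Gram map of \<open>G\<close> with respect to the Euclidean
  product: nondegeneracy makes it injective, hence surjective in finite dimension. This justifies
  the description operator in \<open>metric_sharp\<close>.\<close>

lemma ex1_sharp: "\<exists>!v. \<forall>w. G v w = blinfun_apply a w"
proof -
  define L where "L v = (\<Sum>b\<in>Basis. G v b *\<^sub>R b)" for v
  have L: "L v \<bullet> b = G v b" if "b \<in> Basis" for v b
    using that by (simp add: L_def inner_sum_left inner_Basis if_distrib cong: if_cong)
  have lin: "linear L" unfolding L_def
    by (rule linearI) (simp_all add: form_simps scaleR_left_distrib sum.distrib scaleR_sum_right)
  have rep: "(\<forall>w. G v w = h w) \<longleftrightarrow> (\<forall>b\<in>Basis. G v b = h b)" if "linear h" for v and h :: "'e \<Rightarrow> real"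
    using linear_eq_on_span[OF linear_right that, of Basis v] span_Basis by auto
  have "v = 0" if "L v = 0" for v
  proof (rule nondegenerate)
    have "\<forall>w. G v w = (\<lambda>w. 0) w"
      using rep[of "\<lambda>w. 0" v] L[of _ v] that by (simp add: linear_zero)
    then show "G v w = 0" for w by simp
  qed
  then have inj: "inj L" using lin by (simp add: linear_injective_0)
  then have "surj L" using linear_injective_imp_surjective[OF lin] by simp
  then obtain v where v: "L v = (\<Sum>b\<in>Basis. a b *\<^sub>R b)" by (metis surjD)
  have "\<forall>b\<in>Basis. G v b = a b"
    using v by (simp add: L[symmetric] inner_sum_left inner_Basis if_distrib cong: if_cong)
  then have "\<forall>w. G v w = a w"
    using rep[of "blinfun_apply a" v] by (simp add: blinfun.bounded_linear_right bounded_linear.linear)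
  moreover have "v = v'" if "\<forall>w. G v w = a w" "\<forall>w. G v' w = a w" for v v'
    using nondegenerate[of "v - v'"] that by (simp add: form_simps)
  ultimately show ?thesis by blast
qed

definition orthonormal :: "nat \<Rightarrow> (nat \<Rightarrow> real) \<Rightarrow> (nat \<Rightarrow> 'e) \<Rightarrow> bool" where
  "orthonormal m \<epsilon> v \<longleftrightarrow> (\<forall>i<m. \<epsilon> i = 1 \<or> \<epsilon> i = -1) \<and>
     (\<forall>i<m. \<forall>j<m. G (v i) (v j) = (if i = j then \<epsilon> i else 0))"

text \<open>The usual Gram-Schmidt cancellation; the coefficient carries \<epsilon> because each
  sign is its own inverse.\<close>

lemma orthonormal_residual:
  assumes "orthonormal m \<epsilon> v" "j < m"
  shows "G (z - (\<Sum>i<m. (\<epsilon> i * G z (v i)) *\<^sub>R v i)) (v j) = 0"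
proof -
  have "(\<Sum>i<m. \<epsilon> i * G z (v i) * G (v i) (v j)) = (\<Sum>i<m. if i = j then \<epsilon> j * G z (v j) * \<epsilon> j else 0)"
    using assms by (intro sum.cong) (auto simp: orthonormal_def)
  moreover have "\<epsilon> j * \<epsilon> j = 1" using assms by (auto simp: orthonormal_def)
  ultimately show ?thesis using assms(2)
    by (simp add: form_simps form_sum_left mult.commute mult.left_commute)
qed

text \<open>With an indefinite form the residual of a vector outside the span may be null. A second
  vector \<open>t\<close> pairs nontrivially with it, and by polarisation one of the two residuals
  or their sum has nonzero square.\<close>

lemma orthonormal_extend:
  assumes o: "orthonormal m \<epsilon> v" and m: "m < DIM('e)"
  obtains \<epsilon>' v' where "orthonormal (Suc m) \<epsilon>' v'"
proof -
  define P where "P z = z - (\<Sum>i<m. (\<epsilon> i * G z (v i)) *\<^sub>R v i)" for z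
  have res: "G (P z) (v j) = 0" if "j < m" for z j
    unfolding P_def by (rule orthonormal_residual[OF o that])
  have "span (v ` {..<m}) \<noteq> UNIV"
  proof
    assume "span (v ` {..<m}) = UNIV"
    then have "dim (UNIV :: 'e set) \<le> card (v ` {..<m})" by (intro dim_le_card) auto
    also have "\<dots> \<le> m" using card_image_le[of "{..<m}" v] by simp
    finally show False using m by simp
  qed
  then obtain z where z: "z \<notin> span (v ` {..<m})" by blast
  have p: "P z \<noteq> 0"
  proof
    assume "P z = 0"
    then have "z = (\<Sum>i<m. (\<epsilon> i * G z (v i)) *\<^sub>R v i)" by (simp add: P_def)
    also have "\<dots> \<in> span (v ` {..<m})" by (intro span_sum span_scale span_base) auto
    finally show False using z by blast
  qed
  then obtain t where t: "G (P z) t \<noteq> 0" using nondegenerate by blast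
  \<comment> \<open>Replacing \<open>t\<close> by its residual does not change its pairing with
    \<open>P z\<close>, which is orthogonal to every \<open>v i\<close>.\<close>
  have "G (P z) (\<Sum>i<m. (\<epsilon> i * G t (v i)) *\<^sub>R v i) = 0"
    using res by (simp add: linear_sum[OF linear_right] form_simps)
  then have "G (P z) (P t) \<noteq> 0" using t by (simp add: P_def[of t] bilinear_rsub[OF bilinear])
  moreover have "G (P z + P t) (P z + P t) = G (P z) (P z) + G (P t) (P t) + 2 * G (P z) (P t)"
    using sym[of "P t" "P z"] by (simp add: bilinear_ladd[OF bilinear] bilinear_radd[OF bilinear])
  ultimately have "G (P z) (P z) \<noteq> 0 \<or> G (P t) (P t) \<noteq> 0 \<or> G (P z + P t) (P z + P t) \<noteq> 0"
    by linarith
  moreover have "G (P z + P t) (v j) = 0" if "j < m" for j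
    using res[OF that] by (simp add: bilinear_ladd[OF bilinear])
  ultimately obtain w where w: "G w w \<noteq> 0" "\<And>j. j < m \<Longrightarrow> G w (v j) = 0" using res by metis
  define u where "u = (1 / sqrt \<bar>G w w\<bar>) *\<^sub>R w"
  have "G u u = sgn (G w w)"
  proof -
    have "G u u = G w w / (sqrt \<bar>G w w\<bar>)\<^sup>2" by (simp add: u_def form_simps power2_eq_square)
    then show ?thesis by (simp add: sgn_div_norm divide_inverse mult.commute)
  qed
  moreover have "G u (v j) = 0" "G (v j) u = 0" if "j < m" for j
    using w(2)[OF that] sym[of "v j" u] by (simp_all add: u_def form_simps)
  ultimately have "orthonormal (Suc m) (\<epsilon>(m := sgn (G w w))) (v(m := u))"
    using o w(1) unfolding orthonormal_def by (auto simp: less_Suc_eq sgn_if)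
  then show ?thesis using that by blast
qed

lemma orthonormal_exists: "m \<le> DIM('e) \<Longrightarrow> \<exists>\<epsilon> v. orthonormal m \<epsilon> v"
proof (induction m)
  case 0
  have "orthonormal 0 (\<lambda>i. 1) (\<lambda>i. 0)" by (simp add: orthonormal_def)
  then show ?case by blast
next
  case (Suc m)
  then obtain \<epsilon> v where "orthonormal m \<epsilon> v" by auto
  then show ?case using orthonormal_extend[of m \<epsilon> v] Suc.prems by (metis Suc_le_lessD)
qed

text \<open>Pairwise orthogonal vectors of nonzero square are independent, so as many as the
  dimension span the space. The residual is then orthogonal to everything and vanishes by
  nondegeneracy.\<close>

lemma orthonormal_expansion:
  assumes o: "orthonormal DIM('e) \<epsilon> v"
  shows "z = (\<Sum>i<DIM('e). (\<epsilon> i * G z (v i)) *\<^sub>R v i)"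
proof -
  let ?S = "v ` {..<DIM('e)}"
  have ne: "G (v i) (v i) \<noteq> 0" if "i < DIM('e)" for i using o that by (auto simp: orthonormal_def)
  have inj: "inj_on v {..<DIM('e)}"
  proof (rule inj_onI, rule ccontr)
    fix i j assume ij: "i \<in> {..<DIM('e)}" "j \<in> {..<DIM('e)}" "v i = v j" "i \<noteq> j"
    have "G (v i) (v j) = 0" using o ij(1,2,4) by (simp add: orthonormal_def)
    then show False using ij(1,3) ne[of i] by simp
  qed
  have "independent ?S" unfolding dependent_def
  proof safe
    fix i assume i: "i < DIM('e)" "v i \<in> span (?S - {v i})"
    have "G x (v i) = 0" if "x \<in> ?S - {v i}" for x
      using that o i by (auto simp: orthonormal_def)
    then have "G (v i) (v i) = 0"
      using linear_eq_0_on_span[OF linear_left] i(2) by blast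
    then show False using ne i(1) by blast
  qed
  then have "UNIV \<subseteq> span ?S"
    using card_ge_dim_independent[of ?S UNIV] card_image[OF inj] by simp
  moreover let ?d = "z - (\<Sum>i<DIM('e). (\<epsilon> i * G z (v i)) *\<^sub>R v i)"
  have "G ?d x = 0" if "x \<in> ?S" for x
    using that orthonormal_residual[OF o] by blast
  ultimately have "G ?d w = 0" for w
    using linear_eq_0_on_span[OF linear_right] by blast
  then have "?d = 0" by (rule nondegenerate)
  then show ?thesis by simp
qed

end

lemma metric_sharp_apply:
  assumes "inner_form (G x)" shows "G x (metric_sharp G x a) w = a w"
  using theI'[OF inner_form.ex1_sharp[OF assms, of a]] unfolding metric_sharp_def by blast

lemma metric_sharp_eqI:
  assumes "inner_form (G x)" "\<And>w. G x v w = blinfun_apply a w"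
  shows "metric_sharp G x a = v"
  using inner_form.ex1_sharp[OF assms(1), of a] metric_sharp_apply[where G=G and x=x, OF assms(1), of a] assms(2) by blast

lemma cometric_eq:
  assumes "inner_form (G x)" shows "cometric G x a b = a (metric_sharp G x b)"
  by (simp add: cometric_def metric_sharp_apply[where G=G and x=x, OF assms])

lemma cometric_sym:
  assumes "inner_form (G x)" shows "cometric G x a b = cometric G x b a"
  using inner_form.sym[OF assms] by (simp add: cometric_def)

lemma cometric_bilinear:
  assumes "inner_form (G x)" shows "bilinear (cometric G x)"
proof -
  have "linear (\<lambda>a. cometric G x a b)" for b
    by (rule linearI)
      (simp_all add: cometric_eq[where G=G and x=x, OF assms] blinfun.add_left blinfun.scaleR_left)
  moreover from this have "linear (\<lambda>b. cometric G x a b)" for a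
    by (simp add: cometric_sym[where G=G and x=x, OF assms, of a])
  ultimately show ?thesis by (simp add: bilinear_def)
qed

lemma cometric_flat_form:
  assumes "inner_form (G x)"
  shows "cometric G x a (inner_form.flat_form (G x) v) = a v"
  using metric_sharp_eqI[where G=G and x=x, OF assms, of v "inner_form.flat_form (G x) v"]
  by (simp add: cometric_eq[where G=G and x=x, OF assms] inner_form.flat_form_apply[OF assms])

lemma cometric_nondegenerate:
  assumes "inner_form (G x)" "\<And>b. cometric G x a b = 0" shows "a = 0"
  using assms(2)[unfolded cometric_eq[where G=G and x=x, OF assms(1)]] 
  by (intro blinfun_eqI) (metis assms(2) cometric_flat_form[where G=G and x=x, OF assms(1)] zero_blinfun.rep_eq)

lemma cometric_expansion:
  fixes G :: "('a, 'e::euclidean_space) metric"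
  assumes G: "inner_form (G x)" and o: "inner_form.orthonormal (G x) DIM('e) \<epsilon> v"
  shows "cometric G x a b = (\<Sum>i<DIM('e). \<epsilon> i * (a (v i) * b (v i)))"
proof -
  interpret inner_form "G x" by (rule G)
  have "cometric G x a b = a (metric_sharp G x b)" by (rule cometric_eq[where G=G and x=x, OF G])
  also have "\<dots> = a (\<Sum>i<DIM('e). (\<epsilon> i * b (v i)) *\<^sub>R v i)"
    using orthonormal_expansion[OF o, of "metric_sharp G x b"] metric_sharp_apply[where G=G and x=x, OF G]
    by simp
  also have "\<dots> = (\<Sum>i<DIM('e). \<epsilon> i * (a (v i) * b (v i)))"
    by (simp add: blinfun.sum_right blinfun.scaleR_right mult_ac)
  finally show ?thesis .
qed

lemma pseudo_riemannian_inner_form: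
  assumes "pseudo_riemannian_metric N G" shows "inner_form (G x)"
  using assms unfolding pseudo_riemannian_metric_def inner_form_def by blast

section \<open>The anchor\<close>

text \<open>Discharges the description operator in \<open>anchor\<close>: by reflexivity in finite
  dimension, a linear functional on covectors is evaluation at the vector whose coordinates are its
  values on the dual basis.\<close>

lemma anchor_apply:
  fixes P :: "('a, 'e::euclidean_space) cotensor"
  assumes "bilinear (P x)" shows "blinfun_apply b (anchor P \<alpha> x) = P x (\<alpha> x) b"
proof -
  have lin: "linear (P x (\<alpha> x))" using assms by (simp add: bilinear_def)
  let ?v = "\<Sum>i\<in>Basis. P x (\<alpha> x) (blinfun_inner_left i) *\<^sub>R i"
  have "b ?v = P x (\<alpha> x) b" for b :: "'e \<Rightarrow>\<^sub>L real"
  proof -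
    have "b = (\<Sum>i\<in>Basis. b i *\<^sub>R blinfun_inner_left i)"
    proof (rule blinfun_eqI)
      fix w
      have "b w = b (\<Sum>i\<in>Basis. (w \<bullet> i) *\<^sub>R i)" by (simp only: euclidean_representation)
      then show "b w = (\<Sum>i\<in>Basis. b i *\<^sub>R blinfun_inner_left i) w"
        by (simp add: blinfun.sum_right blinfun.scaleR_right blinfun.sum_left blinfun.scaleR_left
            mult.commute inner_commute)
    qed
    then have "P x (\<alpha> x) b = P x (\<alpha> x) (\<Sum>i\<in>Basis. b i *\<^sub>R blinfun_inner_left i)" by (rule arg_cong)
    also have "\<dots> = (\<Sum>i\<in>Basis. b i * P x (\<alpha> x) (blinfun_inner_left i))"
      by (simp add: linear_sum[OF lin] linear_cmul[OF lin])
    finally show ?thesis by (simp add: blinfun.sum_right blinfun.scaleR_right mult.commute)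
  qed
  moreover have "v = ?v" if "\<forall>b::'e \<Rightarrow>\<^sub>L real. blinfun_apply b v = P x (\<alpha> x) b" for v
  proof (rule euclidean_eqI)
    fix i :: 'e assume "i \<in> Basis"
    have "blinfun_inner_left i v = blinfun_inner_left i ?v" using that calculation by metis
    then show "v \<bullet> i = ?v \<bullet> i" by (simp add: inner_commute)
  qed
  ultimately have "\<exists>!v. \<forall>b. blinfun_apply b v = P x (\<alpha> x) b" by blast
  from theI'[OF this] show ?thesis unfolding anchor_def by blast
qed

section \<open>Local orthonormal frames\<close>

context mfd
begin

context
  fixes G assumes G: "pseudo_riemannian_metric N G"
begin

interpretation g: inner_form "G x" for x
  by (rule pseudo_riemannian_inner_form[OF G])

lemma metric_smooth:
  "X \<in> vector_fields N \<Longrightarrow> Y \<in> vector_fields N \<Longrightarrow> (\<lambda>x. G x (X x) (Y x)) \<in> smooth_functions N"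
  using G unfolding pseudo_riemannian_metric_def by blast

lemma smooth_function_nhd:
  assumes "u \<in> smooth_functions N" "u x > r"
  obtains V where "open V" "x \<in> V" "\<And>z. z \<in> V \<Longrightarrow> u z > r"
proof -
  let ?c = "chart_at N x"
  have c: "is_chart ?c" using is_chart by simp
  have "continuous_on (chart_image ?c) (\<lambda>y. u (chart_inv ?c y))"
    using smooth_functionsD[OF assms(1), of ?c] by (simp add: smooth_on_def) (metis Ck_on.simps(1))
  then have "continuous_on (chart_dom ?c) (\<lambda>z. u (chart_inv ?c (chart_map ?c z)))"
    by (rule continuous_on_compose2[OF _ is_chartD(4)[OF c]]) auto
  then have "continuous_on (chart_dom ?c) u" by (rule continuous_on_eq) simp
  then have "open (chart_dom ?c \<inter> u -` {r<..})"
    by (rule continuous_open_preimage) (auto simp: open_dom)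
  then show ?thesis using that[of "chart_dom ?c \<inter> u -` {r<..}"] assms by auto
qed

text \<open>
  Gram-Schmidt on vector fields: the fields are already orthonormal at \<open>x\<close>, so the normalising
  factor \<open>\<epsilon> m * G(Y, Y)\<close> equals 1 at \<open>x\<close> and \<open>rsqrt\<close> can be applied to it globally. Working with
  vector fields and passing to the coframe \<open>G(X\<^sub>i, \<cdot>)\<close> avoids inverting the matrix of \<open>G\<close>; smoothness of
  the cometric then follows from its expansion in the frame.
\<close>

lemma local_frame_partial:
  assumes o: "g.orthonormal x m \<epsilon> v"
  shows "\<exists>X V. open V \<and> x \<in> V \<and> (\<forall>i<m. X i \<in> vector_fields N \<and> X i x = v i) \<and>
    (\<forall>z\<in>V. g.orthonormal z m \<epsilon> (\<lambda>i. X i z))"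
  using o
proof (induction m)
  case 0
  show ?case by (rule exI, rule exI[of _ UNIV]) (auto simp: g.orthonormal_def)
next
  case (Suc m)
  have "g.orthonormal x m \<epsilon> v" using Suc.prems by (auto simp: g.orthonormal_def)
  then obtain X V where V: "open V" "x \<in> V" and X: "\<And>i. i < m \<Longrightarrow> X i \<in> vector_fields N"
    "\<And>i. i < m \<Longrightarrow> X i x = v i" and oV: "\<And>z. z \<in> V \<Longrightarrow> g.orthonormal z m \<epsilon> (\<lambda>i. X i z)"
    using Suc.IH by blast
  obtain X0 where X0: "X0 \<in> vector_fields N" "X0 x = v m"
    using vector_field_through by blast
  have \<epsilon>: "\<epsilon> m * \<epsilon> m = 1" using Suc.prems by (auto simp: g.orthonormal_def)
  define Y where "Y z = X0 z + (-1) *\<^sub>R (\<Sum>i<m. (\<epsilon> i * G z (X0 z) (X i z)) *\<^sub>R X i z)" for z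
  define u where "u z = \<epsilon> m * G z (Y z) (Y z)" for z
  define Z where "Z z = rsqrt (u z) *\<^sub>R Y z" for z
  have Y: "Y \<in> vector_fields N" unfolding Y_def[abs_def]
  proof (intro vector_fields_add vector_fields_scale vector_fields_sum smooth_functions_mult
        smooth_functions_const X0(1))
    fix i assume "i \<in> {..<m}"
    then show "X i \<in> vector_fields N" "(\<lambda>z. G z (X0 z) (X i z)) \<in> smooth_functions N"
      using X(1) metric_smooth[OF X0(1)] by auto
  qed
  have u: "u \<in> smooth_functions N" unfolding u_def[abs_def]
    by (intro smooth_functions_mult smooth_functions_const metric_smooth Y)
  have Z: "Z \<in> vector_fields N" unfolding Z_def[abs_def]
    by (intro vector_fields_scale smooth_functions_rsqrt u Y)
  have "(\<epsilon> i * G x (X0 x) (X i x)) *\<^sub>R X i x = 0" if "i < m" for i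
  proof -
    have "G x (v m) (v i) = 0" using Suc.prems that unfolding g.orthonormal_def
      by (metis less_Suc_eq less_irrefl)
    then show ?thesis using X0(2) X(2)[OF that] by simp
  qed
  then have "(\<Sum>i<m. (\<epsilon> i * G x (X0 x) (X i x)) *\<^sub>R X i x) = 0" by (intro sum.neutral) blast
  then have "Y x = v m" using X0(2) by (simp add: Y_def)
  moreover have "G x (v m) (v m) = \<epsilon> m" using Suc.prems unfolding g.orthonormal_def by simp
  ultimately have ux: "u x = 1" using \<epsilon> by (simp add: u_def)
  then have Zx: "Z x = v m" using \<open>Y x = v m\<close> by (simp add: Z_def rsqrt_1)
  have "u x > 1 / 2" using ux by simp
  then obtain W where W: "open W" "x \<in> W" "\<And>z. z \<in> W \<Longrightarrow> u z > 1 / 2"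
    using smooth_function_nhd[OF u] by metis
  have "g.orthonormal z (Suc m) \<epsilon> (\<lambda>i. (X(m := Z)) i z)" if "z \<in> V" "z \<in> W" for z
  proof -
    have "G z (Y z) (X j z) = 0" if "j < m" for j
      using g.orthonormal_residual[OF oV[OF \<open>z \<in> V\<close>] that, of "X0 z"] by (simp add: Y_def)
    then have 1: "G z (Z z) (X j z) = 0" "G z (X j z) (Z z) = 0" if "j < m" for j
      using that g.sym[of z "X j z"] by (simp_all add: Z_def g.form_simps)
    \<comment> \<open>The bound \<open>u z > 1 / 2\<close> keeps the new direction away from null
      vectors on W, so its sign remains the one prescribed at \<open>x\<close>.\<close>
    have "\<epsilon> m * G z (Z z) (Z z) = 1"
      using rsqrt_square[OF W(3)[OF that(2)]] by (simp add: Z_def g.form_simps u_def mult_ac)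
    then have "\<epsilon> m * \<epsilon> m * G z (Z z) (Z z) = \<epsilon> m" by (simp add: mult.assoc)
    then have "G z (Z z) (Z z) = \<epsilon> m" using \<epsilon> by simp
    then show ?thesis using 1 oV[OF that(1)] \<open>g.orthonormal x (Suc m) \<epsilon> v\<close>
      unfolding g.orthonormal_def by (simp add: less_Suc_eq all_conj_distrib)
  qed
  moreover have "open (V \<inter> W)" "x \<in> V \<inter> W" using V W by auto
  moreover have "\<forall>i<Suc m. (X(m := Z)) i \<in> vector_fields N \<and> (X(m := Z)) i x = v i"
    using X Z Zx by (auto simp: less_Suc_eq)
  ultimately show ?case by (intro exI[of _ "X(m := Z)"] exI[of _ "V \<inter> W"]) auto
qed

lemma local_frame:
  obtains X \<epsilon> V where "open V" "x \<in> V" "\<And>i. i < DIM('e) \<Longrightarrow> X i \<in> vector_fields N"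
    "\<And>z. z \<in> V \<Longrightarrow> g.orthonormal z DIM('e) \<epsilon> (\<lambda>i. X i z)"
proof -
  obtain \<epsilon> v where "g.orthonormal x DIM('e) \<epsilon> v" using g.orthonormal_exists by blast
  then show ?thesis using local_frame_partial that by metis
qed

lemma cometric_smooth:
  assumes "\<alpha> \<in> one_forms N" "\<beta> \<in> one_forms N"
  shows "(\<lambda>x. cometric G x (\<alpha> x) (\<beta> x)) \<in> smooth_functions N"
proof (rule smooth_functions_local)
  fix x
  obtain X \<epsilon> V where V: "open V" "x \<in> V" "\<And>i. i < DIM('e) \<Longrightarrow> X i \<in> vector_fields N"
    "\<And>z. z \<in> V \<Longrightarrow> g.orthonormal z DIM('e) \<epsilon> (\<lambda>i. X i z)" by (rule local_frame[of x]) (rule that)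
  have "(\<lambda>z. \<Sum>i<DIM('e). \<epsilon> i * (\<alpha> z (X i z) * \<beta> z (X i z))) \<in> smooth_functions N"
    using V(3) assms
    by (intro smooth_functions_sum smooth_functions_mult smooth_functions_const pairing_smooth) auto
  then show "\<exists>W v. open W \<and> x \<in> W \<and> v \<in> smooth_functions N \<and>
      (\<forall>z\<in>W. cometric G z (\<alpha> z) (\<beta> z) = v z)"
    using V cometric_expansion[where G=G, OF g.inner_form_axioms V(4)] by blast
qed

text \<open>Lowering indices with \<open>G\<close> carries the metric to the cometric, so an
  orthonormal frame becomes an orthonormal coframe. This is what makes \<open>ricci_eq\<close>
  informative at each point.\<close>

lemma local_coframe:
  obtains \<eta> \<epsilon> V where "x \<in> V" "local_orthonormal_coframe N (cometric G) V \<epsilon> \<eta>"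
proof -
  obtain X \<epsilon> V where V: "open V" "x \<in> V" and X: "\<And>i. i < DIM('e) \<Longrightarrow> X i \<in> vector_fields N"
    and o: "\<And>z. z \<in> V \<Longrightarrow> g.orthonormal z DIM('e) \<epsilon> (\<lambda>i. X i z)" by (rule local_frame[of x]) (rule that)
  define \<eta> where "\<eta> i z = g.flat_form z (X i z)" for i z
  have "\<eta> i \<in> one_forms N" if "i < DIM('e)" for i
    unfolding \<eta>_def using X[OF that]
    by (intro one_formsI) (simp add: g.flat_form_apply metric_smooth)
  moreover have "cometric G z (\<eta> i z) (\<eta> j z) = (if i = j then \<epsilon> i else 0)"
    if "z \<in> V" "i < DIM('e)" "j < DIM('e)" for z i j
    using o[OF that(1)] that unfolding \<eta>_def
    by (simp add: cometric_flat_form[where G=G and x=z, OF g.inner_form_axioms] g.flat_form_apply g.orthonormal_def)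
  ultimately have "local_orthonormal_coframe N (cometric G) V \<epsilon> \<eta>"
    using o[OF V(2)] V(1) unfolding local_orthonormal_coframe_def g.orthonormal_def by blast
  then show ?thesis using that V(2) by blast
qed

end

lemma bivector_bilinear: "bivector_field N P \<Longrightarrow> bilinear (P x)"
  unfolding bivector_field_def by blast

lemma bivector_smooth:
  "bivector_field N P \<Longrightarrow> \<alpha> \<in> one_forms N \<Longrightarrow> \<beta> \<in> one_forms N \<Longrightarrow>
    (\<lambda>x. P x (\<alpha> x) (\<beta> x)) \<in> smooth_functions N"
  unfolding bivector_field_def by blast

lemma anchor_smooth:
  assumes "bivector_field N P" "\<alpha> \<in> one_forms N"
  shows "anchor P \<alpha> \<in> vector_fields N"
proof (rule vector_fieldsI)
  fix \<omega> assume \<omega>: "\<omega> \<in> one_forms N"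
  have "blinfun_apply (\<omega> x) (anchor P \<alpha> x) = P x (\<alpha> x) (\<omega> x)" for x
    by (rule anchor_apply[OF bivector_bilinear[OF assms(1)]])
  then show "(\<lambda>x. blinfun_apply (\<omega> x) (anchor P \<alpha> x)) \<in> smooth_functions N"
    using bivector_smooth[OF assms \<omega>] by simp
qed

end

section \<open>Product manifolds\<close>

lemma smooth_on_fst:
  fixes f :: "'e::euclidean_space \<Rightarrow> 'w::real_normed_vector" and S :: "('e \<times> 'd::real_normed_vector) set"
  assumes "open S" "open T" "\<And>q. q \<in> S \<Longrightarrow> fst q \<in> T" "smooth_on T f"
  shows "smooth_on S (\<lambda>q. f (fst q))"
  by (rule smooth_on_compose[of S T fst f])
    (use assms smooth_on_linear[OF bounded_linear_fst assms(1) smooth_on_id[OF assms(1)]] in simp_all)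

lemma smooth_on_snd:
  fixes f :: "'d::euclidean_space \<Rightarrow> 'w::real_normed_vector" and S :: "('e::real_normed_vector \<times> 'd) set"
  assumes "open S" "open T" "\<And>q. q \<in> S \<Longrightarrow> snd q \<in> T" "smooth_on T f"
  shows "smooth_on S (\<lambda>q. f (snd q))"
  by (rule smooth_on_compose[of S T snd f])
    (use assms smooth_on_linear[OF bounded_linear_snd assms(1) smooth_on_id[OF assms(1)]] in simp_all)

lemma smooth_on_Pair:
  assumes "open S" "smooth_on S f" "smooth_on S g"
  shows "smooth_on S (\<lambda>y. (f y, g y))"
proof -
  have "smooth_on S (\<lambda>y. (f y, 0) + (0, g y))"
    using assms
    by (intro smooth_on_add smooth_on_linear[of "\<lambda>a. (a, 0)" S f] smooth_on_linear[of "\<lambda>a. (0, a)" S g]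
        bounded_linear_Pair bounded_linear_ident bounded_linear_zero) auto
  then show ?thesis by simp
qed

lemma has_derivative_comp_fst:
  assumes "(h has_derivative h') (at (fst q))"
  shows "((\<lambda>q. h (fst q)) has_derivative (\<lambda>v. h' (fst v))) (at q)"
  using has_derivative_compose[OF has_derivative_fst[OF has_derivative_ident] assms] .

lemma has_derivative_comp_snd:
  assumes "(h has_derivative h') (at (snd q))"
  shows "((\<lambda>q. h (snd q)) has_derivative (\<lambda>v. h' (snd v))) (at q)"
  using has_derivative_compose[OF has_derivative_snd[OF has_derivative_ident] assms] .

lemma product_chart_simps [simp]:
  "chart_dom (product_chart c d) = chart_dom c \<times> chart_dom d"
  "chart_map (product_chart c d) = map_prod (chart_map c) (chart_map d)"
  by (simp_all add: product_chart_def)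

lemma product_manifold_simps [simp]:
  "atlas (product_manifold B F) = {product_chart c d | c d. c \<in> atlas B \<and> d \<in> atlas F}"
  "chart_at (product_manifold B F) p = product_chart (chart_at B (fst p)) (chart_at F (snd p))"
  by (simp_all add: product_manifold_def)

lemma map_prod_image_Times: "map_prod f g ` (A \<times> C) = f ` A \<times> g ` C"
  by force

text \<open>\<open>inv_into\<close> has prescribed values only on the image of the chart, so the
  splitting holds there and later reaches derivatives through agreement on open sets.\<close>

lemma product_chart_inv:
  assumes "is_chart c" "is_chart d" "q \<in> chart_image c \<times> chart_image d"
  shows "inv_into (chart_dom c \<times> chart_dom d) (map_prod (chart_map c) (chart_map d)) q
    = (chart_inv c (fst q), chart_inv d (snd q))"
proof (rule inv_into_f_eq)
  show "inj_on (map_prod (chart_map c) (chart_map d)) (chart_dom c \<times> chart_dom d)"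
    using is_chartD(3)[OF assms(1)] is_chartD(3)[OF assms(2)] by (rule map_prod_inj_on)
qed (use assms in \<open>auto simp: inv_into_into f_inv_into_f\<close>)

lemma is_chart_product:
  assumes c: "is_chart c" and d: "is_chart d"
  shows "is_chart (product_chart c d)"
  unfolding is_chart_def homeomorphism_def product_chart_simps map_prod_image_Times
proof (intro conjI ballI)
  let ?m = "map_prod (chart_map c) (chart_map d)"
  let ?i = "inv_into (chart_dom c \<times> chart_dom d) ?m"
  show "open (chart_dom c \<times> chart_dom d)" "open (chart_image c \<times> chart_image d)"
    using is_chartD[OF c] is_chartD[OF d] by (simp_all add: open_Times)
  show inv: "?i (?m p) = p" if "p \<in> chart_dom c \<times> chart_dom d" for p
    using that c d by (subst product_chart_inv) (auto simp: chart_inv_map)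
  show "?m (?i q) = q" if "q \<in> chart_image c \<times> chart_image d" for q
    using that c d by (subst product_chart_inv) (auto simp: f_inv_into_f)
  show "chart_image c \<times> chart_image d = chart_image c \<times> chart_image d" ..
  show "?i ` (chart_image c \<times> chart_image d) = chart_dom c \<times> chart_dom d"
  proof -
    have "?i ` (?m ` (chart_dom c \<times> chart_dom d)) = chart_dom c \<times> chart_dom d"
      unfolding image_image by (simp only: inv cong: image_cong) simp
    then show ?thesis by (simp add: map_prod_image_Times)
  qed
  have "continuous_on (chart_dom c \<times> chart_dom d) (\<lambda>p. (chart_map c (fst p), chart_map d (snd p)))"
    by (intro continuous_on_Pair continuous_on_compose2[OF is_chartD(4)[OF c]]
        continuous_on_compose2[OF is_chartD(4)[OF d]] continuous_on_fst continuous_on_snd continuous_on_id) auto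
  then show "continuous_on (chart_dom c \<times> chart_dom d) ?m"
    by (simp add: map_prod_def case_prod_beta')
  have "continuous_on (chart_image c \<times> chart_image d) (\<lambda>p. (chart_inv c (fst p), chart_inv d (snd p)))"
    by (intro continuous_on_Pair continuous_on_compose2[OF is_chartD(5)[OF c]]
        continuous_on_compose2[OF is_chartD(5)[OF d]] continuous_on_fst continuous_on_snd continuous_on_id) auto
  then show "continuous_on (chart_image c \<times> chart_image d) ?i"
    by (rule continuous_on_eq) (use product_chart_inv[OF c d] in auto)
qed

section \<open>Covectors and 1-forms on a product\<close>

definition cosum :: "('e::real_normed_vector \<Rightarrow>\<^sub>L real) \<Rightarrow> ('d::real_normed_vector \<Rightarrow>\<^sub>L real) \<Rightarrow> (('e \<times> 'd) \<Rightarrow>\<^sub>L real)" where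
  "cosum a b = (a o\<^sub>L fst_blinfun) + (b o\<^sub>L snd_blinfun)"

lemma cosum_apply [simp]: "cosum a b v = a (fst v) + b (snd v)"
  by (simp add: cosum_def blinfun.add_left)

text \<open>\<open>cosum\<close> identifies pairs of covectors with covectors of the product;
  restriction to the two axes inverts it.\<close>

lemma cosum_eq: "c = cosum (c o\<^sub>L Blinfun (\<lambda>v. (v, 0))) (c o\<^sub>L Blinfun (\<lambda>v. (0, v)))"
  by (rule blinfun_eqI)
    (simp add: bounded_linear_Blinfun_apply bounded_linear_Pair bounded_linear_ident bounded_linear_zero
      flip: blinfun.add_right)

lemma cosum_comp_left [simp]:
  "cosum a b o\<^sub>L Blinfun (\<lambda>v. (v, 0)) = a" "cosum a b o\<^sub>L Blinfun (\<lambda>v. (0, v)) = b"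
  by (rule blinfun_eqI,
      simp add: bounded_linear_Blinfun_apply bounded_linear_Pair bounded_linear_ident bounded_linear_zero)+

lemma cosum_linear:
  "cosum a b + cosum a' b' = cosum (a + a') (b + b')"
  "cosum a b - cosum a' b' = cosum (a - a') (b - b')"
  "r *\<^sub>R cosum a b = cosum (r *\<^sub>R a) (r *\<^sub>R b)"
  "cosum 0 0 = 0"
  by (rule blinfun_eqI; simp add: blinfun.add_left blinfun.diff_left blinfun.scaleR_left algebra_simps)+

lemma bounded_linear_cosum:
  "bounded_linear (\<lambda>a. a o\<^sub>L fst_blinfun)" "bounded_linear (\<lambda>b. b o\<^sub>L snd_blinfun)"
  by (rule bounded_bilinear.bounded_linear_left[OF bounded_bilinear_blinfun_compose])+

text \<open>The sum of the two pullbacks. Horizontal and vertical lifts are the cases with one zero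
  argument, so one computation serves all combinations.\<close>

definition sform :: "('a, 'e::euclidean_space) form \<Rightarrow> ('b, 'd::euclidean_space) form \<Rightarrow> ('a \<times> 'b, 'e \<times> 'd) form" where
  "sform \<alpha> \<beta> p = cosum (\<alpha> (fst p)) (\<beta> (snd p))"

locale product_mfd = B: mfd B + F: mfd F
  for B :: "('a::{t2_space,second_countable_topology}, 'e::euclidean_space) manifold"
    and F :: "('b::{t2_space,second_countable_topology}, 'd::euclidean_space) manifold"
begin

abbreviation "M \<equiv> product_manifold B F"

lemma product_chart_inv':
  assumes "c \<in> atlas B" "d \<in> atlas F" "q \<in> chart_image c \<times> chart_image d"
  shows "chart_inv (product_chart c d) q = (chart_inv c (fst q), chart_inv d (snd q))"
  using product_chart_inv[OF B.is_chart F.is_chart] assms by simp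

lemma smooth_manifold_product: "smooth_manifold M"
proof -
  have "smooth_on (map_prod (chart_map c) (chart_map d) ` (chart_dom c \<times> chart_dom d \<inter> chart_dom c' \<times> chart_dom d'))
      (map_prod (chart_map c') (chart_map d') \<circ> inv_into (chart_dom c \<times> chart_dom d) (map_prod (chart_map c) (chart_map d)))"
    if c: "c \<in> atlas B" "c' \<in> atlas B" and d: "d \<in> atlas F" "d' \<in> atlas F" for c d c' d'
  proof -
    let ?S = "chart_map c ` (chart_dom c' \<inter> chart_dom c)" and ?T = "chart_map d ` (chart_dom d' \<inter> chart_dom d)"
    have o: "open ?S" "open ?T" using B.open_overlap F.open_overlap c d by blast+
    then have o': "open (?S \<times> ?T)" by (rule open_Times)
    have s: "smooth_on (?S \<times> ?T) (\<lambda>q. (chart_map c' (chart_inv c (fst q)), chart_map d' (chart_inv d (snd q))))"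
      by (intro smooth_on_Pair o' smooth_on_fst[OF o' o(1) _ B.transition_smooth[OF c]]
          smooth_on_snd[OF o' o(2) _ F.transition_smooth[OF d]]) auto
    have "smooth_on (?S \<times> ?T)
        (map_prod (chart_map c') (chart_map d') \<circ> inv_into (chart_dom c \<times> chart_dom d) (map_prod (chart_map c) (chart_map d)))"
    proof (rule smooth_on_transform[OF o' s])
      fix q assume q: "q \<in> ?S \<times> ?T"
      then have "q \<in> chart_image c \<times> chart_image d" by auto
      from product_chart_inv[OF B.is_chart[OF c(1)] F.is_chart[OF d(1)] this]
      show "(chart_map c' (chart_inv c (fst q)), chart_map d' (chart_inv d (snd q))) =
         (map_prod (chart_map c') (chart_map d') \<circ> inv_into (chart_dom c \<times> chart_dom d) (map_prod (chart_map c) (chart_map d))) q"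
        by simp
    qed
    moreover have "map_prod (chart_map c) (chart_map d) ` (chart_dom c \<times> chart_dom d \<inter> chart_dom c' \<times> chart_dom d') = ?S \<times> ?T"
      unfolding Times_Int_Times map_prod_image_Times by (simp add: Int_commute)
    ultimately show ?thesis by simp
  qed
  then show ?thesis unfolding smooth_manifold_def
    using is_chart_product[OF B.is_chart F.is_chart] by (auto simp: mem_Times_iff)
qed

sublocale M: mfd M
  by (rule mfd.intro) (rule smooth_manifold_product)

lemma product_atlas: "c \<in> atlas B \<Longrightarrow> d \<in> atlas F \<Longrightarrow> product_chart c d \<in> atlas M"
  by auto

abbreviation kB where "kB x \<equiv> chart_at B x"
abbreviation kF where "kF y \<equiv> chart_at F y"

text \<open>Formulas for functions read in a product chart are valid on the open rectangle of
  coordinates only; the derivative sees nothing beyond it.\<close>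

lemma has_derivative_product_chart:
  assumes c: "c \<in> atlas B" "x \<in> chart_dom c" and d: "d \<in> atlas F" "y \<in> chart_dom d"
    and h: "(h has_derivative h') (at (chart_map c x, chart_map d y))"
    and eq: "\<And>x y. x \<in> chart_dom c \<Longrightarrow> y \<in> chart_dom d \<Longrightarrow>
      u (chart_map c x, chart_map d y) = h (chart_map c x, chart_map d y)"
  shows "(u has_derivative h') (at (chart_map c x, chart_map d y))"
proof (rule has_derivative_transform_within_open[OF h])
  show "open (chart_image c \<times> chart_image d)"
    using B.open_image[OF c(1)] F.open_image[OF d(1)] by (rule open_Times)
qed (use c d eq in auto)

lemma inv_simp [simp]:
  assumes "c \<in> atlas B" "x \<in> chart_dom c" "d \<in> atlas F" "y \<in> chart_dom d"
  shows "inv_into (chart_dom c \<times> chart_dom d) (map_prod (chart_map c) (chart_map d))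
    (chart_map c x, chart_map d y) = (x, y)"
  using product_chart_inv'[OF assms(1,3), of "(chart_map c x, chart_map d y)"] assms by simp

text \<open>The Jacobian is block diagonal because transitions act on the factors separately; hence
  components of split forms and fields split as well.\<close>

lemma chart_change_product:
  assumes c: "c \<in> atlas B" "x \<in> chart_dom c" "c' \<in> atlas B" "x \<in> chart_dom c'"
    and d: "d \<in> atlas F" "y \<in> chart_dom d" "d' \<in> atlas F" "y \<in> chart_dom d'"
  shows "chart_change (product_chart c d) (product_chart c' d') (x, y) v
    = (chart_change c c' x (fst v), chart_change d d' y (snd v))"
proof -
  have "((\<lambda>q. (chart_map c' (chart_inv c (fst q)), chart_map d' (chart_inv d (snd q)))) has_derivative
      (\<lambda>v. (chart_change c c' x (fst v), chart_change d d' y (snd v)))) (at (chart_map c x, chart_map d y))"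
    using B.transition_derivative[OF c(1,3,2,4)] F.transition_derivative[OF d(1,3,2,4)]
    by (intro has_derivative_Pair has_derivative_comp_fst has_derivative_comp_snd)
      (simp_all only: fst_conv snd_conv)
  then have 1: "((\<lambda>q. chart_map (product_chart c' d') (chart_inv (product_chart c d) q)) has_derivative
      (\<lambda>v. (chart_change c c' x (fst v), chart_change d d' y (snd v)))) (at (chart_map c x, chart_map d y))"
    by (rule has_derivative_product_chart[OF c(1,2) d(1,2)]) (use c d in simp)
  have 2: "((\<lambda>q. chart_map (product_chart c' d') (chart_inv (product_chart c d) q)) has_derivative
      chart_change (product_chart c d) (product_chart c' d') (x, y)) (at (chart_map c x, chart_map d y))"
    using M.transition_derivative[OF product_atlas[OF c(1) d(1)] product_atlas[OF c(3) d(3)], of "(x, y)"] c d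
    by simp
  show ?thesis using fun_cong[OF has_derivative_unique[OF 2 1], of v] by simp
qed

lemma form_in_product_chart:
  assumes c: "c \<in> atlas B" "x \<in> chart_dom c" and d: "d \<in> atlas F" "y \<in> chart_dom d"
  shows "form_in_chart M (sform \<alpha> \<beta>) (product_chart c d) (chart_map c x, chart_map d y)
    = cosum (form_in_chart B \<alpha> c (chart_map c x)) (form_in_chart F \<beta> d (chart_map d y))"
proof (rule blinfun_eqI)
  fix v
  show "form_in_chart M (sform \<alpha> \<beta>) (product_chart c d) (chart_map c x, chart_map d y) v
    = cosum (form_in_chart B \<alpha> c (chart_map c x)) (form_in_chart F \<beta> d (chart_map d y)) v"
    using M.form_in_chart_apply[OF product_atlas[OF c(1) d(1)], of "(x, y)" "sform \<alpha> \<beta>" v] c d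
    by (simp add: B.form_in_chart_apply F.form_in_chart_apply chart_change_product sform_def)
qed

lemma vector_in_product_chart:
  assumes c: "c \<in> atlas B" "x \<in> chart_dom c" and d: "d \<in> atlas F" "y \<in> chart_dom d"
  shows "vector_in_chart M (\<lambda>p. (X (fst p), Y (snd p))) (product_chart c d) (chart_map c x, chart_map d y)
    = (vector_in_chart B X c (chart_map c x), vector_in_chart F Y d (chart_map d y))"
  using M.vector_in_chart_eq[OF product_atlas[OF c(1) d(1)], of "(x, y)"] c d
  by (simp add: B.vector_in_chart_eq F.vector_in_chart_eq chart_change_product)

lemma sform_one_form:
  assumes "\<alpha> \<in> one_forms B" "\<beta> \<in> one_forms F"
  shows "sform \<alpha> \<beta> \<in> one_forms M"
proof -
  have "smooth_on (chart_image c \<times> chart_image d) (form_in_chart M (sform \<alpha> \<beta>) (product_chart c d))"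
    if c: "c \<in> atlas B" and d: "d \<in> atlas F" for c d
  proof -
    have o: "open (chart_image c)" "open (chart_image d)" using B.open_image[OF c] F.open_image[OF d] .
    then have o': "open (chart_image c \<times> chart_image d)" by (rule open_Times)
    have ab: "smooth_on (chart_image c) (form_in_chart B \<alpha> c)" "smooth_on (chart_image d) (form_in_chart F \<beta> d)"
      using assms c d unfolding one_forms_def by blast+
    have s: "smooth_on (chart_image c \<times> chart_image d)
        (\<lambda>q. cosum (form_in_chart B \<alpha> c (fst q)) (form_in_chart F \<beta> d (snd q)))"
      unfolding cosum_def
      by (intro smooth_on_add o' smooth_on_linear[OF bounded_linear_cosum(1)]
          smooth_on_linear[OF bounded_linear_cosum(2)] smooth_on_fst[OF o' o(1) _ ab(1)]
          smooth_on_snd[OF o' o(2) _ ab(2)]) auto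
    show ?thesis
      by (rule smooth_on_transform[OF o' s]) (use c d form_in_product_chart in auto)
  qed
  then show ?thesis unfolding one_forms_def by (auto simp: map_prod_image_Times)
qed

lemma fst_smooth:
  assumes "u \<in> smooth_functions B" shows "(\<lambda>p. u (fst p)) \<in> smooth_functions M"
proof -
  have "smooth_on (chart_image c \<times> chart_image d) (\<lambda>q. u (fst (chart_inv (product_chart c d) q)))"
    if c: "c \<in> atlas B" and d: "d \<in> atlas F" for c d
  proof -
    have o: "open (chart_image c \<times> chart_image d)"
      using B.open_image[OF c] F.open_image[OF d] by (rule open_Times)
    have s: "smooth_on (chart_image c \<times> chart_image d) (\<lambda>q. u (chart_inv c (fst q)))"
      by (rule smooth_on_fst[OF o B.open_image[OF c] _ B.smooth_functionsD[OF assms c]]) auto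
    show ?thesis
      by (rule smooth_on_transform[OF o s]) (use c d in auto)
  qed
  then show ?thesis unfolding smooth_functions_def comp_def by (auto simp: map_prod_image_Times)
qed

lemma snd_smooth:
  assumes "u \<in> smooth_functions F" shows "(\<lambda>p. u (snd p)) \<in> smooth_functions M"
proof -
  have "smooth_on (chart_image c \<times> chart_image d) (\<lambda>q. u (snd (chart_inv (product_chart c d) q)))"
    if c: "c \<in> atlas B" and d: "d \<in> atlas F" for c d
  proof -
    have o: "open (chart_image c \<times> chart_image d)"
      using B.open_image[OF c] F.open_image[OF d] by (rule open_Times)
    have s: "smooth_on (chart_image c \<times> chart_image d) (\<lambda>q. u (chart_inv d (snd q)))"
      by (rule smooth_on_snd[OF o F.open_image[OF d] _ F.smooth_functionsD[OF assms d]]) auto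
    show ?thesis
      by (rule smooth_on_transform[OF o s]) (use c d in auto)
  qed
  then show ?thesis unfolding smooth_functions_def comp_def by (auto simp: map_prod_image_Times)
qed

lemma differential_fst:
  assumes "u \<in> smooth_functions B"
  shows "differential M (\<lambda>p. u (fst p)) p = cosum (differential B u (fst p)) 0"
proof (cases p)
  case (Pair x y)
  let ?k = "product_chart (kB x) (kF y)"
  have "((\<lambda>q. u (chart_inv (kB x) (fst q))) has_derivative (\<lambda>v. differential B u x (fst v)))
      (at (chart_map (kB x) x, chart_map (kF y) y))"
    by (rule has_derivative_comp_fst) (use B.has_derivative_differential[OF assms] in simp)
  then have "((\<lambda>q. u (fst (chart_inv ?k q))) has_derivative (\<lambda>v. differential B u x (fst v)))
      (at (chart_map (kB x) x, chart_map (kF y) y))"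
    by (rule has_derivative_product_chart[rotated 4]) auto
  then show ?thesis using Pair
    by (intro blinfun_eqI) (subst M.differential_eqI, auto)
qed

lemma differential_snd:
  assumes "u \<in> smooth_functions F"
  shows "differential M (\<lambda>p. u (snd p)) p = cosum 0 (differential F u (snd p))"
proof (cases p)
  case (Pair x y)
  let ?k = "product_chart (kB x) (kF y)"
  have "((\<lambda>q. u (chart_inv (kF y) (snd q))) has_derivative (\<lambda>v. differential F u y (snd v)))
      (at (chart_map (kB x) x, chart_map (kF y) y))"
    by (rule has_derivative_comp_snd) (use F.has_derivative_differential[OF assms] in simp)
  then have "((\<lambda>q. u (snd (chart_inv ?k q))) has_derivative (\<lambda>v. differential F u y (snd v)))
      (at (chart_map (kB x) x, chart_map (kF y) y))"
    by (rule has_derivative_product_chart[rotated 4]) auto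
  then show ?thesis using Pair
    by (intro blinfun_eqI) (subst M.differential_eqI, auto)
qed

text \<open>The components of each summand depend on the coordinates of their own factor, so the
  mixed partial derivatives in the coordinate formula vanish.\<close>

lemma lie_derivative_product:
  assumes X: "X \<in> vector_fields B" and Y: "Y \<in> vector_fields F"
    and \<alpha>: "\<alpha> \<in> one_forms B" and \<beta>: "\<beta> \<in> one_forms F"
  shows "lie_derivative M (\<lambda>p. (X (fst p), Y (snd p))) (sform \<alpha> \<beta>) p
    = cosum (lie_derivative B X \<alpha> (fst p)) (lie_derivative F Y \<beta> (snd p))"
proof (cases p)
  case (Pair x y)
  let ?kB = "kB x" and ?kF = "kF y"
  let ?k = "product_chart ?kB ?kF"
  let ?x = "chart_map ?kB x" and ?y = "chart_map ?kF y"
  let ?\<alpha> = "form_in_chart B \<alpha> ?kB" and ?\<beta> = "form_in_chart F \<beta> ?kF"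
  let ?X = "vector_in_chart B X ?kB" and ?Y = "vector_in_chart F Y ?kF"
  have d\<alpha>: "(?\<alpha> has_derivative frechet_derivative ?\<alpha> (at ?x)) (at ?x)"
    by (rule smooth_on_has_derivative[of "chart_image ?kB"]) (use \<alpha> in \<open>auto simp: one_forms_def\<close>)
  have d\<beta>: "(?\<beta> has_derivative frechet_derivative ?\<beta> (at ?y)) (at ?y)"
    by (rule smooth_on_has_derivative[of "chart_image ?kF"]) (use \<beta> in \<open>auto simp: one_forms_def\<close>)
  have dX: "(?X has_derivative frechet_derivative ?X (at ?x)) (at ?x)"
    by (rule smooth_on_has_derivative[of "chart_image ?kB"]) (use X in \<open>auto simp: vector_fields_def\<close>)
  have dY: "(?Y has_derivative frechet_derivative ?Y (at ?y)) (at ?y)"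
    by (rule smooth_on_has_derivative[of "chart_image ?kF"]) (use Y in \<open>auto simp: vector_fields_def\<close>)
  have "((\<lambda>q. cosum (?\<alpha> (fst q)) (?\<beta> (snd q))) has_derivative
      (\<lambda>v. cosum (frechet_derivative ?\<alpha> (at ?x) (fst v)) (frechet_derivative ?\<beta> (at ?y) (snd v)))) (at (?x, ?y))"
    unfolding cosum_def
    by (intro has_derivative_add bounded_linear.has_derivative[OF bounded_linear_cosum(1)]
        bounded_linear.has_derivative[OF bounded_linear_cosum(2)] has_derivative_comp_fst has_derivative_comp_snd)
      (use d\<alpha> d\<beta> in simp_all)
  then have 1: "(form_in_chart M (sform \<alpha> \<beta>) ?k has_derivative
      (\<lambda>v. cosum (frechet_derivative ?\<alpha> (at ?x) (fst v)) (frechet_derivative ?\<beta> (at ?y) (snd v)))) (at (?x, ?y))"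
    by (rule has_derivative_product_chart[rotated 4]) (auto simp: form_in_product_chart)
  have "((\<lambda>q. (?X (fst q), ?Y (snd q))) has_derivative
      (\<lambda>v. (frechet_derivative ?X (at ?x) (fst v), frechet_derivative ?Y (at ?y) (snd v)))) (at (?x, ?y))"
    by (intro has_derivative_Pair has_derivative_comp_fst has_derivative_comp_snd) (use dX dY in simp_all)
  then have 2: "(vector_in_chart M (\<lambda>p. (X (fst p), Y (snd p))) ?k has_derivative
      (\<lambda>v. (frechet_derivative ?X (at ?x) (fst v), frechet_derivative ?Y (at ?y) (snd v)))) (at (?x, ?y))"
    by (rule has_derivative_product_chart[rotated 4]) (auto simp: vector_in_product_chart)
  define lB where "lB v = frechet_derivative ?\<alpha> (at ?x) (X x) v + \<alpha> x (frechet_derivative ?X (at ?x) v)" for v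
  define lF where "lF v = frechet_derivative ?\<beta> (at ?y) (Y y) v + \<beta> y (frechet_derivative ?Y (at ?y) v)" for v
  have bl: "bounded_linear lB" "bounded_linear lF"
    unfolding lB_def lF_def
    by (intro bounded_linear_add blinfun.bounded_linear_right
        bounded_linear_compose[OF blinfun.bounded_linear_right] has_derivative_bounded_linear[OF dX]
        has_derivative_bounded_linear[OF dY])+
  have B: "lie_derivative B X \<alpha> x = Blinfun lB" and F: "lie_derivative F Y \<beta> y = Blinfun lF"
    unfolding lie_derivative_def Let_def lB_def lF_def by simp_all
  have "lie_derivative M (\<lambda>p. (X (fst p), Y (snd p))) (sform \<alpha> \<beta>) p = Blinfun (\<lambda>v. lB (fst v) + lF (snd v))"
    unfolding lie_derivative_def Let_def Pair
    by (simp add: frechet_derivative_at[OF 1, symmetric] frechet_derivative_at[OF 2, symmetric]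
        lB_def lF_def sform_def add_ac)
  also have "\<dots> = cosum (Blinfun lB) (Blinfun lF)"
  proof (rule blinfun_eqI)
    fix v
    have "bounded_linear (\<lambda>v. lB (fst v) + lF (snd v))"
      using bl by (intro bounded_linear_add bounded_linear_compose[OF bl(1) bounded_linear_fst]
          bounded_linear_compose[OF bl(2) bounded_linear_snd])
    then show "Blinfun (\<lambda>v. lB (fst v) + lF (snd v)) v = cosum (Blinfun lB) (Blinfun lF) v"
      using bl by (simp add: bounded_linear_Blinfun_apply)
  qed
  finally show ?thesis using B F Pair by simp
qed

text \<open>The preferred charts of the product are products of preferred charts, so the projection
  is the linear projection in coordinates.\<close>

lemma tangent_map_fst: "tangent_map M B fst p v = fst v"
proof (cases p)
  case (Pair x y)
  let ?h = "chart_map (kB x) \<circ> fst \<circ> chart_inv (product_chart (kB x) (kF y))"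
  have "(?h has_derivative fst) (at (chart_map (kB x) x, chart_map (kF y) y))"
    by (rule has_derivative_product_chart[OF _ _ _ _ has_derivative_fst[OF has_derivative_ident]]) auto
  then show ?thesis unfolding tangent_map_def Pair
    by (simp flip: frechet_derivative_at) (simp add: bounded_linear_Blinfun_apply bounded_linear_fst)
qed

lemma tangent_map_snd: "tangent_map M F snd p v = snd v"
proof (cases p)
  case (Pair x y)
  let ?h = "chart_map (kF y) \<circ> snd \<circ> chart_inv (product_chart (kB x) (kF y))"
  have "(?h has_derivative snd) (at (chart_map (kB x) x, chart_map (kF y) y))"
    by (rule has_derivative_product_chart[OF _ _ _ _ has_derivative_snd[OF has_derivative_ident]]) auto
  then show ?thesis unfolding tangent_map_def Pair
    by (simp flip: frechet_derivative_at) (simp add: bounded_linear_Blinfun_apply bounded_linear_snd)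
qed

lemma tangent_map_slice_left: "tangent_map B M (\<lambda>x. (x, y)) x = Blinfun (\<lambda>v. (v, 0))"
proof -
  let ?h = "map_prod (chart_map (kB x)) (chart_map (kF y)) \<circ> (\<lambda>x. (x, y)) \<circ> chart_inv (kB x)"
  have "((\<lambda>q. (q, chart_map (kF y) y)) has_derivative (\<lambda>v. (v, 0))) (at (chart_map (kB x) x))"
    by (intro has_derivative_Pair has_derivative_ident has_derivative_const)
  then have "(?h has_derivative (\<lambda>v. (v, 0))) (at (chart_map (kB x) x))"
    by (rule has_derivative_transform_within_open[OF _ B.open_image[OF B.chart_at(1)]]) auto
  then show ?thesis unfolding tangent_map_def by (simp flip: frechet_derivative_at)
qed

lemma tangent_map_slice_right: "tangent_map F M (\<lambda>y. (x, y)) y = Blinfun (\<lambda>v. (0, v))"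
proof -
  let ?h = "map_prod (chart_map (kB x)) (chart_map (kF y)) \<circ> (\<lambda>y. (x, y)) \<circ> chart_inv (kF y)"
  have "((\<lambda>q. (chart_map (kB x) x, q)) has_derivative (\<lambda>v. (0, v))) (at (chart_map (kF y) y))"
    by (intro has_derivative_Pair has_derivative_ident has_derivative_const)
  then have "(?h has_derivative (\<lambda>v. (0, v))) (at (chart_map (kF y) y))"
    by (rule has_derivative_transform_within_open[OF _ F.open_image[OF F.chart_at(1)]]) auto
  then show ?thesis unfolding tangent_map_def by (simp flip: frechet_derivative_at)
qed

lemma warped_metric_eq:
  "warped_metric B gB F gF f p v w = gB (fst p) (fst v) (fst w) + (f (fst p))\<^sup>2 * gF (snd p) (snd v) (snd w)"
  by (simp add: warped_metric_def pullback_metric_def tangent_map_fst tangent_map_snd)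

lemma product_bivector_cosum:
  "product_bivector B PB F PF p (cosum a b) (cosum a' b') = PB (fst p) a a' + PF (snd p) b b'"
  unfolding product_bivector_def Let_def tangent_map_slice_left tangent_map_slice_right by simp

end

section \<open>Derivatives along the anchor\<close>

context mfd
begin

lemma one_forms_add:
  assumes "\<alpha> \<in> one_forms N" "\<beta> \<in> one_forms N"
  shows "(\<lambda>x. \<alpha> x + \<beta> x) \<in> one_forms N"
  by (rule one_formsI) (simp add: blinfun.add_left smooth_functions_add pairing_smooth assms)

lemma one_forms_diff:
  assumes "\<alpha> \<in> one_forms N" "\<beta> \<in> one_forms N"
  shows "(\<lambda>x. \<alpha> x - \<beta> x) \<in> one_forms N"
  using one_forms_add[OF assms(1) one_forms_scale[OF smooth_functions_const[of "-1"] assms(2)]] by simp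

lemma differential_add:
  assumes "u \<in> smooth_functions N" "v \<in> smooth_functions N"
  shows "differential N (\<lambda>x. u x + v x) x = differential N u x + differential N v x"
  by (rule blinfun_eqI, rule trans, rule differential_eqI,
      rule has_derivative_add[OF has_derivative_differential[OF assms(1)] has_derivative_differential[OF assms(2)]])
    (simp add: blinfun.add_left)

lemma differential_mult:
  assumes "u \<in> smooth_functions N" "v \<in> smooth_functions N"
  shows "differential N (\<lambda>x. u x * v x) x = u x *\<^sub>R differential N v x + v x *\<^sub>R differential N u x"
  by (rule blinfun_eqI, rule trans, rule differential_eqI,
      rule has_derivative_mult[OF has_derivative_differential[OF assms(1)] has_derivative_differential[OF assms(2)]])
    (simp add: blinfun.add_left blinfun.scaleR_left)

lemma anchor_deriv_mult:
  assumes "u \<in> smooth_functions N" "v \<in> smooth_functions N"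
  shows "anchor_deriv N P \<alpha> (\<lambda>x. u x * v x) x = u x * anchor_deriv N P \<alpha> v x + v x * anchor_deriv N P \<alpha> u x"
  by (simp add: anchor_deriv_def differential_mult[OF assms] blinfun.add_left blinfun.scaleR_left)

lemma differential_const: "differential N (\<lambda>x. r) x = 0"
  by (rule blinfun_eqI, rule trans, rule differential_eqI, rule has_derivative_const) simp

lemma anchor_deriv_const: "anchor_deriv N P \<alpha> (\<lambda>x. r) x = 0"
  by (simp add: anchor_deriv_def differential_const)

lemma smooth_functions_powr:
  assumes "u \<in> smooth_functions N" "\<And>x. u x > 0"
  shows "(\<lambda>x. u x powr a) \<in> smooth_functions N"
  unfolding smooth_functions_def comp_def
proof safe
  fix c assume c: "c \<in> atlas N"
  have "smooth_on {0<..} (\<lambda>t::real. t powr a)" using Ck_on_powr by (simp add: smooth_on_def)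
  from smooth_on_compose[OF open_image[OF c] open_greaterThan _ this smooth_functionsD[OF assms(1) c]]
  show "smooth_on (chart_image c) (\<lambda>y. u (chart_inv c y) powr a)"
    using assms(2) by simp
qed

text \<open>Metric compatibility expands the three derivatives and torsion-freeness the three
  brackets; by symmetry all terms cancel except two copies of the left-hand pairing.\<close>

lemma koszul_formula:
  assumes D: "levi_civita N P g D" and bil: "\<And>x. bilinear (g x)" and sym: "\<And>x a b. g x a b = g x b a"
    and f: "\<alpha> \<in> one_forms N" "\<beta> \<in> one_forms N" "\<gamma> \<in> one_forms N"
  shows "2 * g x (D \<alpha> \<beta> x) (\<gamma> x) =
      anchor_deriv N P \<alpha> (\<lambda>z. g z (\<beta> z) (\<gamma> z)) x + anchor_deriv N P \<beta> (\<lambda>z. g z (\<alpha> z) (\<gamma> z)) x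
    - anchor_deriv N P \<gamma> (\<lambda>z. g z (\<alpha> z) (\<beta> z)) x + g x (koszul_bracket N P \<alpha> \<beta> x) (\<gamma> x)
    - g x (koszul_bracket N P \<beta> \<gamma> x) (\<alpha> x) - g x (koszul_bracket N P \<alpha> \<gamma> x) (\<beta> x)"
proof -
  have comp: "anchor_deriv N P a (\<lambda>z. g z (b z) (c z)) x = g x (D a b x) (c x) + g x (b x) (D a c x)"
    if "a \<in> one_forms N" "b \<in> one_forms N" "c \<in> one_forms N" for a b c
    using D that unfolding levi_civita_def by blast
  have tors: "koszul_bracket N P a b x = D a b x - D b a x"
    if "a \<in> one_forms N" "b \<in> one_forms N" for a b
  proof -
    have "(\<lambda>x. D a b x - D b a x) = koszul_bracket N P a b"
      using D that unfolding levi_civita_def by blast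
    from fun_cong[OF this, of x] show ?thesis by (rule HOL.sym)
  qed
  show ?thesis
    unfolding comp[OF f(1,2,3)] comp[OF f(2,1,3)] comp[OF f(3,1,2)] tors[OF f(1,2)] tors[OF f(2,3)]
      tors[OF f(1,3)] bilinear_lsub[OF bil]
    using sym[of x "\<beta> x" "D \<alpha> \<gamma> x"] sym[of x "\<alpha> x" "D \<beta> \<gamma> x"] sym[of x "\<alpha> x" "D \<gamma> \<beta> x"]
    by linarith
qed

end

context product_mfd
begin

lemma covector_separates:
  fixes v w :: "'x::euclidean_space"
  assumes "\<And>b::'x \<Rightarrow>\<^sub>L real. blinfun_apply b v = blinfun_apply b w" shows "v = w"
proof (rule euclidean_eqI)
  fix i :: 'x assume "i \<in> Basis"
  show "v \<bullet> i = w \<bullet> i" using assms[of "blinfun_inner_left i"] by (simp add: inner_commute)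
qed

lemma bilinear_product_bivector:
  assumes "\<And>x. bilinear (PB x)" "\<And>y. bilinear (PF y)"
  shows "bilinear (product_bivector B PB F PF p)"
  unfolding bilinear_def product_bivector_def Let_def tangent_map_slice_left tangent_map_slice_right
  by (intro conjI allI linearI)
    (simp_all add: bounded_bilinear.add_left[OF bounded_bilinear_blinfun_compose]
      bounded_bilinear.scaleR_left[OF bounded_bilinear_blinfun_compose]
      bilinear_ladd[OF assms(1)] bilinear_ladd[OF assms(2)] bilinear_radd[OF assms(1)] bilinear_radd[OF assms(2)]
      bilinear_lmul[OF assms(1)] bilinear_lmul[OF assms(2)] bilinear_rmul[OF assms(1)] bilinear_rmul[OF assms(2)]
      distrib_left)

text \<open>A vector is determined by its pairings with covectors, each of them a
  \<open>cosum\<close>, and the bivector has no mixed term.\<close>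

lemma anchor_product:
  assumes "\<And>x. bilinear (PB x)" "\<And>y. bilinear (PF y)"
  shows "anchor (product_bivector B PB F PF) (sform \<alpha> \<beta>) p = (anchor PB \<alpha> (fst p), anchor PF \<beta> (snd p))"
proof (rule covector_separates)
  fix c :: "('e \<times> 'd) \<Rightarrow>\<^sub>L real"
  obtain a b where c: "c = cosum a b" using cosum_eq by blast
  show "blinfun_apply c (anchor (product_bivector B PB F PF) (sform \<alpha> \<beta>) p)
      = blinfun_apply c (anchor PB \<alpha> (fst p), anchor PF \<beta> (snd p))"
    unfolding anchor_apply[where P="product_bivector B PB F PF", OF bilinear_product_bivector[where PB=PB and PF=PF, OF assms]]
    by (simp add: c sform_def product_bivector_cosum anchor_apply[where P=PB, OF assms(1)]
        anchor_apply[where P=PF, OF assms(2)])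
qed

text \<open>Anchors and Lie derivatives split, and the bivector evaluates to a function on B plus a
  function on F, whose differential splits too.\<close>

lemma koszul_bracket_product:
  assumes PB: "bivector_field B PB" and PF: "bivector_field F PF"
    and B: "\<alpha> \<in> one_forms B" "\<alpha>' \<in> one_forms B" and F: "\<beta> \<in> one_forms F" "\<beta>' \<in> one_forms F"
  shows "koszul_bracket M (product_bivector B PB F PF) (sform \<alpha> \<beta>) (sform \<alpha>' \<beta>')
    = sform (koszul_bracket B PB \<alpha> \<alpha>') (koszul_bracket F PF \<beta> \<beta>')"
proof
  fix p
  have anch: "anchor (product_bivector B PB F PF) (sform a b) = (\<lambda>p. (anchor PB a (fst p), anchor PF b (snd p)))"
    for a b
    using anchor_product[where PB=PB and PF=PF, OF B.bivector_bilinear[OF PB] F.bivector_bilinear[OF PF]] by blast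
  let ?u = "\<lambda>x. PB x (\<alpha> x) (\<alpha>' x)" and ?w = "\<lambda>y. PF y (\<beta> y) (\<beta>' y)"
  have uw: "?u \<in> smooth_functions B" "?w \<in> smooth_functions F"
    using B.bivector_smooth[OF PB B] F.bivector_smooth[OF PF F] .
  have "differential M (\<lambda>z. product_bivector B PB F PF z (sform \<alpha> \<beta> z) (sform \<alpha>' \<beta>' z)) p
      = cosum (differential B ?u (fst p)) (differential F ?w (snd p))"
    using M.differential_add[OF fst_smooth[OF uw(1)] snd_smooth[OF uw(2)], of p]
    by (simp add: sform_def product_bivector_cosum differential_fst[OF uw(1)] differential_snd[OF uw(2)]
        cosum_linear del: product_manifold_simps)
  moreover have "lie_derivative M (\<lambda>p. (anchor PB a (fst p), anchor PF b (snd p))) (sform a' b') p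
      = cosum (lie_derivative B (anchor PB a) a' (fst p)) (lie_derivative F (anchor PF b) b' (snd p))"
    if "a \<in> one_forms B" "a' \<in> one_forms B" "b \<in> one_forms F" "b' \<in> one_forms F" for a a' b b'
    using that by (intro lie_derivative_product B.anchor_smooth[OF PB] F.anchor_smooth[OF PF])
  ultimately show "koszul_bracket M (product_bivector B PB F PF) (sform \<alpha> \<beta>) (sform \<alpha>' \<beta>') p
      = sform (koszul_bracket B PB \<alpha> \<alpha>') (koszul_bracket F PF \<beta> \<beta>') p"
    unfolding koszul_bracket_def anch using B F by (simp add: sform_def cosum_linear del: product_manifold_simps)
qed

end

section \<open>Warped products\<close>

locale warped = product_mfd B F
  for B :: "('a::{t2_space,second_countable_topology}, 'e::euclidean_space) manifold"
    and F :: "('b::{t2_space,second_countable_topology}, 'd::euclidean_space) manifold" +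
  fixes gB gF PB PF f
  assumes gB: "pseudo_riemannian_metric B gB" and gF: "pseudo_riemannian_metric F gF"
    and PB: "bivector_field B PB" and PF: "bivector_field F PF"
    and f: "warping_function B f" and casimir: "casimir B PB f"
begin

abbreviation "P \<equiv> product_bivector B PB F PF"
abbreviation "g \<equiv> cometric (warped_metric B gB F gF f)"
text \<open>The factor 1/f^2 of the cometric on vertical covectors, written as a power so that
  \<open>smooth_functions_powr\<close> applies.\<close>

abbreviation "r x \<equiv> f x powr (- 2)"

lemma f_pos: "f x > 0" and f_smooth: "f \<in> smooth_functions B"
  using f by (simp_all add: warping_function_def)

lemma r_f: "r x * (f x * f x) = 1"
  using f_pos[of x] by (simp add: powr_minus powr_realpow[of "f x" 2, simplified] power2_eq_square field_simps)

sublocale GB: inner_form "gB x" for x by (rule pseudo_riemannian_inner_form[OF gB])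
sublocale GF: inner_form "gF y" for y by (rule pseudo_riemannian_inner_form[OF gF])

lemma warped_inner_form: "inner_form (warped_metric B gB F gF f p)"
proof
  show "bilinear (warped_metric B gB F gF f p)"
    unfolding bilinear_def
    by (intro conjI allI linearI)
      (simp_all add: warped_metric_eq GB.form_simps GF.form_simps algebra_simps)
  show "warped_metric B gB F gF f p v w = warped_metric B gB F gF f p w v" for v w
    using GB.sym[of _ "fst v" "fst w"] GF.sym[of _ "snd v" "snd w"] by (simp add: warped_metric_eq)
  fix v assume *: "\<And>w. warped_metric B gB F gF f p v w = 0"
  have "fst v = 0"
  proof (rule GB.nondegenerate)
    fix w show "gB (fst p) (fst v) w = 0"
      using *[of "(w, 0)"] by (simp add: warped_metric_eq GF.form_simps)
  qed
  moreover have "snd v = 0"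
  proof (rule GF.nondegenerate)
    fix w show "gF (snd p) (snd v) w = 0"
      using *[of "(0, w)"] f_pos[of "fst p"] by (simp add: warped_metric_eq GB.form_simps)
  qed
  ultimately show "v = 0" by (simp add: prod_eq_iff)
qed

text \<open>The warped metric is an orthogonal sum, so raising an index works in each factor
  separately, with the vertical part divided by f^2.\<close>

lemma g_cosum: "g p (cosum a b) (cosum a' b') = cometric gB (fst p) a a' + r (fst p) * cometric gF (snd p) b b'"
proof -
  let ?v = "(metric_sharp gB (fst p) a', r (fst p) *\<^sub>R metric_sharp gF (snd p) b')"
  have "metric_sharp (warped_metric B gB F gF f) p (cosum a' b') = ?v"
  proof (rule metric_sharp_eqI[where x=p, OF warped_inner_form])
    fix w
    have "(f (fst p))\<^sup>2 * (r (fst p) * c) = c" for c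
      using r_f[of "fst p"] by (simp add: power2_eq_square flip: mult.assoc) (simp add: mult_ac)
    then show "warped_metric B gB F gF f p ?v w = cosum a' b' w"
      by (simp add: warped_metric_eq GF.form_simps metric_sharp_apply[where G=gB, OF GB.inner_form_axioms]
          metric_sharp_apply[where G=gF, OF GF.inner_form_axioms])
  qed
  then show ?thesis
    by (simp add: cometric_eq[where x=p and G="warped_metric B gB F gF f", OF warped_inner_form]
        cometric_eq[where G=gB, OF GB.inner_form_axioms] cometric_eq[where G=gF, OF GF.inner_form_axioms]
        blinfun.scaleR_right)
qed

lemma g_bilinear: "bilinear (g p)"
  by (rule cometric_bilinear[where x=p, OF warped_inner_form])
lemma g_sym: "g p a b = g p b a"
  by (rule cometric_sym[where x=p, OF warped_inner_form])

lemmas g_simps = bilinear_ladd[OF g_bilinear] bilinear_radd[OF g_bilinear]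
  bilinear_lmul[OF g_bilinear] bilinear_rmul[OF g_bilinear] bilinear_lsub[OF g_bilinear]
  bilinear_rsub[OF g_bilinear] bilinear_lzero[OF g_bilinear] bilinear_rzero[OF g_bilinear]

lemma gB_zero [simp]: "cometric gB x 0 a = 0" "cometric gB x a 0 = 0"
  using bilinear_lzero bilinear_rzero cometric_bilinear[where G=gB and x=x, OF GB.inner_form_axioms] by blast+

lemma gF_zero [simp]: "cometric gF y 0 b = 0" "cometric gF y b 0 = 0"
  using bilinear_lzero bilinear_rzero cometric_bilinear[where G=gF and x=y, OF GF.inner_form_axioms] by blast+

definition hlift :: "('a, 'e) form \<Rightarrow> ('a \<times> 'b, 'e \<times> 'd) form" where "hlift \<alpha> = sform \<alpha> (\<lambda>y. 0)"
definition vlift :: "('b, 'd) form \<Rightarrow> ('a \<times> 'b, 'e \<times> 'd) form" where "vlift \<beta> = sform (\<lambda>x. 0) \<beta>"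

lemma hlift_form: "\<alpha> \<in> one_forms B \<Longrightarrow> hlift \<alpha> \<in> one_forms M"
  and vlift_form: "\<beta> \<in> one_forms F \<Longrightarrow> vlift \<beta> \<in> one_forms M"
  unfolding hlift_def vlift_def using sform_one_form B.one_forms_zero F.one_forms_zero by blast+

lemma g_lift:
  "g p (hlift \<alpha> p) (hlift \<alpha>' p) = cometric gB (fst p) (\<alpha> (fst p)) (\<alpha>' (fst p))"
  "g p (hlift \<alpha> p) (vlift \<beta> p) = 0" "g p (vlift \<beta> p) (hlift \<alpha> p) = 0"
  "g p (vlift \<beta> p) (vlift \<beta>' p) = r (fst p) * cometric gF (snd p) (\<beta> (snd p)) (\<beta>' (snd p))"
  unfolding hlift_def vlift_def sform_def g_cosum by simp_all

text \<open>Every covector at a point is the value of a horizontal plus a vertical lift of global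
  forms, so nondegeneracy need only be tested on lifts.\<close>

lemma covector_zeroI:
  assumes "\<And>\<alpha>. \<alpha> \<in> one_forms B \<Longrightarrow> g p a (hlift \<alpha> p) = 0"
    and "\<And>\<beta>. \<beta> \<in> one_forms F \<Longrightarrow> g p a (vlift \<beta> p) = 0"
  shows "a = 0"
proof (rule cometric_nondegenerate[where x=p, OF warped_inner_form])
  fix b :: "('e \<times> 'd) \<Rightarrow>\<^sub>L real"
  obtain b1 b2 where b: "b = cosum b1 b2" using cosum_eq by blast
  obtain \<alpha> where \<alpha>: "\<alpha> \<in> one_forms B" "\<alpha> (fst p) = b1" using B.one_form_through .
  obtain \<beta> where \<beta>: "\<beta> \<in> one_forms F" "\<beta> (snd p) = b2" using F.one_form_through .
  have "b = hlift \<alpha> p + vlift \<beta> p" by (simp add: b hlift_def vlift_def sform_def cosum_linear \<alpha> \<beta>)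
  then show "g p a b = 0" using assms \<alpha> \<beta> by (simp add: g_simps)
qed

lemma lift_diff: "vlift \<beta> p - vlift \<beta>' p = vlift (\<lambda>y. \<beta> y - \<beta>' y) p"
  by (simp add: vlift_def sform_def cosum_linear)

lemma anchor_lift:
  "anchor P (hlift \<alpha>) p = (anchor PB \<alpha> (fst p), 0)" "anchor P (vlift \<beta>) p = (0, anchor PF \<beta> (snd p))"
proof -
  note bil = B.bivector_bilinear[OF PB] F.bivector_bilinear[OF PF]
  have "anchor PB (\<lambda>x. 0) x = 0" for x
    by (rule covector_separates)
      (simp add: anchor_apply[where P=PB, OF bil(1)] bilinear_lzero[OF bil(1)])
  moreover have "anchor PF (\<lambda>x. 0) y = 0" for y
    by (rule covector_separates)
      (simp add: anchor_apply[where P=PF, OF bil(2)] bilinear_lzero[OF bil(2)])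
  ultimately show "anchor P (hlift \<alpha>) p = (anchor PB \<alpha> (fst p), 0)"
    "anchor P (vlift \<beta>) p = (0, anchor PF \<beta> (snd p))"
    using anchor_product[where PB=PB and PF=PF, OF bil] by (simp_all add: hlift_def vlift_def)
qed

lemma anchor_deriv_lift:
  assumes "u \<in> smooth_functions B" "w \<in> smooth_functions F"
  shows "anchor_deriv M P (vlift \<beta>) (\<lambda>p. u (fst p)) p = 0"
    "anchor_deriv M P (hlift \<alpha>) (\<lambda>p. u (fst p)) p = anchor_deriv B PB \<alpha> u (fst p)"
    "anchor_deriv M P (hlift \<alpha>) (\<lambda>p. w (snd p)) p = 0"
    "anchor_deriv M P (vlift \<beta>) (\<lambda>p. w (snd p)) p = anchor_deriv F PF \<beta> w (snd p)"
  by (simp_all add: anchor_deriv_def anchor_lift differential_fst[OF assms(1)] differential_snd[OF assms(2)]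
      del: product_manifold_simps)

lemma r_smooth: "r \<in> smooth_functions B"
  by (rule B.smooth_functions_powr[OF f_smooth f_pos])

text \<open>Skewness exchanges the two arguments: the derivative is Pi(alpha, df) = -alpha(sharp
  df), and sharp df = 0 for a Casimir function.\<close>

lemma anchor_deriv_f: "anchor_deriv B PB \<alpha> f x = 0"
proof -
  note ap = anchor_apply[where P=PB, OF B.bivector_bilinear[OF PB]]
  have "anchor_deriv B PB \<alpha> f x = PB x (\<alpha> x) (differential B f x)"
    by (simp add: anchor_deriv_def ap)
  also have "\<dots> = - PB x (differential B f x) (\<alpha> x)"
    using PB unfolding bivector_field_def by blast
  also have "\<dots> = - blinfun_apply (\<alpha> x) (anchor PB (differential B f) x)" by (simp add: ap)
  also have "\<dots> = 0" using casimir by (simp add: casimir_def)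
  finally show ?thesis .
qed

text \<open>Differentiating the identity r * f^2 = 1 by the product rule replaces a chain rule for
  powers.\<close>

lemma anchor_deriv_r: "anchor_deriv B PB \<alpha> r x = 0"
proof -
  have "(\<lambda>x. f x * f x) \<in> smooth_functions B" by (intro B.smooth_functions_mult f_smooth)
  from B.anchor_deriv_mult[OF r_smooth this, of PB \<alpha> x]
  have "f x * f x * anchor_deriv B PB \<alpha> r x = 0"
    by (simp add: r_f B.anchor_deriv_const B.anchor_deriv_mult[OF f_smooth f_smooth] anchor_deriv_f)
  then show ?thesis using f_pos[of x] by simp
qed

end

section \<open>The Levi-Civita connection and curvature on lifted forms\<close>

locale warped_levi_civita = warped B F gB gF PB PF f
  for B :: "('a::{t2_space,second_countable_topology}, 'e::euclidean_space) manifold"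
    and F :: "('b::{t2_space,second_countable_topology}, 'd::euclidean_space) manifold"
    and gB gF PB PF f +
  fixes D DF
  assumes D: "levi_civita M P g D" and DF: "levi_civita F PF (cometric gF) DF"
begin

lemma D_form: "\<omega> \<in> one_forms M \<Longrightarrow> \<theta> \<in> one_forms M \<Longrightarrow> D \<omega> \<theta> \<in> one_forms M"
  using D unfolding levi_civita_def by blast

lemma DF_form: "\<beta> \<in> one_forms F \<Longrightarrow> \<gamma> \<in> one_forms F \<Longrightarrow> DF \<beta> \<gamma> \<in> one_forms F"
  using DF unfolding levi_civita_def by blast

lemma D_scale:
  assumes "u \<in> smooth_functions M" "\<omega> \<in> one_forms M" "\<theta> \<in> one_forms M"
  shows "D (\<lambda>p. u p *\<^sub>R \<omega> p) \<theta> = (\<lambda>p. u p *\<^sub>R D \<omega> \<theta> p)"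
    "D \<omega> (\<lambda>p. u p *\<^sub>R \<theta> p) = (\<lambda>p. u p *\<^sub>R D \<omega> \<theta> p + anchor_deriv M P \<omega> u p *\<^sub>R \<theta> p)"
  using D assms unfolding levi_civita_def by blast+

lemma D_zero:
  assumes "\<omega> \<in> one_forms M" shows "D (\<lambda>p. 0) \<omega> = (\<lambda>p. 0)" "D \<omega> (\<lambda>p. 0) = (\<lambda>p. 0)"
  using D_scale[OF M.smooth_functions_const[of 0] assms assms] by (simp_all add: M.anchor_deriv_const)

lemma D_torsion:
  assumes "\<omega> \<in> one_forms M" "\<theta> \<in> one_forms M"
  shows "koszul_bracket M P \<omega> \<theta> p = D \<omega> \<theta> p - D \<theta> \<omega> p"
proof -
  have "(\<lambda>p. D \<omega> \<theta> p - D \<theta> \<omega> p) = koszul_bracket M P \<omega> \<theta>"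
    using D assms unfolding levi_civita_def by blast
  from fun_cong[OF this, of p] show ?thesis by (rule sym)
qed

lemma D_metric:
  "\<omega> \<in> one_forms M \<Longrightarrow> \<theta> \<in> one_forms M \<Longrightarrow> \<zeta> \<in> one_forms M \<Longrightarrow>
    anchor_deriv M P \<omega> (\<lambda>z. g z (\<theta> z) (\<zeta> z)) p = g p (D \<omega> \<theta> p) (\<zeta> p) + g p (\<theta> p) (D \<omega> \<zeta> p)"
  using D unfolding levi_civita_def by blast

lemma DF_torsion:
  assumes "\<beta> \<in> one_forms F" "\<gamma> \<in> one_forms F"
  shows "koszul_bracket F PF \<beta> \<gamma> = (\<lambda>y. DF \<beta> \<gamma> y - DF \<gamma> \<beta> y)"
proof -
  have "(\<lambda>y. DF \<beta> \<gamma> y - DF \<gamma> \<beta> y) = koszul_bracket F PF \<beta> \<gamma>"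
    using DF assms unfolding levi_civita_def by blast
  then show ?thesis by (rule sym)
qed

text \<open>
  No connection is given on \<open>B\<close>; the bracket with the zero form is computed on \<open>B \<times> F\<close>, where it
  vanishes by torsion-freeness of \<open>D\<close>.
\<close>

lemma koszul_sform_zero:
  assumes "\<alpha> \<in> one_forms B" "\<beta> \<in> one_forms F"
  shows "koszul_bracket B PB \<alpha> (\<lambda>x. 0) x = 0" "koszul_bracket B PB (\<lambda>x. 0) \<alpha> x = 0"
    "koszul_bracket F PF \<beta> (\<lambda>x. 0) y = 0" "koszul_bracket F PF (\<lambda>x. 0) \<beta> y = 0"
proof -
  note z = B.one_forms_zero F.one_forms_zero
  note kp = koszul_bracket_product[OF PB PF]
  have zero: "(\<lambda>p. 0) = sform (\<lambda>x. 0) (\<lambda>y. 0)" by (auto simp: sform_def cosum_linear)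
  let ?s = "sform \<alpha> \<beta>"
  have s: "?s \<in> one_forms M" using sform_one_form[OF assms] .
  have "koszul_bracket M P ?s (\<lambda>p. 0) (x, y) = 0" "koszul_bracket M P (\<lambda>p. 0) ?s (x, y) = 0"
    using D_torsion[OF s M.one_forms_zero] D_torsion[OF M.one_forms_zero s] D_zero[OF s] by simp_all
  then have 1: "cosum (koszul_bracket B PB \<alpha> (\<lambda>x. 0) x) (koszul_bracket F PF \<beta> (\<lambda>x. 0) y) = 0"
    and 2: "cosum (koszul_bracket B PB (\<lambda>x. 0) \<alpha> x) (koszul_bracket F PF (\<lambda>x. 0) \<beta> y) = 0"
    unfolding zero using kp[OF assms(1) z(1) assms(2) z(2)] kp[OF z(1) assms(1) z(2) assms(2)]
    by (simp_all add: sform_def del: product_manifold_simps)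
  have c0: "a = 0 \<and> b = 0" if "cosum a b = 0" for a :: "'e \<Rightarrow>\<^sub>L real" and b :: "'d \<Rightarrow>\<^sub>L real"
    using cosum_comp_left[of a b] unfolding that by simp
  show "koszul_bracket B PB \<alpha> (\<lambda>x. 0) x = 0" "koszul_bracket B PB (\<lambda>x. 0) \<alpha> x = 0"
    "koszul_bracket F PF \<beta> (\<lambda>x. 0) y = 0" "koszul_bracket F PF (\<lambda>x. 0) \<beta> y = 0"
    using c0[OF 1] c0[OF 2] by simp_all
qed

lemma koszul_lift:
  assumes a: "\<alpha> \<in> one_forms B" "\<alpha>' \<in> one_forms B" and b: "\<beta> \<in> one_forms F" "\<beta>' \<in> one_forms F"
  shows "koszul_bracket M P (hlift \<alpha>) (hlift \<alpha>') = hlift (koszul_bracket B PB \<alpha> \<alpha>')"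
    "koszul_bracket M P (vlift \<beta>) (vlift \<beta>') = vlift (koszul_bracket F PF \<beta> \<beta>')"
    "koszul_bracket M P (hlift \<alpha>) (vlift \<beta>) = (\<lambda>p. 0)"
    "koszul_bracket M P (vlift \<beta>) (hlift \<alpha>) = (\<lambda>p. 0)"
proof -
  note z = B.one_forms_zero F.one_forms_zero
  note kp = koszul_bracket_product[OF PB PF]
  note k0 = koszul_sform_zero[OF a(1) b(1)] koszul_sform_zero[OF z]
  show "koszul_bracket M P (hlift \<alpha>) (hlift \<alpha>') = hlift (koszul_bracket B PB \<alpha> \<alpha>')"
    unfolding hlift_def kp[OF a z(2) z(2)] by (auto simp: sform_def k0)
  show "koszul_bracket M P (vlift \<beta>) (vlift \<beta>') = vlift (koszul_bracket F PF \<beta> \<beta>')"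
    unfolding vlift_def kp[OF z(1) z(1) b] by (auto simp: sform_def k0)
  show "koszul_bracket M P (hlift \<alpha>) (vlift \<beta>) = (\<lambda>p. 0)"
    unfolding hlift_def vlift_def kp[OF a(1) z(1) z(2) b(1)] by (auto simp: sform_def k0 cosum_linear)
  show "koszul_bracket M P (vlift \<beta>) (hlift \<alpha>) = (\<lambda>p. 0)"
    unfolding hlift_def vlift_def kp[OF z(1) a(1) b(1) z(2)] by (auto simp: sform_def k0 cosum_linear)
qed

lemma koszul_formula_M:
  assumes "\<alpha> \<in> one_forms M" "\<beta> \<in> one_forms M" "\<gamma> \<in> one_forms M"
  shows "2 * g x (D \<alpha> \<beta> x) (\<gamma> x) =
      anchor_deriv M P \<alpha> (\<lambda>z. g z (\<beta> z) (\<gamma> z)) x + anchor_deriv M P \<beta> (\<lambda>z. g z (\<alpha> z) (\<gamma> z)) x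
    - anchor_deriv M P \<gamma> (\<lambda>z. g z (\<alpha> z) (\<beta> z)) x + g x (koszul_bracket M P \<alpha> \<beta> x) (\<gamma> x)
    - g x (koszul_bracket M P \<beta> \<gamma> x) (\<alpha> x) - g x (koszul_bracket M P \<alpha> \<gamma> x) (\<beta> x)"
  by (rule M.koszul_formula[OF D g_bilinear g_sym assms])

lemma koszul_formula_F:
  assumes "\<alpha> \<in> one_forms F" "\<beta> \<in> one_forms F" "\<gamma> \<in> one_forms F"
  shows "2 * cometric gF x (DF \<alpha> \<beta> x) (\<gamma> x) =
      anchor_deriv F PF \<alpha> (\<lambda>z. cometric gF z (\<beta> z) (\<gamma> z)) x
    + anchor_deriv F PF \<beta> (\<lambda>z. cometric gF z (\<alpha> z) (\<gamma> z)) x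
    - anchor_deriv F PF \<gamma> (\<lambda>z. cometric gF z (\<alpha> z) (\<beta> z)) x
    + cometric gF x (koszul_bracket F PF \<alpha> \<beta> x) (\<gamma> x)
    - cometric gF x (koszul_bracket F PF \<beta> \<gamma> x) (\<alpha> x)
    - cometric gF x (koszul_bracket F PF \<alpha> \<gamma> x) (\<beta> x)"
  by (rule F.koszul_formula[OF DF cometric_bilinear[where G=gF, OF GF.inner_form_axioms]
        cometric_sym[where G=gF, OF GF.inner_form_axioms] assms])

text \<open>These are the derivative terms of the Koszul formula. Horizontal anchors kill functions
  on F and, by the Casimir property, the factor \<open>r\<close>; vertical anchors kill every
  function on B, so \<open>r\<close> passes through them as a constant.\<close>

lemma anchor_deriv_g:
  assumes "\<alpha> \<in> one_forms B" "\<alpha>' \<in> one_forms B" "\<beta> \<in> one_forms F" "\<beta>' \<in> one_forms F"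
  shows "anchor_deriv M P (vlift \<gamma>) (\<lambda>z. g z (hlift \<alpha> z) (hlift \<alpha>' z)) p = 0"
    "anchor_deriv M P \<omega> (\<lambda>z. g z (hlift \<alpha> z) (vlift \<beta> z)) p = 0"
    "anchor_deriv M P \<omega> (\<lambda>z. g z (vlift \<beta> z) (hlift \<alpha> z)) p = 0"
    "anchor_deriv M P (hlift \<delta>) (\<lambda>z. g z (vlift \<beta> z) (vlift \<beta>' z)) p = 0"
    "anchor_deriv M P (vlift \<gamma>) (\<lambda>z. g z (vlift \<beta> z) (vlift \<beta>' z)) p
      = r (fst p) * anchor_deriv F PF \<gamma> (\<lambda>z. cometric gF z (\<beta> z) (\<beta>' z)) (snd p)"
proof -
  let ?u = "\<lambda>x. cometric gB x (\<alpha> x) (\<alpha>' x)" and ?w = "\<lambda>y. cometric gF y (\<beta> y) (\<beta>' y)"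
  have u: "?u \<in> smooth_functions B" and w: "?w \<in> smooth_functions F"
    using B.cometric_smooth[OF gB assms(1,2)] F.cometric_smooth[OF gF assms(3,4)] .
  note m = M.anchor_deriv_mult[OF fst_smooth[OF r_smooth] snd_smooth[OF w]]
  show "anchor_deriv M P (vlift \<gamma>) (\<lambda>z. g z (hlift \<alpha> z) (hlift \<alpha>' z)) p = 0"
    unfolding g_lift by (rule anchor_deriv_lift(1)[OF u w])
  show "anchor_deriv M P \<omega> (\<lambda>z. g z (hlift \<alpha> z) (vlift \<beta> z)) p = 0"
    "anchor_deriv M P \<omega> (\<lambda>z. g z (vlift \<beta> z) (hlift \<alpha> z)) p = 0"
    unfolding g_lift by (rule M.anchor_deriv_const)+
  show "anchor_deriv M P (hlift \<delta>) (\<lambda>z. g z (vlift \<beta> z) (vlift \<beta>' z)) p = 0"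
    unfolding g_lift m anchor_deriv_lift[OF r_smooth w] by (simp add: anchor_deriv_r)
  show "anchor_deriv M P (vlift \<gamma>) (\<lambda>z. g z (vlift \<beta> z) (vlift \<beta>' z)) p
      = r (fst p) * anchor_deriv F PF \<gamma> ?w (snd p)"
    unfolding g_lift m anchor_deriv_lift[OF r_smooth w] by simp
qed

text \<open>Against vertical forms the Koszul formula on the product is \<open>r\<close> times that
  on F. Against horizontal forms the only candidate for a nonzero term is the derivative of 1/f^2,
  which is 0.\<close>

lemma D_vertical:
  assumes b: "\<beta> \<in> one_forms F" "\<beta>' \<in> one_forms F"
  shows "D (vlift \<beta>) (vlift \<beta>') = vlift (DF \<beta> \<beta>')"
proof
  fix p
  have "D (vlift \<beta>) (vlift \<beta>') p - vlift (DF \<beta> \<beta>') p = 0"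
  proof (rule covector_zeroI)
    fix \<alpha> assume a: "\<alpha> \<in> one_forms B"
    show "g p (D (vlift \<beta>) (vlift \<beta>') p - vlift (DF \<beta> \<beta>') p) (hlift \<alpha> p) = 0"
      using koszul_formula_M[OF vlift_form[OF b(1)] vlift_form[OF b(2)] hlift_form[OF a], of p,
          unfolded anchor_deriv_g[OF a a b] anchor_deriv_g[OF a a b(2,1)]]
      by (simp add: koszul_lift[OF a a b] koszul_lift[OF a a b(2,1)] g_simps g_lift)
  next
    fix \<gamma> assume c: "\<gamma> \<in> one_forms F"
    note z = B.one_forms_zero
    have "2 * g p (D (vlift \<beta>) (vlift \<beta>') p) (vlift \<gamma> p)
        = r (fst p) * (2 * cometric gF (snd p) (DF \<beta> \<beta>' (snd p)) (\<gamma> (snd p)))"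
      unfolding koszul_formula_M[OF vlift_form[OF b(1)] vlift_form[OF b(2)] vlift_form[OF c]]
        koszul_formula_F[OF b c] anchor_deriv_g[OF z z b] anchor_deriv_g[OF z z b(2) c]
        anchor_deriv_g[OF z z b(1) c]
      by (simp add: koszul_lift[OF z z b] koszul_lift[OF z z b(2) c] koszul_lift[OF z z b(1) c] g_lift
          algebra_simps)
    then show "g p (D (vlift \<beta>) (vlift \<beta>') p - vlift (DF \<beta> \<beta>') p) (vlift \<gamma> p) = 0"
      by (simp add: g_simps g_lift)
  qed
  then show "D (vlift \<beta>) (vlift \<beta>') p = vlift (DF \<beta> \<beta>') p" by simp
qed

text \<open>In an ordinary warped product a logarithmic derivative of f appears here. It would come
  from differentiating \<open>r\<close> along a horizontal anchor, and this vanishes. The second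
  identity follows from the first, since mixed brackets vanish and \<open>D\<close> is
  torsion-free.\<close>

lemma D_mixed:
  assumes a: "\<alpha> \<in> one_forms B" and b: "\<beta> \<in> one_forms F"
  shows "D (hlift \<alpha>) (vlift \<beta>) = (\<lambda>p. 0)" "D (vlift \<beta>) (hlift \<alpha>) = (\<lambda>p. 0)"
proof -
  have 1: "D (hlift \<alpha>) (vlift \<beta>) p = 0" for p
  proof (rule covector_zeroI)
    fix \<gamma> assume c: "\<gamma> \<in> one_forms B"
    show "g p (D (hlift \<alpha>) (vlift \<beta>) p) (hlift \<gamma> p) = 0"
      using koszul_formula_M[OF hlift_form[OF a] vlift_form[OF b] hlift_form[OF c], of p,
          unfolded anchor_deriv_g[OF a c b b] anchor_deriv_g[OF c a b b]]
      by (simp add: koszul_lift[OF a c b b] koszul_lift[OF c a b b] g_simps g_lift)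
  next
    fix \<gamma> assume c: "\<gamma> \<in> one_forms F"
    show "g p (D (hlift \<alpha>) (vlift \<beta>) p) (vlift \<gamma> p) = 0"
      using koszul_formula_M[OF hlift_form[OF a] vlift_form[OF b] vlift_form[OF c], of p,
          unfolded anchor_deriv_g[OF a a b c] anchor_deriv_g[OF a a c b]]
      by (simp add: koszul_lift[OF a a b c] koszul_lift[OF a a c b] g_simps g_lift)
  qed
  then show "D (hlift \<alpha>) (vlift \<beta>) = (\<lambda>p. 0)" by blast
  have "D (vlift \<beta>) (hlift \<alpha>) p = 0" for p
    using D_torsion[OF vlift_form[OF b] hlift_form[OF a], of p] 1[of p] koszul_lift[OF a a b b] by simp
  then show "D (vlift \<beta>) (hlift \<alpha>) = (\<lambda>p. 0)" by blast
qed

text \<open>D(h a)(h a) is never computed. It is orthogonal to all vertical forms; differentiating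
  this orthogonality along a vertical form, whose derivative of a vertical form is again vertical,
  keeps it.\<close>

lemma curvature_horizontal:
  assumes a: "\<alpha> \<in> one_forms B" and b: "\<beta> \<in> one_forms F" "\<gamma> \<in> one_forms F"
  shows "g p (curvature M P D (vlift \<beta>) (hlift \<alpha>) (hlift \<alpha>) p) (vlift \<gamma> p) = 0"
proof -
  note forms = hlift_form[OF a] vlift_form[OF b(1)] vlift_form[OF b(2)]
  \<comment> \<open>Metric compatibility applied to the identically zero function g(h a, v d),
    together with D(h a)(v d) = 0.\<close>
  have vert: "g q (D (hlift \<alpha>) (hlift \<alpha>) q) (vlift \<delta> q) = 0" if d: "\<delta> \<in> one_forms F" for q \<delta>
    using D_metric[OF forms(1) forms(1) vlift_form[OF d], of q]
    by (simp add: anchor_deriv_g[OF a a d d] D_mixed[OF a d] g_simps)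
  have "curvature M P D (vlift \<beta>) (hlift \<alpha>) (hlift \<alpha>) p = D (vlift \<beta>) (D (hlift \<alpha>) (hlift \<alpha>)) p"
    by (simp add: curvature_def D_mixed[OF a b(1)] koszul_lift[OF a a b] D_zero[OF forms(1)])
  moreover have "g p (D (vlift \<beta>) (D (hlift \<alpha>) (hlift \<alpha>)) p) (vlift \<gamma> p) = 0"
    using D_metric[OF forms(2) D_form[OF forms(1) forms(1)] forms(3), of p]
    by (simp add: vert b DF_form D_vertical M.anchor_deriv_const)
  ultimately show ?thesis by simp
qed

text \<open>Scaling by f compensates the 1/f^2 in the cometric, so an orthonormal coframe of F stays
  orthonormal on the product.\<close>

abbreviation "flift \<beta> \<equiv> \<lambda>p. f (fst p) *\<^sub>R vlift \<beta> p"

lemma D_flift: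
  assumes b: "\<beta> \<in> one_forms F" and \<omega>: "\<omega> \<in> one_forms M"
  shows "D (vlift \<beta>) (\<lambda>p. f (fst p) *\<^sub>R \<omega> p) = (\<lambda>p. f (fst p) *\<^sub>R D (vlift \<beta>) \<omega> p)"
  using D_scale(2)[OF fst_smooth[OF f_smooth] vlift_form[OF b] \<omega>]
    anchor_deriv_lift(1)[OF f_smooth F.smooth_functions_const] by simp

text \<open>Vertical anchors do not see functions on B, so f can be moved out of every slot like a
  constant; the two scaled arguments contribute one factor each.\<close>

lemma curvature_vertical:
  assumes b: "\<beta> \<in> one_forms F" "\<eta> \<in> one_forms F"
  shows "curvature M P D (vlift \<beta>) (flift \<eta>) (flift \<eta>) p
    = (f (fst p) * f (fst p)) *\<^sub>R vlift (curvature F PF DF \<beta> \<eta> \<eta>) p"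
proof -
  note ff = fst_smooth[OF f_smooth]
  note DFf = DF_form[OF b] DF_form[OF b(2,1)] DF_form[OF b(2,2)]
  have fl: "flift \<gamma> \<in> one_forms M" if "\<gamma> \<in> one_forms F" for \<gamma>
    by (rule M.one_forms_scale[OF ff vlift_form[OF that]])
  have D1: "D (vlift \<gamma>) (flift \<delta>) = flift (DF \<gamma> \<delta>)" if "\<gamma> \<in> one_forms F" "\<delta> \<in> one_forms F" for \<gamma> \<delta>
    using D_flift[OF that(1) vlift_form[OF that(2)]] D_vertical[OF that] by simp
  have D2: "D (flift \<gamma>) \<omega> = (\<lambda>p. f (fst p) *\<^sub>R D (vlift \<gamma>) \<omega> p)"
    if "\<gamma> \<in> one_forms F" "\<omega> \<in> one_forms M" for \<gamma> \<omega>
    using D_scale(1)[OF ff vlift_form[OF that(1)] that(2)] .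
  have D3: "D (flift \<gamma>) (flift \<delta>) = (\<lambda>p. f (fst p) *\<^sub>R flift (DF \<gamma> \<delta>) p)"
    if "\<gamma> \<in> one_forms F" "\<delta> \<in> one_forms F" for \<gamma> \<delta>
    using D2[OF that(1) fl[OF that(2)]] D1[OF that] by simp
  let ?k = "koszul_bracket F PF \<beta> \<eta>"
  have k: "?k \<in> one_forms F"
    unfolding DF_torsion[OF b] by (rule F.one_forms_diff[OF DFf(1,2)])
  \<comment> \<open>The bracket is read off from torsion-freeness, which avoids a Leibniz rule for
    Lie derivatives.\<close>
  have "koszul_bracket M P (vlift \<beta>) (flift \<eta>) p = flift ?k p" for p
    using D_torsion[OF vlift_form[OF b(1)] fl[OF b(2)], of p] D1[OF b] D2[OF b(2) vlift_form[OF b(1)]]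
      D_vertical[OF b(2,1)] by (simp add: DF_torsion[OF b] lift_diff flip: scaleR_diff_right)
  then have K: "koszul_bracket M P (vlift \<beta>) (flift \<eta>) = flift ?k" by blast
  have 1: "D (vlift \<beta>) (D (flift \<eta>) (flift \<eta>)) p
      = (f (fst p) * f (fst p)) *\<^sub>R vlift (DF \<beta> (DF \<eta> \<eta>)) p"
    unfolding D3[OF b(2,2)] D_flift[OF b(1) fl[OF DFf(3)]] D1[OF b(1) DFf(3)] by simp
  have 2: "D (flift \<eta>) (D (vlift \<beta>) (flift \<eta>)) p
      = (f (fst p) * f (fst p)) *\<^sub>R vlift (DF \<eta> (DF \<beta> \<eta>)) p"
    unfolding D1[OF b] D3[OF b(2) DFf(1)] by simp
  have 3: "D (flift ?k) (flift \<eta>) p = (f (fst p) * f (fst p)) *\<^sub>R vlift (DF ?k \<eta>) p"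
    unfolding D3[OF k b(2)] by simp
  show ?thesis
    unfolding curvature_def K 1 2 3 by (simp add: lift_diff flip: scaleR_diff_right)
qed

section \<open>Comparison of the Ricci curvatures of the product and the fibre\<close>

lemma sum_lessThan_add:
  "(\<Sum>i<m + n. w i) = (\<Sum>i<m. w i) + (\<Sum>j<n. w (m + j))" for w :: "nat \<Rightarrow> real"
  by (induction n) simp_all

text \<open>Both Ricci equations are evaluated on the first coframe form of F. The Ricci values
  agree, while its square length is \<epsilon> on F and \<epsilon>/f^2 on the product.\<close>

lemma warping_constant:
  assumes RM: "ricci_eq M P g D lam" and RF: "ricci_eq F PF (cometric gF) DF lamhat"
  shows "lam = lamhat * (f x * f x)"
proof -
  \<comment> \<open>Any point of F will do, and one exists because types are inhabited; the
    conclusion mentions only the point of B.\<close>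
  fix y :: 'b
  let ?m = "DIM('e)" and ?n = "DIM('d)"
  obtain \<eta>B \<epsilon>B UB where UB: "x \<in> UB" and B: "local_orthonormal_coframe B (cometric gB) UB \<epsilon>B \<eta>B"
    using B.local_coframe[OF gB] by metis
  obtain \<eta>F \<epsilon>F UF where UF: "y \<in> UF" and F: "local_orthonormal_coframe F (cometric gF) UF \<epsilon>F \<eta>F"
    using F.local_coframe[OF gF] by metis
  \<comment> \<open>Indices below the dimension of B carry the base coframe, the remaining ones the
    rescaled fibre coframe shifted by that dimension.\<close>
  define \<eta> where "\<eta> i = (if i < ?m then hlift (\<eta>B i) else flift (\<eta>F (i - ?m)))" for i
  define \<epsilon> where "\<epsilon> i = (if i < ?m then \<epsilon>B i else \<epsilon>F (i - ?m))" for i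
  have fB: "\<eta>B i \<in> one_forms B" "\<epsilon>B i = 1 \<or> \<epsilon>B i = -1" if "i < ?m" for i
    using B that unfolding local_orthonormal_coframe_def by blast+
  have fF: "\<eta>F i \<in> one_forms F" "\<epsilon>F i = 1 \<or> \<epsilon>F i = -1" if "i < ?n" for i
    using F that unfolding local_orthonormal_coframe_def by blast+
  have oB: "cometric gB z (\<eta>B i z) (\<eta>B j z) = (if i = j then \<epsilon>B i else 0)" if "z \<in> UB" "i < ?m" "j < ?m" for z i j
    using B that unfolding local_orthonormal_coframe_def by blast
  have oF: "cometric gF z (\<eta>F i z) (\<eta>F j z) = (if i = j then \<epsilon>F i else 0)" if "z \<in> UF" "i < ?n" "j < ?n" for z i j
    using F that unfolding local_orthonormal_coframe_def by blast
  have scale: "f z * (f z * (r z * c)) = c" for z c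
    using r_f[of z] by (metis mult.assoc mult.commute mult_1)
  have "local_orthonormal_coframe M g (UB \<times> UF) \<epsilon> \<eta>"
    unfolding local_orthonormal_coframe_def
  proof (intro conjI allI impI ballI)
    show "open (UB \<times> UF)" using B F by (simp add: local_orthonormal_coframe_def open_Times)
  next
    fix i assume i: "i < DIM('e \<times> 'd)"
    then have i': "i - ?m < ?n" if "\<not> i < ?m" using that by simp
    show "\<eta> i \<in> one_forms M"
      using hlift_form[OF fB(1)] M.one_forms_scale[OF fst_smooth[OF f_smooth] vlift_form[OF fF(1)[OF i']]]
      unfolding \<eta>_def by simp
    show "\<epsilon> i = 1 \<or> \<epsilon> i = -1" using fB(2) fF(2)[OF i'] unfolding \<epsilon>_def by simp
  next
    fix p i j assume p: "p \<in> UB \<times> UF" and ij: "i < DIM('e \<times> 'd)" "j < DIM('e \<times> 'd)"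
    have ij': "\<not> i < ?m \<Longrightarrow> i - ?m < ?n" "\<not> j < ?m \<Longrightarrow> j - ?m < ?n" using ij by simp_all
    have p': "fst p \<in> UB" "snd p \<in> UF" using p by auto
    show "g p (\<eta> i p) (\<eta> j p) = (if i = j then \<epsilon> i else 0)"
      using oB[OF p'(1)] oF[OF p'(2)] ij'
      by (cases "i < ?m"; cases "j < ?m") (auto simp: \<eta>_def \<epsilon>_def g_simps g_lift scale)
  qed
  \<comment> \<open>Model spaces have positive dimension, so the fibre coframe has a form with index
    0.\<close>
  moreover have n0: "0 < ?n" by simp
  ultimately have "ricci M P g D \<epsilon> \<eta> (vlift (\<eta>F 0)) (vlift (\<eta>F 0)) (x, y)
      = lam * g (x, y) (vlift (\<eta>F 0) (x, y)) (vlift (\<eta>F 0) (x, y))"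
    using RM vlift_form[OF fF(1)[OF n0]] UB UF unfolding ricci_eq_def by blast
  moreover have "ricci M P g D \<epsilon> \<eta> (vlift (\<eta>F 0)) (vlift (\<eta>F 0)) (x, y)
      = ricci F PF (cometric gF) DF \<epsilon>F \<eta>F (\<eta>F 0) (\<eta>F 0) y"
  proof -
    let ?R = "\<lambda>i. \<epsilon> i * g (x, y) (curvature M P D (vlift (\<eta>F 0)) (\<eta> i) (\<eta> i) (x, y)) (vlift (\<eta>F 0) (x, y))"
    have "(\<Sum>i<?m. ?R i) = 0"
      using curvature_horizontal[OF fB(1) fF(1)[OF n0] fF(1)[OF n0]] by (intro sum.neutral) (simp add: \<eta>_def)
    moreover have "(\<Sum>j<?n. ?R (?m + j)) = ricci F PF (cometric gF) DF \<epsilon>F \<eta>F (\<eta>F 0) (\<eta>F 0) y"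
      unfolding ricci_def
    proof (rule sum.cong[OF refl])
      fix j assume "j \<in> {..<?n}"
      then have j: "j < ?n" by simp
      show "?R (?m + j) = \<epsilon>F j * cometric gF y (curvature F PF DF (\<eta>F 0) (\<eta>F j) (\<eta>F j) y) (\<eta>F 0 y)"
        by (simp add: \<eta>_def \<epsilon>_def curvature_vertical[OF fF(1)[OF n0] fF(1)[OF j]] g_simps g_lift scale mult.assoc)
    qed
    ultimately show ?thesis unfolding ricci_def DIM_prod sum_lessThan_add by simp
  qed
  moreover have "ricci F PF (cometric gF) DF \<epsilon>F \<eta>F (\<eta>F 0) (\<eta>F 0) y = lamhat * cometric gF y (\<eta>F 0 y) (\<eta>F 0 y)"
    using RF F fF(1)[OF n0] UF unfolding ricci_eq_def by blast
  ultimately have "lamhat * \<epsilon>F 0 = lam * (r x * \<epsilon>F 0)"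
    using oF[OF UF n0 n0] by (simp add: g_lift)
  \<comment> \<open>The common factor is a sign, hence nonzero, and can be cancelled.\<close>
  then have "lamhat = lam * r x" using fF(2)[OF n0] by auto
  then show ?thesis using r_f[of x] by (simp add: mult.assoc)
qed

end

theorem theorem4p9:
  fixes B :: "('a::{t2_space,second_countable_topology}, 'e::euclidean_space) manifold"
    and F :: "('b::{t2_space,second_countable_topology}, 'd::euclidean_space) manifold"
    and gB :: "('a, 'e) metric" and gF :: "('b, 'd) metric"
    and PB :: "('a, 'e) cotensor" and PF :: "('b, 'd) cotensor"
    and DF :: "('b, 'd) connection"
    and lam lamhat :: real
  assumes "smooth_manifold B" and "DIM('e) \<ge> 2"
    and "pseudo_riemannian_metric B gB" and "poisson_bivector B PB"
    and "smooth_manifold F"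
    and "pseudo_riemannian_metric F gF" and "poisson_bivector F PF"
    and "levi_civita F PF (cometric gF) DF"
    and "ricci_eq F PF (cometric gF) DF lamhat"
    and "lamhat < 0"
  shows "(lam > 0 \<longrightarrow> \<not> (\<exists>f. einstein_poisson_warped_product B gB PB F gF PF f lam)) \<and>
         (lam < 0 \<longrightarrow> (\<forall>f. einstein_poisson_warped_product B gB PB F gF PF f lam \<longrightarrow>
            f = (\<lambda>x. sqrt (lam / lamhat))))"
proof -
  have key: "lam = lamhat * (f x * f x) \<and> f x > 0"
    if E: "einstein_poisson_warped_product B gB PB F gF PF f lam" for f x
  proof -
    obtain D where LC: "levi_civita (product_manifold B F) (product_bivector B PB F PF)
        (cometric (warped_metric B gB F gF f)) D"
      and RM: "ricci_eq (product_manifold B F) (product_bivector B PB F PF)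
        (cometric (warped_metric B gB F gF f)) D lam"
      using E unfolding einstein_poisson_warped_product_def Let_def by blast
    interpret warped_levi_civita B F gB gF PB PF f D DF
      using assms E LC
      by unfold_locales (simp_all add: einstein_poisson_warped_product_def poisson_bivector_def)
    show ?thesis using warping_constant[OF RM assms(9)] f_pos by blast
  qed
  show ?thesis
  proof (intro conjI impI allI notI)
    assume "lam > 0" "\<exists>f. einstein_poisson_warped_product B gB PB F gF PF f lam"
    then obtain f where "einstein_poisson_warped_product B gB PB F gF PF f lam" by blast
    \<comment> \<open>Here \<open>undefined\<close> is just some point of B; one point suffices for
      the contradiction of signs.\<close>
    from key[OF this] have "lam = lamhat * (f undefined * f undefined)" "f undefined > 0" by blast+
    then show False using \<open>lam > 0\<close> \<open>lamhat < 0\<close> mult_neg_pos[of lamhat "f undefined * f undefined"] by simp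
  next
    fix f assume "lam < 0" and E: "einstein_poisson_warped_product B gB PB F gF PF f lam"
    show "f = (\<lambda>x. sqrt (lam / lamhat))"
    proof
      fix x
      have "lam / lamhat = f x * f x" using key[OF E, of x] \<open>lamhat < 0\<close> by simp
      \<comment> \<open>Positivity of f selects the positive square root.\<close>
      then show "f x = sqrt (lam / lamhat)" using key[OF E, of x] by simp
    qed
  qed
qed

end
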